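(* For each $n$, let $A_1(n),\dots,A_k(n)$ and $B_1(n),\dots,B_\ell(n)$ be deterministic matrices in $M_n(\mathbb C)$ and let $U=U(n)$ be an $n\times n$ Haar unitary random matrix. Suppose that (1) $((A_1(n),\dots,A_k(n)),\mathrm{Tr}_n)$ converges in distribution, as $n\to\infty$, to a $k$-tuple of trace class operators on a separable Hilbert space $H$ (with respect to $\mathrm{Tr}_H$); (2) $((B_1(n),\dots,B_\ell(n)),\mathrm{tr}_n)$ converges in distribution, as $n\to\infty$, to an $\ell$-tuple of elements in a non-commutative probability space. Then, almost surely, the pair $(\{A_i(n)\}_{i=1}^k,\{U(n)B_j(n)U(n)^*\}_{j=1}^\ell)$ is asymptotically cyclically monotone with respect to $(\mathrm{Tr}_n,\mathrm{tr}_n)$.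
   Context: $\mathrm{Tr}_n$ is the non-normalized trace on $M_n(\mathbb C)$, $\mathrm{tr}_n=\frac1n\mathrm{Tr}_n$, and $\mathrm{Tr}_H$ is the trace on trace class operators on $H$. The $U(n)$ are defined on a common probability space; $U(n)$ has the normalized Haar measure on the unitary group as its law. A non-commutative measure space $(\mathcal A,\omega)$ is a (unital or non-unital) $*$-algebra $\mathcal A$ over $\mathbb C$ with a tracial weight $\omega$: a linear map $\omega:\mathrm D(\omega)\to\mathbb C$ on a (possibly non-unital) $*$-subalgebra $\mathrm D(\omega)\subset\mathcal A$ with $\omega(a^*a)\ge 0$, $\omega(a^* )=\overline{\omega(a)}$, $\omega(ab)=\omega(ba)$ for $a,b\in \mathrm D(\omega)$. If $\mathcal A$ is unital, $\mathrm D(\omega)=\mathcal A$ and $\omega(1)=1$, it is a non-commutative probability space. A non-commutative probability space with a tracial weight $(\mathcal C,\omega,\tau)$ consists of a non-commutative probability space $(\mathcal C,\tau)$ and a tracial weight $\omega$ on $\mathcal C$. (For matrices, $\mathcal C=M_n(\mathbb C)$, $\omega=\mathrm{Tr}_n$ with domain $M_n(\mathbb C)$, $\tau=\mathrm{tr}_n$.) Convergence in distribution: $((x_1(n),\dots,x_k(n)),\omega_n)$ converges in distribution to $((x_1,\dots,x_k),\omega)$ if $\omega_n(x_{i_1}(n)^{\varepsilon_1}\cdots x_{i_p}(n)^{\varepsilon_p})\to\omega(x_{i_1}^{\varepsilon_1}\cdots x_{i_p}^{\varepsilon_p})$ for all $p\ge1$, $1\le i_1,\dots,i_p\le k$, $\varepsilon_j\in\{1,*\}$.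 Cyclic monotone independence: for $*$-subalgebras $\mathcal A,\mathcal B$ of $\mathcal C$ with $1_{\mathcal C}\in\mathcal B$, let $\mathrm{Ideal}_{\mathcal B}(\mathcal A)=\mathrm{span}\{b_0a_1b_1\cdots a_nb_n: n\ge1,\ a_i\in\mathcal A,\ b_i\in\mathcal B\}$. The pair $(\mathcal A,\mathcal B)$ is cyclically monotone with respect to $(\omega,\tau)$ if $\mathrm{Ideal}_{\mathcal B}(\mathcal A)\subset\mathrm D(\omega)$ and $\omega(a_1b_1a_2b_2\cdots a_nb_n)=\omega(a_1a_2\cdots a_n)\tau(b_1)\cdots\tau(b_n)$ for all $n\ge1$, $a_i\in\mathcal A$, $b_i\in\mathcal B$. For $a_1,\dots,a_k\in\mathrm D(\omega)$ and $b_1,\dots,b_\ell\in\mathcal C$, the pair $(\{a_i\},\{b_j\})$ is cyclically monotone if the pair (non-unital $*$-algebra generated by the $a_i$, unital $*$-algebra generated by the $b_j$ and $1_{\mathcal C}$) is. Asymptotic version: given $(\mathcal C_n,\omega_n,\tau_n)$, $a_i(n)\in\mathrm D(\omega_n)$ and $b_j(n)\in\mathcal C_n$, the pair $(\{a_i(n)\}_{i=1}^k,\{b_j(n)\}_{j=1}^\ell)$ is asymptotically cyclically monotone if there exist $(\mathcal C,\omega,\tau)$, $a_1,\dots,a_k\in\mathrm D(\omega)$ and $b_1,\dots,b_\ell\in\mathcal C$ such that $(\{a_i\},\{b_j\})$ is cyclically monotone and, for every non-commutative $*$-polynomial $P(x_1,\dots,x_k,y_1,\dots,y_\ell)$ with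 $P(0,\dots,0,y_1,\dots,y_\ell)=0$, one has $P(\{a_i(n)\},\{b_j(n)\})\in\mathrm D(\omega_n)$ and $\omega_n(P(\{a_i(n)\},\{b_j(n)\}))\to\omega(P(\{a_i\},\{b_j\}))$ as $n\to\infty$. *)

theory Defs
  imports
    "HOL-Probability.Probability"
    "HOL-Library.Poly_Mapping"
    "Jordan_Normal_Form.VS_Connect"
    "Jordan_Normal_Form.Schur_Decomposition"
begin

section \<open>Non-commutative measure and probability spaces\<close>

text \<open>
  The field \<open>one\<close> of the record is meaningless for a \<open>star_algebra\<close> and is the unit for a
  \<open>unital_star_algebra\<close>.
\<close>

record 'a star_alg = "(complex, 'a) module" +
  star :: "'a \<Rightarrow> 'a"

locale star_algebra = Module.module "class_ring :: complex ring" A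
  for A :: "('a, 'm) star_alg_scheme" (structure) +
  assumes mult_closed: "x \<in> carrier A \<Longrightarrow> y \<in> carrier A \<Longrightarrow> x \<otimes> y \<in> carrier A"
    and mult_assoc: "x \<in> carrier A \<Longrightarrow> y \<in> carrier A \<Longrightarrow> z \<in> carrier A \<Longrightarrow>
          (x \<otimes> y) \<otimes> z = x \<otimes> (y \<otimes> z)"
    and distrib_right: "x \<in> carrier A \<Longrightarrow> y \<in> carrier A \<Longrightarrow> z \<in> carrier A \<Longrightarrow>
          (x \<oplus> y) \<otimes> z = x \<otimes> z \<oplus> y \<otimes> z"
    and distrib_left: "x \<in> carrier A \<Longrightarrow> y \<in> carrier A \<Longrightarrow> z \<in> carrier A \<Longrightarrow>
          z \<otimes> (x \<oplus> y) = z \<otimes> x \<oplus> z \<otimes> y"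
    and smult_mult_left: "x \<in> carrier A \<Longrightarrow> y \<in> carrier A \<Longrightarrow> (c \<odot> x) \<otimes> y = c \<odot> (x \<otimes> y)"
    and smult_mult_right: "x \<in> carrier A \<Longrightarrow> y \<in> carrier A \<Longrightarrow> x \<otimes> (c \<odot> y) = c \<odot> (x \<otimes> y)"
    and star_closed: "x \<in> carrier A \<Longrightarrow> star A x \<in> carrier A"
    and star_star: "x \<in> carrier A \<Longrightarrow> star A (star A x) = x"
    and star_add: "x \<in> carrier A \<Longrightarrow> y \<in> carrier A \<Longrightarrow> star A (x \<oplus> y) = star A x \<oplus> star A y"
    and star_smult: "x \<in> carrier A \<Longrightarrow> star A (c \<odot> x) = cnj c \<odot> star A x"
    and star_mult: "x \<in> carrier A \<Longrightarrow> y \<in> carrier A \<Longrightarrow> star A (x \<otimes> y) = star A y \<otimes> star A x"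

locale unital_star_algebra = star_algebra +
  assumes one_closed: "\<one> \<in> carrier A"
    and one_mult: "x \<in> carrier A \<Longrightarrow> \<one> \<otimes> x = x"
    and mult_one: "x \<in> carrier A \<Longrightarrow> x \<otimes> \<one> = x"

definition linear_subspace :: "('a, 'm) star_alg_scheme \<Rightarrow> 'a set \<Rightarrow> bool" where
  "linear_subspace A V \<longleftrightarrow> V \<subseteq> carrier A \<and> \<zero>\<^bsub>A\<^esub> \<in> V \<and>
     (\<forall>x\<in>V. \<forall>y\<in>V. x \<oplus>\<^bsub>A\<^esub> y \<in> V) \<and> (\<forall>c. \<forall>x\<in>V. c \<odot>\<^bsub>A\<^esub> x \<in> V)"

definition star_subalgebra :: "('a, 'm) star_alg_scheme \<Rightarrow> 'a set \<Rightarrow> bool" where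
  "star_subalgebra A S \<longleftrightarrow> linear_subspace A S \<and>
     (\<forall>x\<in>S. \<forall>y\<in>S. x \<otimes>\<^bsub>A\<^esub> y \<in> S) \<and> (\<forall>x\<in>S. star A x \<in> S)"

locale tracial_weight = star_algebra +
  fixes D :: "'a set" and \<omega> :: "'a \<Rightarrow> complex"
  assumes domain: "star_subalgebra A D"
    and weight_add: "x \<in> D \<Longrightarrow> y \<in> D \<Longrightarrow> \<omega> (x \<oplus> y) = \<omega> x + \<omega> y"
    and weight_smult: "x \<in> D \<Longrightarrow> \<omega> (c \<odot> x) = c * \<omega> x"
    and weight_positive: "x \<in> D \<Longrightarrow> \<omega> (star A x \<otimes> x) \<in> \<real>\<^sub>\<ge>\<^sub>0"
    and weight_star: "x \<in> D \<Longrightarrow> \<omega> (star A x) = cnj (\<omega> x)"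
    and weight_tracial: "x \<in> D \<Longrightarrow> y \<in> D \<Longrightarrow> \<omega> (x \<otimes> y) = \<omega> (y \<otimes> x)"

locale nc_prob_space = unital_star_algebra A + tracial_weight A "carrier A" \<tau>
  for A :: "('a, 'm) star_alg_scheme" (structure) and \<tau> :: "'a \<Rightarrow> complex" +
  assumes state_one: "\<tau> \<one> = 1"

locale nc_prob_space_with_weight = nc_prob_space A \<tau> + tracial_weight A D \<omega>
  for A :: "('a, 'm) star_alg_scheme" (structure)
    and D :: "'a set" and \<omega> :: "'a \<Rightarrow> complex" and \<tau> :: "'a \<Rightarrow> complex"


section \<open>Words, polynomials and convergence in distribution\<close>

text \<open>
  The second equation keeps products of nonempty lists free of the unit, as needed in
  non-unital algebras.
\<close>

fun alg_prod :: "('a, 'm) star_alg_scheme \<Rightarrow> 'a list \<Rightarrow> 'a" where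
  "alg_prod A [] = \<one>\<^bsub>A\<^esub>"
| "alg_prod A [x] = x"
| "alg_prod A (x # y # zs) = x \<otimes>\<^bsub>A\<^esub> alg_prod A (y # zs)"

text \<open>A letter \<open>(v, s)\<close> is the variable \<open>v\<close> if \<open>s\<close> is false and its adjoint if \<open>s\<close> is true.\<close>

definition word_eval ::
    "('a, 'm) star_alg_scheme \<Rightarrow> ('v \<Rightarrow> 'a) \<Rightarrow> ('v \<times> bool) list \<Rightarrow> 'a" where
  "word_eval A f w = alg_prod A (map (\<lambda>(v, s). if s then star A (f v) else f v) w)"

definition converges_in_distribution ::
    "nat \<Rightarrow> (nat \<Rightarrow> ('a, 'm) star_alg_scheme) \<Rightarrow> (nat \<Rightarrow> 'a \<Rightarrow> complex) \<Rightarrow> (nat \<Rightarrow> nat \<Rightarrow> 'a) \<Rightarrow>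
     ('b, 'q) star_alg_scheme \<Rightarrow> ('b \<Rightarrow> complex) \<Rightarrow> (nat \<Rightarrow> 'b) \<Rightarrow> bool" where
  "converges_in_distribution k An \<omega>n xn A \<omega> x \<longleftrightarrow>
     (\<forall>w. w \<noteq> [] \<and> (\<forall>(i, s)\<in>set w. i < k) \<longrightarrow>
        (\<lambda>n. \<omega>n n (word_eval (An n) (xn n) w)) \<longlonglongrightarrow> \<omega> (word_eval A x w))"

text \<open>
  Non-commutative *-polynomials are finitely supported families of coefficients, indexed by
  words in the variables \<open>Inl i\<close> (written \<open>x\<^sub>i\<close> in the comments) and \<open>Inr j\<close> (written
  \<open>y\<^sub>j\<close>) and their adjoints. Indices of both families start at \<open>0\<close>.
\<close>

type_synonym ncpoly = "((nat + nat) \<times> bool) list \<Rightarrow>\<^sub>0 complex"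

definition ncpolys :: "nat \<Rightarrow> nat \<Rightarrow> ncpoly set" where
  "ncpolys k l = {P. \<forall>w\<in>Poly_Mapping.keys P. \<forall>(v, s)\<in>set w. v \<in> Inl ` {..<k} \<union> Inr ` {..<l}}"

definition ncpoly_eval ::
    "('a, 'm) star_alg_scheme \<Rightarrow> (nat \<Rightarrow> 'a) \<Rightarrow> (nat \<Rightarrow> 'a) \<Rightarrow> ncpoly \<Rightarrow> 'a" where
  "ncpoly_eval A x y P =
     (\<Oplus>\<^bsub>A\<^esub>w\<in>Poly_Mapping.keys P. Poly_Mapping.lookup P w \<odot>\<^bsub>A\<^esub>
        word_eval A (case_sum x y) w)"

text \<open>\<open>P(0,\<dots>,0,y)\<close>: every monomial containing some \<open>x\<^sub>i\<close> or its adjoint becomes \<open>0\<close>.\<close>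

definition subst_x_zero :: "ncpoly \<Rightarrow> ncpoly" where
  "subst_x_zero P =
     (\<Sum>w\<in>Poly_Mapping.keys P.
        if \<exists>i s. (Inl i, s) \<in> set w then 0
        else Poly_Mapping.single w (Poly_Mapping.lookup P w))"


section \<open>Cyclic monotone independence\<close>

definition lin_span :: "('a, 'm) star_alg_scheme \<Rightarrow> 'a set \<Rightarrow> 'a set" where
  "lin_span A S = \<Inter>{V. linear_subspace A V \<and> S \<subseteq> V}"

definition gen_star_subalgebra :: "('a, 'm) star_alg_scheme \<Rightarrow> 'a set \<Rightarrow> 'a set" where
  "gen_star_subalgebra A S = \<Inter>{T. star_subalgebra A T \<and> S \<subseteq> T}"

text \<open>A list \<open>[(a\<^sub>1,b\<^sub>1),\<dots>,(a\<^sub>n,b\<^sub>n)]\<close> stands for the product \<open>a\<^sub>1 b\<^sub>1 \<dots> a\<^sub>n b\<^sub>n\<close>.\<close>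

definition interleave :: "('a \<times> 'a) list \<Rightarrow> 'a list" where
  "interleave ps = concat (map (\<lambda>(a, b). [a, b]) ps)"

definition ideal_over :: "('a, 'm) star_alg_scheme \<Rightarrow> 'a set \<Rightarrow> 'a set \<Rightarrow> 'a set" where
  "ideal_over C B A = lin_span C
     {alg_prod C (b\<^sub>0 # interleave ps) | b\<^sub>0 ps. b\<^sub>0 \<in> B \<and> ps \<noteq> [] \<and> set ps \<subseteq> A \<times> B}"

definition cyclically_monotone ::
    "('a, 'm) star_alg_scheme \<Rightarrow> 'a set \<Rightarrow> ('a \<Rightarrow> complex) \<Rightarrow> ('a \<Rightarrow> complex) \<Rightarrow>
     'a set \<Rightarrow> 'a set \<Rightarrow> bool" where
  "cyclically_monotone C D \<omega> \<tau> A B \<longleftrightarrow>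
     star_subalgebra C A \<and> star_subalgebra C B \<and> \<one>\<^bsub>C\<^esub> \<in> B \<and>
     ideal_over C B A \<subseteq> D \<and>
     (\<forall>ps. ps \<noteq> [] \<and> set ps \<subseteq> A \<times> B \<longrightarrow>
        \<omega> (alg_prod C (interleave ps)) =
        \<omega> (alg_prod C (map fst ps)) * (\<Prod>(a, b)\<leftarrow>ps. \<tau> b))"

definition cyclically_monotone_families ::
    "('a, 'm) star_alg_scheme \<Rightarrow> 'a set \<Rightarrow> ('a \<Rightarrow> complex) \<Rightarrow> ('a \<Rightarrow> complex) \<Rightarrow>
     nat \<Rightarrow> (nat \<Rightarrow> 'a) \<Rightarrow> nat \<Rightarrow> (nat \<Rightarrow> 'a) \<Rightarrow> bool" where
  "cyclically_monotone_families C D \<omega> \<tau> k a l b \<longleftrightarrow>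
     cyclically_monotone C D \<omega> \<tau>
       (gen_star_subalgebra C (a ` {..<k})) (gen_star_subalgebra C (insert \<one>\<^bsub>C\<^esub> (b ` {..<l})))"

text \<open>
  The limit space \<open>C\<close> is sought with elements of type \<^typ>\<open>ncpoly\<close>, since HOL has no
  quantification over types. This is no restriction: if some \<open>C\<close> over an arbitrary type
  satisfies the conditions with \<open>a\<close> and \<open>b\<close>, then so does the free unital *-algebra of all
  *-polynomials, with \<open>\<omega>\<close>, \<open>\<tau>\<close> and the domain of \<open>\<omega>\<close> pulled back along the evaluation at
  \<open>a\<close> and \<open>b\<close> (superfluous variables being sent to \<open>0\<close>). Other *-algebras whose elements have
  this type are allowed as well.

  The index \<open>n\<close> of the approximating spaces starts at \<open>1\<close>.
\<close>

definition asymptotically_cyclically_monotone ::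
    "(nat \<Rightarrow> ('a, 'm) star_alg_scheme) \<Rightarrow> (nat \<Rightarrow> 'a set) \<Rightarrow> (nat \<Rightarrow> 'a \<Rightarrow> complex) \<Rightarrow>
     (nat \<Rightarrow> 'a \<Rightarrow> complex) \<Rightarrow> nat \<Rightarrow> (nat \<Rightarrow> nat \<Rightarrow> 'a) \<Rightarrow> nat \<Rightarrow> (nat \<Rightarrow> nat \<Rightarrow> 'a) \<Rightarrow> bool" where
  "asymptotically_cyclically_monotone Cn Dn \<omega>n \<tau>n k an l bn \<longleftrightarrow>
     (\<forall>n\<ge>1. nc_prob_space_with_weight (Cn n) (Dn n) (\<omega>n n) (\<tau>n n) \<and>
        (\<forall>i<k. an n i \<in> Dn n) \<and> (\<forall>j<l. bn n j \<in> carrier (Cn n))) \<and>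
     (\<exists>(C :: ncpoly star_alg) D \<omega> \<tau> a b.
        nc_prob_space_with_weight C D \<omega> \<tau> \<and>
        (\<forall>i<k. a i \<in> D) \<and> (\<forall>j<l. b j \<in> carrier C) \<and>
        cyclically_monotone_families C D \<omega> \<tau> k a l b \<and>
        (\<forall>P\<in>ncpolys k l. subst_x_zero P = 0 \<longrightarrow>
           (\<forall>n\<ge>1. ncpoly_eval (Cn n) (an n) (bn n) P \<in> Dn n) \<and>
           (\<lambda>n. \<omega>n n (ncpoly_eval (Cn n) (an n) (bn n) P)) \<longlonglongrightarrow> \<omega> (ncpoly_eval C a b P)))"


section \<open>Matrices and Haar unitary random matrices\<close>

definition matrix_alg :: "nat \<Rightarrow> complex mat star_alg" where
  "matrix_alg n =
     \<lparr>carrier = carrier_mat n n, mult = (*), one = 1\<^sub>m n, zero = 0\<^sub>m n n, add = (+),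
      smult = (\<cdot>\<^sub>m), star = mat_adjoint\<rparr>"

definition Tr :: "complex mat \<Rightarrow> complex" where
  "Tr X = (\<Sum>i<dim_row X. X $$ (i, i))"

definition tr :: "complex mat \<Rightarrow> complex" where
  "tr X = Tr X / of_nat (dim_row X)"

definition unitary_group :: "nat \<Rightarrow> complex mat set" where
  "unitary_group n =
     {V \<in> carrier_mat n n. mat_adjoint V * V = 1\<^sub>m n \<and> V * mat_adjoint V = 1\<^sub>m n}"

text \<open>The trace on the unitary group of the Borel sets of complex \<open>n \<times> n\<close> matrices.\<close>

definition borel_unitary :: "nat \<Rightarrow> complex mat measure" where
  "borel_unitary n = vimage_algebra (unitary_group n)
     (\<lambda>V. \<lambda>ij\<in>{..<n} \<times> {..<n}. V $$ ij) (\<Pi>\<^sub>M ij\<in>{..<n} \<times> {..<n}. borel)"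

definition normalized_haar_measure :: "nat \<Rightarrow> complex mat measure \<Rightarrow> bool" where
  "normalized_haar_measure n \<mu> \<longleftrightarrow>
     prob_space \<mu> \<and> sets \<mu> = sets (borel_unitary n) \<and>
     (\<forall>V\<in>unitary_group n. distr \<mu> (borel_unitary n) (\<lambda>W. V * W) = \<mu>)"

definition haar_unitary :: "'w measure \<Rightarrow> nat \<Rightarrow> ('w \<Rightarrow> complex mat) \<Rightarrow> bool" where
  "haar_unitary M n U \<longleftrightarrow> U \<in> measurable M (borel_unitary n) \<and>
     normalized_haar_measure n (distr M (borel_unitary n) U)"


section \<open>Trace class operators on a complex Hilbert space\<close>

class complex_hilbert_space = banach +
  fixes scaleC :: "complex \<Rightarrow> 'a \<Rightarrow> 'a"
    and cinner :: "'a \<Rightarrow> 'a \<Rightarrow> complex"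
  assumes scaleC_add_right: "scaleC c (x + y) = scaleC c x + scaleC c y"
    and scaleC_add_left: "scaleC (c + d) x = scaleC c x + scaleC d x"
    and scaleC_scaleC: "scaleC c (scaleC d x) = scaleC (c * d) x"
    and scaleC_of_real: "scaleC (complex_of_real r) x = scaleR r x"
    and cinner_commute: "cinner x y = cnj (cinner y x)"
    and cinner_add_left: "cinner (x + y) z = cinner x z + cinner y z"
    and cinner_scaleC_left: "cinner (scaleC c x) y = c * cinner x y"
    and cinner_self: "cinner x x = complex_of_real ((norm x)\<^sup>2)"

definition bounded_operator :: "('h :: complex_hilbert_space \<Rightarrow> 'h) \<Rightarrow> bool" where
  "bounded_operator T \<longleftrightarrow> bounded_linear T \<and> (\<forall>c x. T (scaleC c x) = scaleC c (T x))"

text \<open>Used for bounded operators only, where existence and uniqueness hold.\<close>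

definition adjoint_op :: "('h :: complex_hilbert_space \<Rightarrow> 'h) \<Rightarrow> 'h \<Rightarrow> 'h" where
  "adjoint_op T = (THE S. \<forall>x y. cinner (T x) y = cinner x (S y))"

definition positive_operator :: "('h :: complex_hilbert_space \<Rightarrow> 'h) \<Rightarrow> bool" where
  "positive_operator S \<longleftrightarrow> bounded_operator S \<and> (\<forall>x. cinner (S x) x \<in> \<real>\<^sub>\<ge>\<^sub>0)"

text \<open>The operator absolute value, that is, the positive square root of \<open>T\<^sup>* T\<close>.\<close>

definition abs_op :: "('h :: complex_hilbert_space \<Rightarrow> 'h) \<Rightarrow> 'h \<Rightarrow> 'h" where
  "abs_op T = (THE S. positive_operator S \<and> S \<circ> S = adjoint_op T \<circ> T)"

definition is_onb :: "'h :: complex_hilbert_space set \<Rightarrow> bool" where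
  "is_onb E \<longleftrightarrow> (\<forall>e\<in>E. norm e = 1) \<and> (\<forall>e\<in>E. \<forall>f\<in>E. e \<noteq> f \<longrightarrow> cinner e f = 0) \<and>
     (\<forall>x. (\<forall>e\<in>E. cinner x e = 0) \<longrightarrow> x = 0)"

text \<open>
  An orthonormal basis exists, and neither the summability in \<open>trace_class\<close> nor the value of
  \<open>trace_op\<close> on trace class operators depends on its choice.
\<close>

definition trace_class :: "('h :: complex_hilbert_space \<Rightarrow> 'h) set" where
  "trace_class = {T. bounded_operator T \<and>
     (\<exists>E. is_onb E \<and> (\<lambda>e. cinner (abs_op T e) e) summable_on E)}"

definition trace_op :: "('h :: complex_hilbert_space \<Rightarrow> 'h) \<Rightarrow> complex" where
  "trace_op T = (\<Sum>\<^sub>\<infinity>e\<in>(SOME E. is_onb E). cinner (T e) e)"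

text \<open>A non-unital *-algebra in general: \<open>one\<close> lies in the carrier only in finite dimension.\<close>

definition trace_class_alg :: "('h :: complex_hilbert_space \<Rightarrow> 'h) star_alg" where
  "trace_class_alg =
     \<lparr>carrier = trace_class, mult = (\<circ>), one = id, zero = (\<lambda>x. 0), add = (\<lambda>S T x. S x + T x),
      smult = (\<lambda>c T x. scaleC c (T x)), star = adjoint_op\<rparr>"

end

theory Submission
  imports Defs
begin

text \<open>
  Write \<open>C\<^sub>b = U b U\<^sup>*\<close>. The left invariance of the Haar measure, differentiated at the identity,
  gives a Schwinger-Dyson equation that expresses \<open>n\<close> times the mean of a product of traces
  \<open>Tr (x\<^sub>1 C\<^sub>b\<^sub>1 \<dots> x\<^sub>m C\<^sub>b\<^sub>m)\<close> with all \<open>tr b\<^sub>i = 0\<close> by means of products of the same kind with the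
  letters regrouped, and by means of products in which two letters \<open>C\<^sub>b\<close>, \<open>C\<^sub>c\<close> have merged into
  \<open>C\<^sub>b\<^sub>c\<close>, which has to be centered anew. As the traces \<open>Tr x\<close> and \<open>tr b\<close> of all words stay bounded,
  induction on the number \<open>N\<close> of letters \<open>C\<^sub>b\<close> bounds the mean by \<open>O(n\<^sup>-\<^sup>N\<^sup>/\<^sup>2)\<close>. So the fourth moment of the
  trace of a nonempty centered word is summable, and this trace tends to zero almost surely.
  Splitting each \<open>b\<close> into its centered part and its trace yields
  \<open>Tr (x\<^sub>1 C\<^sub>b\<^sub>1 \<dots> x\<^sub>m C\<^sub>b\<^sub>m) - Tr (x\<^sub>1 \<dots> x\<^sub>m) tr b\<^sub>1 \<dots> tr b\<^sub>m \<longrightarrow> 0\<close> almost surely, simultaneously for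
  the countably many words in the given matrices. Outside the exceptional null set, the limits of
  \<open>Tr\<close> and \<open>tr\<close> make the algebra of all *-polynomials into the limit space; positivity and
  traciality are inherited from the matrices.
\<close>

section \<open>Square matrices\<close>

text \<open>Convergence of moments gives no bound on operator norms, so no error term can be
  estimated by norms: each one has to be rewritten as a product of traces of words. This is why the
  letters are required to be closed under products, adjoints and centering.

  The exponent -N/2 reflects the bookkeeping of the equation. Its left side carries the factor n,
  while merging C_b with C_c costs one letter and the scalar part of the recentered C_bc costs
  another; so one factor 1/n pays for two letters. The traces of the x stay bounded without
  normalization, hence an x that is set free on the way costs no power of n. The terms that keep all
  N letters are out of reach of an induction on N; there are N - 1 of them, each with coefficient
  -1, against the factor n on the left. Centering removes the one other term that could compete with
  the left side, since its coefficient is Tr C_b = Tr b.\<close>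

lemma adjoint_dim [simp]:
  "dim_row (mat_adjoint X) = dim_col X" "dim_col (mat_adjoint X) = dim_row X"
  unfolding mat_adjoint_def by auto

lemma adjoint_carrier [simp]: "X \<in> carrier_mat n m \<Longrightarrow> mat_adjoint X \<in> carrier_mat m n"
  by auto

lemma adjoint_index [simp]:
  fixes X :: "complex mat"
  assumes "i < dim_col X" "j < dim_row X"
  shows "mat_adjoint X $$ (i, j) = cnj (X $$ (j, i))"
  using assms unfolding mat_adjoint_def by (subst mat_of_rows_index) auto

lemma mult_index:
  assumes "X \<in> carrier_mat n m" "Y \<in> carrier_mat m p" "i < n" "j < p"
  shows "(X * Y) $$ (i, j) = (\<Sum>k<m. X $$ (i, k) * Y $$ (k, j))"
  using assms by (auto simp: scalar_prod_def atLeast0LessThan)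

lemma adjoint_mult:
  fixes X :: "complex mat"
  assumes "X \<in> carrier_mat n m" "Y \<in> carrier_mat m p"
  shows "mat_adjoint (X * Y) = mat_adjoint Y * mat_adjoint X"
proof (rule eq_matI)
  fix i j assume "i < dim_row (mat_adjoint Y * mat_adjoint X)" "j < dim_col (mat_adjoint Y * mat_adjoint X)"
  with assms have ij: "i < p" "j < n"
    using adjoint_carrier[OF assms(1)] adjoint_carrier[OF assms(2)] by auto
  have "mat_adjoint (X * Y) $$ (i, j) = cnj ((X * Y) $$ (j, i))"
    using assms ij by simp
  also have "\<dots> = (\<Sum>k<m. cnj (X $$ (j, k)) * cnj (Y $$ (k, i)))"
    using assms ij by (simp add: mult_index del: index_mult_mat)
  also have "\<dots> = (\<Sum>k<m. mat_adjoint Y $$ (i, k) * mat_adjoint X $$ (k, j))"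
    using assms ij by (intro sum.cong) auto
  also have "\<dots> = (mat_adjoint Y * mat_adjoint X) $$ (i, j)"
    using assms ij by (simp add: mult_index[OF adjoint_carrier adjoint_carrier] del: index_mult_mat)
  finally show "mat_adjoint (X * Y) $$ (i, j) = (mat_adjoint Y * mat_adjoint X) $$ (i, j)" .
qed (use assms adjoint_carrier[OF assms(1)] adjoint_carrier[OF assms(2)] adjoint_carrier[of "X * Y" n p] in auto)

lemma adjoint_adjoint [simp]:
  fixes X :: "complex mat"
  shows "mat_adjoint (mat_adjoint X) = X"
proof -
  have X: "X \<in> carrier_mat (dim_row X) (dim_col X)" by simp
  show ?thesis
    by (intro eq_matI) auto
qed

lemma adjoint_add:
  fixes X :: "complex mat"
  assumes "X \<in> carrier_mat n m" "Y \<in> carrier_mat n m"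
  shows "mat_adjoint (X + Y) = mat_adjoint X + mat_adjoint Y"
  using assms adjoint_carrier[OF assms(1)] adjoint_carrier[OF assms(2)] adjoint_carrier[of "X + Y" n m]
  by (intro eq_matI) auto

lemma adjoint_smult:
  fixes X :: "complex mat"
  assumes "X \<in> carrier_mat n m"
  shows "mat_adjoint (c \<cdot>\<^sub>m X) = cnj c \<cdot>\<^sub>m mat_adjoint X"
  using assms adjoint_carrier[OF assms] adjoint_carrier[of "c \<cdot>\<^sub>m X" n m]
  by (intro eq_matI) auto

lemma adjoint_one [simp]: "mat_adjoint (1\<^sub>m n :: complex mat) = 1\<^sub>m n"
  using adjoint_carrier[of "1\<^sub>m n :: complex mat" n n] by (intro eq_matI) auto

lemma adjoint_zero [simp]: "mat_adjoint (0\<^sub>m n m :: complex mat) = 0\<^sub>m m n"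
  using adjoint_carrier[of "0\<^sub>m n m :: complex mat" n m] by (intro eq_matI) auto

lemma Tr_eq: "X \<in> carrier_mat n n \<Longrightarrow> Tr X = (\<Sum>i<n. X $$ (i, i))"
  by (auto simp: Tr_def)

lemma Tr_add: "X \<in> carrier_mat n n \<Longrightarrow> Y \<in> carrier_mat n n \<Longrightarrow> Tr (X + Y) = Tr X + Tr Y"
  by (simp add: Tr_def sum.distrib)

lemma Tr_minus: "X \<in> carrier_mat n n \<Longrightarrow> Y \<in> carrier_mat n n \<Longrightarrow> Tr (X - Y) = Tr X - Tr Y"
  by (simp add: Tr_def sum_subtractf)

lemma Tr_smult: "X \<in> carrier_mat n n \<Longrightarrow> Tr (c \<cdot>\<^sub>m X) = c * Tr X"
  by (simp add: Tr_def sum_distrib_left)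

lemma Tr_zero [simp]: "Tr (0\<^sub>m n n) = 0"
  by (simp add: Tr_def)

lemma Tr_one [simp]: "Tr (1\<^sub>m n) = of_nat n"
  by (simp add: Tr_def)

lemma Tr_adjoint: "X \<in> carrier_mat n n \<Longrightarrow> Tr (mat_adjoint X) = cnj (Tr X)"
  by (subst (1 2) Tr_eq[of _ n]) auto

lemma Tr_mult:
  assumes "X \<in> carrier_mat n m" "Y \<in> carrier_mat m n"
  shows "Tr (X * Y) = (\<Sum>i<n. \<Sum>k<m. X $$ (i, k) * Y $$ (k, i))"
  using assms by (subst Tr_eq[of _ n]) (auto simp: mult_index simp del: index_mult_mat)

lemma Tr_comm:
  assumes "X \<in> carrier_mat n m" "Y \<in> carrier_mat m n"
  shows "Tr (X * Y) = Tr (Y * X)"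
  unfolding Tr_mult[OF assms] Tr_mult[OF assms(2,1)]
  by (subst sum.swap) (simp add: mult.commute)

text \<open>The trace is the sum of the squared moduli of all entries of \<open>X\<close>. The
  positivity of \<open>\<omega>\<close> and \<open>\<tau>\<close> in the limit space is inherited
  from here.\<close>

lemma Tr_adjoint_self_nonneg:
  assumes "X \<in> carrier_mat n n"
  shows "Tr (mat_adjoint X * X) \<in> \<real>\<^sub>\<ge>\<^sub>0"
proof -
  have "Tr (mat_adjoint X * X) = (\<Sum>i<n. \<Sum>k<n. complex_of_real ((cmod (X $$ (k, i)))\<^sup>2))"
    using assms by (auto simp: Tr_mult[OF adjoint_carrier[OF assms] assms] complex_norm_square
        simp del: of_real_power intro!: sum.cong)
  also have "\<dots> = complex_of_real (\<Sum>i<n. \<Sum>k<n. (cmod (X $$ (k, i)))\<^sup>2)" by simp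
  finally show ?thesis by (simp add: sum_nonneg del: of_real_sum)
qed

locale square_matrices =
  fixes n :: nat
begin

abbreviation Mn :: "complex mat set" where "Mn \<equiv> carrier_mat n n"

lemma closed [simp, intro]:
  "X \<in> Mn \<Longrightarrow> Y \<in> Mn \<Longrightarrow> X * Y \<in> Mn" "X \<in> Mn \<Longrightarrow> Y \<in> Mn \<Longrightarrow> X + Y \<in> Mn"
  "X \<in> Mn \<Longrightarrow> Y \<in> Mn \<Longrightarrow> X - Y \<in> Mn" "X \<in> Mn \<Longrightarrow> c \<cdot>\<^sub>m X \<in> Mn"
  "X \<in> Mn \<Longrightarrow> mat_adjoint X \<in> Mn"
  by auto

lemma assoc: "X \<in> Mn \<Longrightarrow> Y \<in> Mn \<Longrightarrow> Z \<in> Mn \<Longrightarrow> X * Y * Z = X * (Y * Z)"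
  by (rule assoc_mult_mat)

lemma distribs:
  assumes "X \<in> Mn" "Y \<in> Mn" "Z \<in> Mn"
  shows "(X + Y) * Z = X * Z + Y * Z" "Z * (X + Y) = Z * X + Z * Y"
    "(X - Y) * Z = X * Z - Y * Z" "Z * (X - Y) = Z * X - Z * Y"
  using assms by (auto intro: add_mult_distrib_mat mult_add_distrib_mat
      minus_mult_distrib_mat mult_minus_distrib_mat)

lemma smult_mults:
  assumes "X \<in> Mn" "Y \<in> Mn"
  shows "(c \<cdot>\<^sub>m X) * Y = c \<cdot>\<^sub>m (X * Y)" "X * (c \<cdot>\<^sub>m Y) = c \<cdot>\<^sub>m (X * Y)"
  using assms by (auto intro: mult_smult_assoc_mat mult_smult_distrib)

lemma mult_idx: "X \<in> Mn \<Longrightarrow> Y \<in> Mn \<Longrightarrow> i < n \<Longrightarrow> j < n \<Longrightarrow>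
    (X * Y) $$ (i, j) = (\<Sum>k<n. X $$ (i, k) * Y $$ (k, j))"
  by (rule mult_index)

lemma entry_plus_minus:
  "X \<in> Mn \<Longrightarrow> Y \<in> Mn \<Longrightarrow> i < n \<Longrightarrow> j < n \<Longrightarrow> (X + Y) $$ (i, j) = X $$ (i, j) + Y $$ (i, j)"
  "X \<in> Mn \<Longrightarrow> Y \<in> Mn \<Longrightarrow> i < n \<Longrightarrow> j < n \<Longrightarrow> (X - Y) $$ (i, j) = X $$ (i, j) - Y $$ (i, j)"
  by auto

lemma Tr_swap: "X \<in> Mn \<Longrightarrow> Y \<in> Mn \<Longrightarrow> Tr (X * Y) = Tr (Y * X)"
  by (rule Tr_comm)

lemma Tr_plus_minus:
  "X \<in> Mn \<Longrightarrow> Y \<in> Mn \<Longrightarrow> Tr (X + Y) = Tr X + Tr Y"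
  "X \<in> Mn \<Longrightarrow> Y \<in> Mn \<Longrightarrow> Tr (X - Y) = Tr X - Tr Y"
  by (rule Tr_add Tr_minus; assumption)+

lemma ones [simp]:
  "X \<in> Mn \<Longrightarrow> X * 1\<^sub>m n = X" "X \<in> Mn \<Longrightarrow> 1\<^sub>m n * X = X"
  "X \<in> Mn \<Longrightarrow> X * 0\<^sub>m n n = 0\<^sub>m n n" "X \<in> Mn \<Longrightarrow> 0\<^sub>m n n * X = 0\<^sub>m n n"
  by auto

section \<open>Matrix units: how traces split and join\<close>

definition eunit :: "nat \<Rightarrow> nat \<Rightarrow> complex mat" where
  "eunit k a = mat n n (\<lambda>(i, j). if i = k \<and> j = a then 1 else 0)"

lemma eunit_carrier [simp, intro]: "eunit k a \<in> Mn"
  by (simp add: eunit_def)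

lemma eunit_mult_index:
  assumes "Y \<in> Mn" "k < n" "a < n" "i < n" "j < n"
  shows "(eunit k a * Y) $$ (i, j) = (if i = k then Y $$ (a, j) else 0)"
proof -
  have "(eunit k a * Y) $$ (i, j) = (if i = k then \<Sum>l<n. if l = a then Y $$ (l, j) else 0 else 0)"
    using assms by (subst mult_idx) (auto simp: eunit_def mult_delta_left)
  then show ?thesis using assms by simp
qed

lemma mult_eunit_index:
  assumes "X \<in> Mn" "k < n" "a < n" "i < n" "j < n"
  shows "(X * eunit k a) $$ (i, j) = (if j = a then X $$ (i, k) else 0)"
proof -
  have "(X * eunit k a) $$ (i, j) = (if j = a then \<Sum>l<n. if l = k then X $$ (i, l) else 0 else 0)"
    using assms by (subst mult_idx) (auto simp: eunit_def mult_delta_right)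
  then show ?thesis using assms by simp
qed

lemma mult_eunit_mult_index:
  assumes "X \<in> Mn" "Y \<in> Mn" "k < n" "a < n" "i < n" "j < n"
  shows "(X * (eunit k a * Y)) $$ (i, j) = X $$ (i, k) * Y $$ (a, j)"
proof -
  have "(X * (eunit k a * Y)) $$ (i, j) = (\<Sum>l<n. if l = k then X $$ (i, l) * Y $$ (a, j) else 0)"
    using assms by (subst mult_idx) (auto simp: eunit_mult_index mult_delta_right simp del: index_mult_mat)
  then show ?thesis using assms by simp
qed

text \<open>The entry of X e Y at the very position (k, a) of the matrix unit e is X_kk Y_aa.
  Summation over all positions cuts one product into two traces; this is how a trace splits in the
  Schwinger-Dyson equation.\<close>

lemma sum_mult_eunit_mult:
  assumes "X \<in> Mn" "Y \<in> Mn"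
  shows "(\<Sum>k<n. \<Sum>a<n. (X * (eunit k a * Y)) $$ (k, a)) = Tr X * Tr Y"
  using assms
  by (simp add: mult_eunit_mult_index Tr_eq[OF assms(1)] Tr_eq[OF assms(2)] sum_product del: index_mult_mat)

lemma Tr_mult_eunit_mult:
  assumes "X \<in> Mn" "Y \<in> Mn" "k < n" "a < n"
  shows "Tr (X * (eunit k a * Y)) = (Y * X) $$ (a, k)"
proof -
  have "Tr (X * (eunit k a * Y)) = (\<Sum>i<n. X $$ (i, k) * Y $$ (a, i))"
    using assms by (subst Tr_eq[of _ n]) (auto simp: mult_eunit_mult_index simp del: index_mult_mat)
  then show ?thesis
    using assms by (subst mult_idx) (auto simp: mult.commute)
qed

text \<open>With a matrix unit inside, the trace is a single entry of \<open>Y * X\<close>, so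
  summation against \<open>Z\<close> joins this trace to \<open>Z\<close>. The terms in which two
  traces become one arise in this way.\<close>

lemma sum_Tr_mult_eunit_mult:
  assumes "X \<in> Mn" "Y \<in> Mn" "Z \<in> Mn"
  shows "(\<Sum>k<n. \<Sum>a<n. Z $$ (k, a) * Tr (X * (eunit k a * Y))) = Tr (Z * (Y * X))"
proof -
  have YX: "Y * X \<in> Mn" using assms by auto
  show ?thesis
    by (subst Tr_mult[OF assms(3) YX])
      (use assms in \<open>simp add: Tr_mult_eunit_mult del: index_mult_mat\<close>)
qed

section \<open>The unitary group and conjugation by its elements\<close>

lemma unitaryI:
  "V \<in> Mn \<Longrightarrow> mat_adjoint V * V = 1\<^sub>m n \<Longrightarrow> V * mat_adjoint V = 1\<^sub>m n \<Longrightarrow> V \<in> unitary_group n"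
  by (simp add: unitary_group_def)

lemma unitaryD [simp]:
  assumes "W \<in> unitary_group n"
  shows "W \<in> Mn" "mat_adjoint W * W = 1\<^sub>m n" "W * mat_adjoint W = 1\<^sub>m n"
  using assms by (simp_all add: unitary_group_def)

lemma unitary_mult:
  assumes V: "V \<in> unitary_group n" and W: "W \<in> unitary_group n"
  shows "V * W \<in> unitary_group n"
proof -
  have c: "V \<in> Mn" "W \<in> Mn" "mat_adjoint V \<in> Mn" "mat_adjoint W \<in> Mn" using V W by auto
  have "mat_adjoint W * mat_adjoint V * (V * W) = mat_adjoint W * (mat_adjoint V * V) * W"
    using c by (simp add: assoc)
  moreover have "V * W * (mat_adjoint W * mat_adjoint V) = V * (W * mat_adjoint W) * mat_adjoint V"
    using c by (simp add: assoc)
  ultimately show ?thesis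
    using c V W by (intro unitaryI) (simp_all add: adjoint_mult[OF c(1,2)])
qed

text \<open>The rows of \<open>W\<close> are unit vectors. The bound makes all polynomials in the
  entries and their conjugates bounded, hence integrable.\<close>

lemma unitary_entry_le:
  assumes W: "W \<in> unitary_group n" and "i < n" "j < n"
  shows "cmod (W $$ (i, j)) \<le> 1"
proof -
  have "complex_of_real (\<Sum>k<n. (cmod (W $$ (i, k)))\<^sup>2) = (\<Sum>k<n. W $$ (i, k) * mat_adjoint W $$ (k, i))"
    using unitaryD(1)[OF W] \<open>i < n\<close> by (auto simp: complex_norm_square simp del: of_real_power)
  also have "\<dots> = (W * mat_adjoint W) $$ (i, i)"
    using W \<open>i < n\<close> by (subst mult_idx) auto
  also have "\<dots> = complex_of_real 1" using W \<open>i < n\<close> by simp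
  finally have "(\<Sum>k<n. (cmod (W $$ (i, k)))\<^sup>2) = 1" unfolding of_real_eq_iff .
  moreover have "(cmod (W $$ (i, j)))\<^sup>2 \<le> (\<Sum>k<n. (cmod (W $$ (i, k)))\<^sup>2)"
    by (rule member_le_sum) (use \<open>j < n\<close> in auto)
  ultimately show ?thesis by (simp add: power_le_one_iff)
qed

definition conj_by :: "complex mat \<Rightarrow> complex mat \<Rightarrow> complex mat" where
  "conj_by W b = W * b * mat_adjoint W"

lemma conj_by_carrier [simp, intro]: "W \<in> Mn \<Longrightarrow> b \<in> Mn \<Longrightarrow> conj_by W b \<in> Mn"
  by (simp add: conj_by_def)

lemma Tr_conj_by: "W \<in> unitary_group n \<Longrightarrow> b \<in> Mn \<Longrightarrow> Tr (conj_by W b) = Tr b"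
  unfolding conj_by_def by (subst Tr_swap) (auto simp: assoc[symmetric])

text \<open>The adjoint of \<open>W\<close> and \<open>W\<close> cancel between the neighbours. This
  merging of two conjugated letters is what lets the number of letters descend.\<close>

lemma conj_by_mult:
  assumes W: "W \<in> unitary_group n" and b: "b \<in> Mn" "c \<in> Mn"
  shows "conj_by W b * conj_by W c = conj_by W (b * c)"
proof -
  have c: "W \<in> Mn" "mat_adjoint W \<in> Mn" using W by auto
  have "conj_by W b * conj_by W c = W * b * (mat_adjoint W * W) * c * mat_adjoint W"
    unfolding conj_by_def using b c by (simp add: assoc del: unitaryD(2))
  then show ?thesis using b c W by (simp add: assoc conj_by_def)
qed

lemma conj_by_one: "W \<in> unitary_group n \<Longrightarrow> conj_by W (1\<^sub>m n) = 1\<^sub>m n"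
  by (simp add: conj_by_def)

lemma conj_by_add: "W \<in> Mn \<Longrightarrow> b \<in> Mn \<Longrightarrow> c \<in> Mn \<Longrightarrow> conj_by W (b + c) = conj_by W b + conj_by W c"
  by (simp add: conj_by_def distribs)

lemma conj_by_smult: "W \<in> Mn \<Longrightarrow> b \<in> Mn \<Longrightarrow> conj_by W (t \<cdot>\<^sub>m b) = t \<cdot>\<^sub>m conj_by W b"
  by (simp add: conj_by_def smult_mults)

lemma conj_by_adjoint: "W \<in> Mn \<Longrightarrow> b \<in> Mn \<Longrightarrow> mat_adjoint (conj_by W b) = conj_by W (mat_adjoint b)"
  by (simp add: conj_by_def adjoint_mult[of _ n n _ n] assoc)

section \<open>Words in conjugated matrices\<close>

text \<open>A word \<open>[(x\<^sub>1,b\<^sub>1),\<dots>,(x\<^sub>m,b\<^sub>m)]\<close> stands for \<open>x\<^sub>1 W b\<^sub>1 W\<^sup>* \<dots> x\<^sub>m W b\<^sub>m W\<^sup>*\<close>.\<close>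

definition wmat :: "complex mat \<Rightarrow> (complex mat \<times> complex mat) list \<Rightarrow> complex mat" where
  "wmat W w = foldr (\<lambda>(x, b) R. x * conj_by W b * R) w (1\<^sub>m n)"

lemma wmat_Nil [simp]: "wmat W [] = 1\<^sub>m n"
  and wmat_Cons: "wmat W ((x, b) # w) = x * conj_by W b * wmat W w"
  by (simp_all add: wmat_def)

definition words :: "(complex mat \<times> complex mat) list set" where
  "words = {w. set w \<subseteq> Mn \<times> Mn}"

lemma words_Nil [simp]: "[] \<in> words"
  and words_Cons [simp]: "p # w \<in> words \<longleftrightarrow> fst p \<in> Mn \<and> snd p \<in> Mn \<and> w \<in> words"
  and words_append [simp]: "u @ v \<in> words \<longleftrightarrow> u \<in> words \<and> v \<in> words"
  by (auto simp: words_def mem_Times_iff)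

lemma words_take [simp]: "w \<in> words \<Longrightarrow> take i w \<in> words"
  and words_drop [simp]: "w \<in> words \<Longrightarrow> drop i w \<in> words"
  by (auto simp: words_def dest: in_set_takeD in_set_dropD)

lemma words_nth:
  assumes "w \<in> words" "i < length w"
  shows "fst (w ! i) \<in> Mn" "snd (w ! i) \<in> Mn"
proof -
  have "w ! i \<in> Mn \<times> Mn" using assms nth_mem[of i w] unfolding words_def by blast
  then show "fst (w ! i) \<in> Mn" "snd (w ! i) \<in> Mn" by (auto simp: mem_Times_iff)
qed

lemma wmat_carrier [simp, intro]: "W \<in> Mn \<Longrightarrow> w \<in> words \<Longrightarrow> wmat W w \<in> Mn"
  by (induction w) (auto simp: wmat_Cons)

lemma wmat_append:
  "W \<in> Mn \<Longrightarrow> u \<in> words \<Longrightarrow> v \<in> words \<Longrightarrow> wmat W (u @ v) = wmat W u * wmat W v"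
  by (induction u) (auto simp: wmat_Cons assoc)

text \<open>The derivative of \<^const>\<open>wmat\<close> along \<open>W \<mapsto> e\<^sup>t\<^sup>X W\<close> for the matrix unit \<open>X\<close> at \<open>(k, a)\<close>.\<close>

fun wgrad :: "nat \<Rightarrow> nat \<Rightarrow> complex mat \<Rightarrow> (complex mat \<times> complex mat) list \<Rightarrow> complex mat" where
  "wgrad k a W [] = 0\<^sub>m n n"
| "wgrad k a W ((x, b) # w) =
     x * (eunit k a * conj_by W b - conj_by W b * eunit k a) * wmat W w + x * conj_by W b * wgrad k a W w"

lemma wgrad_carrier [simp, intro]: "W \<in> Mn \<Longrightarrow> w \<in> words \<Longrightarrow> wgrad k a W w \<in> Mn"
  by (induction w) auto

lemma sum_sum_index_add:
  assumes "\<And>k a. F k a \<in> Mn" "\<And>k a. G k a \<in> Mn"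
  shows "(\<Sum>k<n. \<Sum>a<n. (F k a + G k a) $$ (k, a)) =
    (\<Sum>k<n. \<Sum>a<n. F k a $$ (k, a)) + (\<Sum>k<n. \<Sum>a<n. G k a $$ (k, a))"
proof -
  have "(F k a + G k a) $$ (k, a) = F k a $$ (k, a) + G k a $$ (k, a)" if "k < n" "a < n" for k a
    using assms(1)[of k a] assms(2)[of k a] that by auto
  then show ?thesis by (simp add: sum.distrib del: index_add_mat)
qed

lemma sum_sum_index_minus:
  assumes "\<And>k a. F k a \<in> Mn" "\<And>k a. G k a \<in> Mn"
  shows "(\<Sum>k<n. \<Sum>a<n. (F k a - G k a) $$ (k, a)) =
    (\<Sum>k<n. \<Sum>a<n. F k a $$ (k, a)) - (\<Sum>k<n. \<Sum>a<n. G k a $$ (k, a))"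
proof -
  have "(F k a - G k a) $$ (k, a) = F k a $$ (k, a) - G k a $$ (k, a)" if "k < n" "a < n" for k a
    using assms(1)[of k a] assms(2)[of k a] that by auto
  then show ?thesis by (simp add: sum_subtractf del: index_minus_mat)
qed

text \<open>Each letter contributes a commutator with the matrix unit, which stands either before or
  after the conjugated letter, and \<open>sum_mult_eunit_mult\<close> cuts the product at that
  place: hence two products of traces with opposite signs. The outer factor \<open>Z\<close> is
  arbitrary because the induction moves the letters to the left of the differentiated one into
  it.\<close>

lemma sum_wgrad_index:
  assumes W: "W \<in> Mn" and "w \<in> words" "Z \<in> Mn" "x \<in> Mn"
  shows "(\<Sum>k<n. \<Sum>a<n. (Z * (wgrad k a W w * x)) $$ (k, a)) =
    (\<Sum>i<length w. Tr (Z * (wmat W (take i w) * fst (w ! i))) *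
         Tr (conj_by W (snd (w ! i)) * (wmat W (drop (Suc i) w) * x))
       - Tr (Z * (wmat W (take i w) * (fst (w ! i) * conj_by W (snd (w ! i))))) *
         Tr (wmat W (drop (Suc i) w) * x))"
  using assms(2,3)
proof (induction w arbitrary: Z)
  case Nil
  then show ?case using assms by simp
next
  case (Cons p w)
  obtain y c where p: "p = (y, c)" by (cases p)
  define C where "C = conj_by W c"
  have c: "y \<in> Mn" "c \<in> Mn" "w \<in> words" "C \<in> Mn" "wmat W w \<in> Mn" "\<And>k a. wgrad k a W w \<in> Mn"
    using Cons.prems p W by (auto simp: C_def)
  have eq: "Z * (wgrad k a W (p # w) * x) =
      (Z * y) * (eunit k a * (C * (wmat W w * x))) - (Z * (y * C)) * (eunit k a * (wmat W w * x))
      + (Z * (y * C)) * (wgrad k a W w * x)" for k a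
    using c Cons.prems \<open>x \<in> Mn\<close> p by (simp add: p C_def[symmetric] assoc distribs)
  have "(\<Sum>k<n. \<Sum>a<n. (Z * (wgrad k a W (p # w) * x)) $$ (k, a)) =
      Tr (Z * y) * Tr (C * (wmat W w * x)) - Tr (Z * (y * C)) * Tr (wmat W w * x)
      + (\<Sum>k<n. \<Sum>a<n. ((Z * (y * C)) * (wgrad k a W w * x)) $$ (k, a))"
    unfolding eq using c Cons.prems \<open>x \<in> Mn\<close>
    by (subst sum_sum_index_add, force, force, subst sum_sum_index_minus, force, force)
      (simp add: sum_mult_eunit_mult del: index_mult_mat)
  also have "(\<Sum>k<n. \<Sum>a<n. ((Z * (y * C)) * (wgrad k a W w * x)) $$ (k, a)) =
    (\<Sum>i<length w. Tr ((Z * (y * C)) * (wmat W (take i w) * fst (w ! i))) *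
         Tr (conj_by W (snd (w ! i)) * (wmat W (drop (Suc i) w) * x))
       - Tr ((Z * (y * C)) * (wmat W (take i w) * (fst (w ! i) * conj_by W (snd (w ! i))))) *
         Tr (wmat W (drop (Suc i) w) * x))"
    by (rule Cons.IH) (use c Cons.prems in auto)
  also have "\<dots> = (\<Sum>i<length w. Tr (Z * (wmat W (p # take i w) * fst (w ! i))) *
         Tr (conj_by W (snd (w ! i)) * (wmat W (drop (Suc i) w) * x))
       - Tr (Z * (wmat W (p # take i w) * (fst (w ! i) * conj_by W (snd (w ! i))))) *
         Tr (wmat W (drop (Suc i) w) * x))"
  proof (rule sum.cong[OF refl], goal_cases)
    case (1 i)
    then have "fst (w ! i) \<in> Mn" "snd (w ! i) \<in> Mn" using words_nth[OF c(3)] by auto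
    then show ?case
      using c Cons.prems W by (simp add: p wmat_Cons C_def[symmetric] assoc)
  qed
  finally show ?case
    using c Cons.prems by (simp add: sum.lessThan_Suc_shift p C_def del: sum.lessThan_Suc)
qed

text \<open>The counterpart of \<open>sum_wgrad_index\<close> for a word under its own trace: the
  word is opened at the differentiated letter, and its pieces, in the cyclic order
  \<open>drop\<close> before \<open>take\<close>, are spliced into the trace with \<open>Y\<close>.
  The induction collects the letters already passed in \<open>R\<close>.\<close>

lemma sum_Tr_wgrad:
  assumes W: "W \<in> Mn" and "w \<in> words" "R \<in> Mn" "Y \<in> Mn"
  shows "(\<Sum>k<n. \<Sum>a<n. Y $$ (k, a) * Tr (R * wgrad k a W w)) =
    (\<Sum>i<length w. Tr (Y * (conj_by W (snd (w ! i)) * (wmat W (drop (Suc i) w) *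
                      (R * (wmat W (take i w) * fst (w ! i))))))
       - Tr (Y * (wmat W (drop (Suc i) w) *
                      (R * (wmat W (take i w) * (fst (w ! i) * conj_by W (snd (w ! i))))))))"
  using assms(2,3)
proof (induction w arbitrary: R)
  case Nil
  then show ?case using assms by simp
next
  case (Cons p w)
  obtain y c where p: "p = (y, c)" by (cases p)
  define C where "C = conj_by W c"
  have c: "y \<in> Mn" "c \<in> Mn" "w \<in> words" "C \<in> Mn" "wmat W w \<in> Mn" "\<And>k a. wgrad k a W w \<in> Mn"
    using Cons.prems p W by (auto simp: C_def)
  have eq: "R * wgrad k a W (p # w) =
      (R * y) * (eunit k a * (C * wmat W w)) - (R * (y * C)) * (eunit k a * wmat W w)
      + (R * (y * C)) * wgrad k a W w" for k a
    using c Cons.prems p by (simp add: p C_def[symmetric] assoc distribs)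
  have eq2: "Tr (R * wgrad k a W (p # w)) = Tr ((R * y) * (eunit k a * (C * wmat W w)))
      - Tr ((R * (y * C)) * (eunit k a * wmat W w)) + Tr ((R * (y * C)) * wgrad k a W w)" for k a
    unfolding eq using c Cons.prems by (simp add: Tr_plus_minus)
  have "(\<Sum>k<n. \<Sum>a<n. Y $$ (k, a) * Tr (R * wgrad k a W (p # w))) =
      Tr (Y * (C * wmat W w * (R * y))) - Tr (Y * (wmat W w * (R * (y * C))))
      + (\<Sum>k<n. \<Sum>a<n. Y $$ (k, a) * Tr ((R * (y * C)) * wgrad k a W w))"
    unfolding eq2 using c Cons.prems \<open>Y \<in> Mn\<close>
    by (subst sum_Tr_mult_eunit_mult[symmetric], force, force, force,
        subst sum_Tr_mult_eunit_mult[symmetric], force, force, force)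
      (simp add: algebra_simps sum.distrib sum_subtractf)
  also have "(\<Sum>k<n. \<Sum>a<n. Y $$ (k, a) * Tr ((R * (y * C)) * wgrad k a W w)) =
    (\<Sum>i<length w. Tr (Y * (conj_by W (snd (w ! i)) * (wmat W (drop (Suc i) w) *
                      ((R * (y * C)) * (wmat W (take i w) * fst (w ! i))))))
       - Tr (Y * (wmat W (drop (Suc i) w) *
                      ((R * (y * C)) * (wmat W (take i w) * (fst (w ! i) * conj_by W (snd (w ! i))))))))"
    by (rule Cons.IH) (use c Cons.prems in auto)
  also have "\<dots> =
    (\<Sum>i<length w. Tr (Y * (conj_by W (snd (w ! i)) * (wmat W (drop (Suc i) w) *
                      (R * (wmat W (p # take i w) * fst (w ! i))))))
       - Tr (Y * (wmat W (drop (Suc i) w) *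
                      (R * (wmat W (p # take i w) * (fst (w ! i) * conj_by W (snd (w ! i))))))))"
  proof (rule sum.cong[OF refl], goal_cases)
    case (1 i)
    then have "fst (w ! i) \<in> Mn" "snd (w ! i) \<in> Mn" using words_nth[OF c(3)] by auto
    then show ?case
      using c Cons.prems W by (simp add: p wmat_Cons C_def[symmetric] assoc)
  qed
  finally show ?case
    using c Cons.prems by (simp add: sum.lessThan_Suc_shift p C_def assoc del: sum.lessThan_Suc)
qed

end

section \<open>Integration by parts for the Haar measure\<close>

text \<open>Taylor estimates of the exponential at a purely imaginary point: there the factor exp
  |Re z| of the remainder is 1, so this bound and the next one hold for all real
  \<open>t\<close>.\<close>

lemma cis_minus_one_bound: "cmod (cis t - 1) \<le> \<bar>t\<bar>"
  using Taylor_exp[of "\<i> * complex_of_real t" 0] by (simp add: cis_conv_exp norm_mult)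

lemma cis_minus_one_minus_bound: "cmod (cis t - 1 - \<i> * t) \<le> t\<^sup>2"
  using Taylor_exp[of "\<i> * complex_of_real t" 1]
  by (simp add: cis_conv_exp norm_mult power2_eq_square algebra_simps)

context square_matrices
begin

section \<open>Unitary paths generated by projections\<close>

definition projections :: "complex mat set" where
  "projections = {P \<in> Mn. P * P = P \<and> mat_adjoint P = P}"

text \<open>This is exp (i t P): as \<open>P * P = P\<close> for a projection, the exponential
  series collapses to 1 + (exp (i t) - 1) P.\<close>

definition rotation :: "complex mat \<Rightarrow> real \<Rightarrow> complex mat" where
  "rotation P t = 1\<^sub>m n + (cis t - 1) \<cdot>\<^sub>m P"

lemma rotation_adjoint:
  assumes "P \<in> projections"
  shows "mat_adjoint (rotation P t) = 1\<^sub>m n + cnj (cis t - 1) \<cdot>\<^sub>m P"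
  using assms by (simp add: rotation_def projections_def adjoint_add[of _ n n] adjoint_smult[of _ n n])

text \<open>With z = exp (i t) - 1, the relation |z + 1| = 1 reads z + cnj z + z cnj z = 0, and the
  left side is the coefficient of \<open>P\<close> in both products to be computed.\<close>

lemma rotation_unitary:
  assumes P: "P \<in> projections"
  shows "rotation P t \<in> unitary_group n"
proof -
  have c: "P \<in> Mn" "P * P = P" using P by (auto simp: projections_def)
  define z where "z = cis t - 1"
  have "cmod (z + 1) = 1" by (simp add: z_def)
  then have "(z + 1) * cnj (z + 1) = 1" unfolding complex_norm_square[symmetric] by simp
  then have z: "z + cnj z + z * cnj z = 0" by (simp add: algebra_simps)
  have eq: "(1\<^sub>m n + a \<cdot>\<^sub>m P) * (1\<^sub>m n + b \<cdot>\<^sub>m P) = 1\<^sub>m n" if "a + b + a * b = 0" for a b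
  proof -
    have "(1\<^sub>m n + a \<cdot>\<^sub>m P) * (1\<^sub>m n + b \<cdot>\<^sub>m P) = 1\<^sub>m n + a \<cdot>\<^sub>m P + b \<cdot>\<^sub>m (P + a \<cdot>\<^sub>m P)"
      using c by (simp add: distribs smult_mults)
    also have "\<dots> = 1\<^sub>m n + (a + b + a * b) \<cdot>\<^sub>m P"
      using c by (intro eq_matI) (auto simp: algebra_simps)
    also have "\<dots> = 1\<^sub>m n" unfolding that using c by (intro eq_matI) auto
    finally show ?thesis .
  qed
  show ?thesis
  proof (rule unitaryI)
    show "rotation P t \<in> Mn" using c by (simp add: rotation_def)
    show "mat_adjoint (rotation P t) * rotation P t = 1\<^sub>m n"
      unfolding rotation_adjoint[OF P] unfolding rotation_def z_def[symmetric]
      by (rule eq) (use z in \<open>simp add: algebra_simps\<close>)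
    show "rotation P t * mat_adjoint (rotation P t) = 1\<^sub>m n"
      unfolding rotation_adjoint[OF P] unfolding rotation_def z_def[symmetric]
      by (rule eq) (use z in \<open>simp add: algebra_simps\<close>)
  qed
qed

text \<open>The expansion is exact. Its part linear in z and cnj z equals i t (P C - C P) up to
  order t^2, which identifies the derivative as a commutator.\<close>

lemma conj_by_rotation:
  fixes t :: real
  assumes P: "P \<in> projections" and W: "W \<in> Mn" and b: "b \<in> Mn"
  defines "C \<equiv> conj_by W b" and "z \<equiv> cis t - 1"
  shows "conj_by (rotation P t * W) b =
    C + z \<cdot>\<^sub>m (P * C) + cnj z \<cdot>\<^sub>m (C * P) + (z * cnj z) \<cdot>\<^sub>m (P * (C * P))"
proof -
  have c: "P \<in> Mn" "C \<in> Mn" using P W b by (auto simp: projections_def C_def)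
  have V: "rotation P t \<in> Mn" using c by (simp add: rotation_def)
  have "conj_by (rotation P t * W) b = rotation P t * C * mat_adjoint (rotation P t)"
    using V W b by (simp add: C_def conj_by_def adjoint_mult[of _ n n _ n] assoc)
  also have "\<dots> = (1\<^sub>m n + z \<cdot>\<^sub>m P) * C * (1\<^sub>m n + cnj z \<cdot>\<^sub>m P)"
    unfolding rotation_adjoint[OF P] by (simp add: rotation_def z_def)
  also have "\<dots> = C + z \<cdot>\<^sub>m (P * C) + cnj z \<cdot>\<^sub>m (C * P + z \<cdot>\<^sub>m (P * (C * P)))"
    using c by (simp add: distribs smult_mults assoc)
  also have "\<dots> = C + z \<cdot>\<^sub>m (P * C) + cnj z \<cdot>\<^sub>m (C * P) + (z * cnj z) \<cdot>\<^sub>m (P * (C * P))"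
    using c by (intro eq_matI) (auto simp: algebra_simps)
  finally show ?thesis .
qed

text \<open>
  Rank-one projections span all matrices, so a linear functional on the tangent directions
  that vanishes on projections vanishes.
\<close>

lemma projections_span:
  assumes "\<And>P. P \<in> projections \<Longrightarrow> (\<Sum>k<n. \<Sum>a<n. P $$ (k, a) * I k a) = 0"
    and ka: "k < n" "a < n"
  shows "I k a = (0 :: complex)"
proof -
  \<comment> \<open>The projection onto a single basis vector isolates the diagonal
    coefficient.\<close>
  have diag: "I k k = 0" if k: "k < n" for k
  proof -
    define P where "P = mat n n (\<lambda>(i, j). if i = k \<and> j = k then 1 else (0 :: complex))"
    have Pc: "P \<in> Mn" by (simp add: P_def)
    have "P * P = P"
    proof (rule eq_matI)
      fix i j assume ij: "i < dim_row P" "j < dim_col P"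
      then have "(P * P) $$ (i, j) = (\<Sum>l<n. P $$ (i, l) * P $$ (l, j))"
        using Pc by (intro mult_idx) auto
      also have "\<dots> = (\<Sum>l<n. if l = k then P $$ (i, j) else 0)"
        by (intro sum.cong refl) (use ij in \<open>auto simp: P_def\<close>)
      finally show "(P * P) $$ (i, j) = P $$ (i, j)" using k by simp
    qed (use Pc in auto)
    moreover have "mat_adjoint P = P" by (rule eq_matI) (use Pc in \<open>auto simp: P_def\<close>)
    ultimately have "(\<Sum>i<n. \<Sum>j<n. P $$ (i, j) * I i j) = 0"
      using assms(1) Pc by (auto simp: projections_def)
    moreover have "(\<Sum>i<n. \<Sum>j<n. P $$ (i, j) * I i j) = (\<Sum>i<n. if i = k then I k k else 0)"
    proof (rule sum.cong[OF refl])
      fix i assume "i \<in> {..<n}"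
      then have "(\<Sum>j<n. P $$ (i, j) * I i j) = (\<Sum>j<n. if j = k then (if i = k then I k k else 0) else 0)"
        by (intro sum.cong) (auto simp: P_def)
      then show "(\<Sum>j<n. P $$ (i, j) * I i j) = (if i = k then I k k else 0)" using k by simp
    qed
    ultimately show ?thesis using k by simp
  qed
  have offdiag: "w * I k a + cnj w * I a k = 0" if "k \<noteq> a" and w: "cmod w = 1" for w
  proof -
    \<comment> \<open>\<open>P\<close> projects onto the line spanned by v = w e_k + e_a; the factor
      1/2 normalizes, since v has squared norm 2. The diagonal coefficients in the resulting
      equation vanish by \<open>diag\<close>.\<close>
    define v where "v i = (if i = k then w else if i = a then 1 else 0)" for i
    define P where "P = mat n n (\<lambda>(i, j). v i * cnj (v j) / 2)"
    have ww: "w * cnj w = 1" using w by (simp add: complex_norm_square[symmetric])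
    have vv: "(\<Sum>l<n. v l * f l) = w * f k + f a" for f
    proof -
      have "(\<Sum>l<n. v l * f l) = (\<Sum>l\<in>{k, a}. v l * f l)"
        by (rule sum.mono_neutral_right) (use ka in \<open>auto simp: v_def\<close>)
      then show ?thesis using \<open>k \<noteq> a\<close> by (simp add: v_def)
    qed
    have vv': "(\<Sum>l<n. cnj (v l) * f l) = cnj w * f k + f a" for f
    proof -
      have "(\<Sum>l<n. cnj (v l) * f l) = (\<Sum>l\<in>{k, a}. cnj (v l) * f l)"
        by (rule sum.mono_neutral_right) (use ka in \<open>auto simp: v_def\<close>)
      then show ?thesis using \<open>k \<noteq> a\<close> by (simp add: v_def)
    qed
    have Pc: "P \<in> Mn" by (simp add: P_def)
    have "P * P = P"
    proof (rule eq_matI)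
      fix i j assume ij: "i < dim_row P" "j < dim_col P"
      then have "(P * P) $$ (i, j) = (\<Sum>l<n. v l * (cnj (v l) * (v i * cnj (v j) / 4)))"
        using Pc by (subst mult_idx) (auto simp: P_def intro!: sum.cong)
      also have "\<dots> = (w * cnj w + 1) * (v i * cnj (v j) / 4)"
        unfolding vv using \<open>k \<noteq> a\<close> by (simp add: v_def algebra_simps)
      also have "\<dots> = P $$ (i, j)" using ij by (simp add: ww P_def)
      finally show "(P * P) $$ (i, j) = P $$ (i, j)" .
    qed (use Pc in auto)
    moreover have "mat_adjoint P = P" by (rule eq_matI) (use Pc in \<open>auto simp: P_def\<close>)
    ultimately have "(\<Sum>i<n. \<Sum>j<n. P $$ (i, j) * I i j) = 0"
      using assms(1) Pc by (auto simp: projections_def)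
    moreover have "(\<Sum>i<n. \<Sum>j<n. P $$ (i, j) * I i j) =
        (\<Sum>i<n. v i * (\<Sum>j<n. cnj (v j) * (I i j / 2)))"
      by (auto simp: P_def sum_distrib_left intro!: sum.cong)
    moreover have "\<dots> = (w * (cnj w * I k k + I k a) + (cnj w * I a k + I a a)) / 2"
      unfolding vv vv' by (simp add: algebra_simps add_divide_distrib)
    moreover have "\<dots> = (w * I k a + cnj w * I a k) / 2"
      using diag ka by simp
    ultimately show ?thesis by simp
  qed
  show ?thesis
  proof (cases "k = a")
    case True
    then show ?thesis using diag ka by simp
  next
    case False
    \<comment> \<open>The values 1 and i of \<open>w\<close> give the sum and the difference of the
      two off-diagonal coefficients.\<close>
    have "I k a + I a k = 0" using offdiag[OF False, of 1] by simp
    moreover have "\<i> * I k a - \<i> * I a k = 0" using offdiag[OF False, of \<i>] by simp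
    then have "I k a = I a k" by simp
    ultimately show ?thesis by simp
  qed
qed

end

section \<open>Bounded functions on the unitary group and their Haar integrals\<close>

locale haar = square_matrices +
  fixes \<mu> :: "complex mat measure"
  assumes haar: "normalized_haar_measure n \<mu>"
begin

sublocale prob_space \<mu>
  using haar by (simp add: normalized_haar_measure_def)

lemma sets_haar: "sets \<mu> = sets (borel_unitary n)"
  using haar by (simp add: normalized_haar_measure_def)

lemma space_haar: "space \<mu> = unitary_group n"
  using sets_eq_imp_space_eq[OF sets_haar] by (simp add: borel_unitary_def)

text \<open>The class contains the entries and is closed under sums, products, conjugation and left
  translation, so that integrability of the expressions below follows from their shape.\<close>

definition good :: "(complex mat \<Rightarrow> complex) \<Rightarrow> bool" where
  "good g \<longleftrightarrow> g \<in> borel_measurable \<mu> \<and> (\<exists>K. \<forall>W\<in>unitary_group n. cmod (g W) \<le> K)"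

lemma good_bound:
  assumes "good g"
  obtains K where "K \<ge> 0" "\<And>W. W \<in> unitary_group n \<Longrightarrow> cmod (g W) \<le> K"
proof -
  obtain K where K: "\<forall>W\<in>unitary_group n. cmod (g W) \<le> K" using assms by (auto simp: good_def)
  show ?thesis by (rule that[of "max K 0"]) (use K in auto)
qed

lemma good_cong:
  assumes "good g" "\<And>W. W \<in> unitary_group n \<Longrightarrow> g W = h W"
  shows "good h"
  using assms measurable_cong[of \<mu> g h borel] by (auto simp: good_def space_haar)

lemma good_const [simp]: "good (\<lambda>_. c)"
  by (auto simp: good_def)

lemma good_add [intro]:
  assumes "good g" "good h"
  shows "good (\<lambda>W. g W + h W)"
proof -
  obtain K L where "\<And>W. W \<in> unitary_group n \<Longrightarrow> cmod (g W) \<le> K" "\<And>W. W \<in> unitary_group n \<Longrightarrow> cmod (h W) \<le> L"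
    using good_bound[OF assms(1)] good_bound[OF assms(2)] by metis
  then have "\<forall>W\<in>unitary_group n. cmod (g W + h W) \<le> K + L"
    by (auto intro: norm_triangle_mono)
  then show ?thesis using assms by (auto simp: good_def)
qed

lemma good_mult [intro]:
  assumes "good g" "good h"
  shows "good (\<lambda>W. g W * h W)"
proof -
  obtain K where "K \<ge> 0" "\<And>W. W \<in> unitary_group n \<Longrightarrow> cmod (g W) \<le> K"
    using good_bound[OF assms(1)] by blast
  moreover obtain L where "L \<ge> 0" "\<And>W. W \<in> unitary_group n \<Longrightarrow> cmod (h W) \<le> L"
    using good_bound[OF assms(2)] by blast
  ultimately have "\<forall>W\<in>unitary_group n. cmod (g W * h W) \<le> K * L"
    by (auto simp: norm_mult intro!: mult_mono)
  then show ?thesis using assms by (auto simp: good_def)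
qed

lemma good_cnj [intro]: "good g \<Longrightarrow> good (\<lambda>W. cnj (g W))"
  unfolding good_def by (auto intro: borel_measurable_continuous_on[of cnj, unfolded o_def] continuous_intros)

lemma good_sum [intro]: "(\<And>i. i \<in> S \<Longrightarrow> good (g i)) \<Longrightarrow> good (\<lambda>W. \<Sum>i\<in>S. g i W)"
  by (induction S rule: infinite_finite_induct) auto

lemma good_minus [intro]: "good g \<Longrightarrow> good h \<Longrightarrow> good (\<lambda>W. g W - h W)"
  using good_add[OF _ good_mult[OF good_const[of "- 1"]], of g h] by simp

text \<open>The measurable sets of \<open>borel_unitary\<close> are pulled back along the tuple of
  all entries, which makes each coordinate measurable.\<close>

lemma good_entry:
  assumes "i < n" "j < n"
  shows "good (\<lambda>W. W $$ (i, j))"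
proof -
  define I where "I = {..<n} \<times> {..<n}"
  have "(\<lambda>V. \<lambda>ij\<in>I. V $$ ij) \<in> measurable (vimage_algebra (unitary_group n) (\<lambda>V. \<lambda>ij\<in>I. V $$ ij)
      (\<Pi>\<^sub>M ij\<in>I. borel)) (\<Pi>\<^sub>M ij\<in>I. (borel :: complex measure))"
    by (rule measurable_vimage_algebra1) (auto simp: space_PiM)
  then have "(\<lambda>V. \<lambda>ij\<in>I. V $$ ij) \<in> measurable \<mu> (\<Pi>\<^sub>M ij\<in>I. (borel :: complex measure))"
    using measurable_cong_sets[OF sets_haar refl] by (auto simp: borel_unitary_def I_def)
  then have "(\<lambda>V. (\<lambda>ij\<in>I. V $$ ij) (i, j)) \<in> borel_measurable \<mu>"
    by (rule measurable_compose) (rule measurable_component_singleton, use assms in \<open>simp add: I_def\<close>)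
  then have "(\<lambda>V. V $$ (i, j)) \<in> borel_measurable \<mu>"
    using assms by (simp add: I_def)
  then show ?thesis
    unfolding good_def using unitary_entry_le assms by blast
qed

lemma good_integrable: "good g \<Longrightarrow> integrable \<mu> g"
proof -
  assume g: "good g"
  obtain K where "\<And>W. W \<in> unitary_group n \<Longrightarrow> cmod (g W) \<le> K" using good_bound[OF g] by metis
  then have "AE W in \<mu>. cmod (g W) \<le> K" by (intro AE_I2) (simp add: space_haar)
  then show "integrable \<mu> g" using g by (intro integrable_const_bound) (auto simp: good_def)
qed

lemma left_mult_measurable:
  assumes V: "V \<in> unitary_group n"
  shows "(\<lambda>W. V * W) \<in> measurable \<mu> (borel_unitary n)"
  unfolding borel_unitary_def
proof (rule measurable_vimage_algebra2)
  show "(*) V \<in> space \<mu> \<rightarrow> unitary_group n"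
    using V by (auto simp: space_haar intro: unitary_mult)
  show "(\<lambda>W. \<lambda>ij\<in>{..<n} \<times> {..<n}. (V * W) $$ ij) \<in> measurable \<mu> (\<Pi>\<^sub>M ij\<in>{..<n} \<times> {..<n}. borel)"
  proof (rule measurable_restrict)
    fix ij assume "ij \<in> {..<n} \<times> {..<n}"
    then obtain i j where ij: "ij = (i, j)" "i < n" "j < n" by auto
    have "good (\<lambda>W. \<Sum>k<n. V $$ (i, k) * W $$ (k, j))"
      using ij by (auto intro!: good_sum good_mult good_entry)
    then have "good (\<lambda>W. (V * W) $$ ij)"
      by (rule good_cong) (use ij V in \<open>auto simp: mult_idx simp del: index_mult_mat\<close>)
    then show "(\<lambda>W. (V * W) $$ ij) \<in> borel_measurable \<mu>" by (simp add: good_def)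
  qed
qed

lemma integral_left_mult:
  assumes V: "V \<in> unitary_group n" and g: "good g"
  shows "(\<integral>W. g (V * W) \<partial>\<mu>) = (\<integral>W. g W \<partial>\<mu>)"
proof -
  have "distr \<mu> (borel_unitary n) (\<lambda>W. V * W) = \<mu>"
    using haar V by (auto simp: normalized_haar_measure_def)
  moreover have "g \<in> borel_measurable (borel_unitary n)"
    using g measurable_cong_sets[OF sets_haar refl] by (auto simp: good_def)
  ultimately show ?thesis
    using integral_distr[OF left_mult_measurable[OF V], of g] by simp
qed

lemma good_left_mult:
  assumes V: "V \<in> unitary_group n" and g: "good g"
  shows "good (\<lambda>W. g (V * W))"
proof -
  have "g \<in> borel_measurable (borel_unitary n)"
    using g measurable_cong_sets[OF sets_haar refl] by (auto simp: good_def)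
  then have "(\<lambda>W. g (V * W)) \<in> borel_measurable \<mu>"
    by (rule measurable_compose[OF left_mult_measurable[OF V]])
  moreover obtain K where "\<And>W. W \<in> unitary_group n \<Longrightarrow> cmod (g W) \<le> K"
    using good_bound[OF g] by metis
  then have "\<forall>W\<in>unitary_group n. cmod (g (V * W)) \<le> K"
    using V unitary_mult by blast
  ultimately show ?thesis by (auto simp: good_def)
qed

text \<open>
  \<open>g' k a\<close> is the derivative of \<open>g\<close> along \<open>W \<mapsto> e\<^sup>t\<^sup>X W\<close> for the matrix unit \<open>X\<close> at \<open>(k, a)\<close>,
  extended complex linearly in \<open>X\<close> from the skew-hermitian directions \<open>\<i>P\<close>, along which the
  path stays in the unitary group.
\<close>

definition left_derivative :: "(complex mat \<Rightarrow> complex) \<Rightarrow> (nat \<Rightarrow> nat \<Rightarrow> complex mat \<Rightarrow> complex) \<Rightarrow> bool" where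
  "left_derivative g g' \<longleftrightarrow> good g \<and> (\<forall>k<n. \<forall>a<n. good (g' k a)) \<and>
     (\<forall>P\<in>projections. \<exists>K. \<forall>W\<in>unitary_group n. \<forall>t\<in>{0..1}.
        cmod (g (rotation P t * W) - g W - \<i> * t * (\<Sum>k<n. \<Sum>a<n. P $$ (k, a) * g' k a W)) \<le> K * t\<^sup>2)"

lemma left_derivative_bound:
  assumes "left_derivative g g'" "P \<in> projections"
  obtains K where "\<And>W t. W \<in> unitary_group n \<Longrightarrow> t \<in> {0..1} \<Longrightarrow>
    cmod (g (rotation P t * W) - g W - \<i> * complex_of_real t * (\<Sum>k<n. \<Sum>a<n. P $$ (k, a) * g' k a W)) \<le> K * t\<^sup>2"
  using assms unfolding left_derivative_def by blast

lemma left_derivative_cong: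
  assumes "left_derivative g g'" "\<And>W. W \<in> unitary_group n \<Longrightarrow> g W = h W"
    "\<And>k a W. k < n \<Longrightarrow> a < n \<Longrightarrow> W \<in> unitary_group n \<Longrightarrow> g' k a W = h' k a W"
  shows "left_derivative h h'"
  unfolding left_derivative_def
proof (intro conjI allI impI ballI)
  show "good h" using assms by (auto simp: left_derivative_def intro: good_cong)
  show "good (h' k a)" if "k < n" "a < n" for k a
    using assms that by (auto simp: left_derivative_def intro: good_cong[of "g' k a"])
  fix P assume P: "P \<in> projections"
  obtain K where K: "\<And>W t. W \<in> unitary_group n \<Longrightarrow> t \<in> {0..1} \<Longrightarrow>
        cmod (g (rotation P t * W) - g W - \<i> * complex_of_real t * (\<Sum>k<n. \<Sum>a<n. P $$ (k, a) * g' k a W)) \<le> K * t\<^sup>2"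
    using left_derivative_bound[OF assms(1) P] by blast
  have "cmod (h (rotation P t * W) - h W - \<i> * complex_of_real t * (\<Sum>k<n. \<Sum>a<n. P $$ (k, a) * h' k a W)) \<le> K * t\<^sup>2"
    if W: "W \<in> unitary_group n" and t: "t \<in> {0..1}" for W t
  proof -
    have "(\<Sum>k<n. \<Sum>a<n. P $$ (k, a) * g' k a W) = (\<Sum>k<n. \<Sum>a<n. P $$ (k, a) * h' k a W)"
      using assms(3) W by (intro sum.cong) auto
    then show ?thesis
      using K[OF W t] assms(2)[OF W] assms(2)[OF unitary_mult[OF rotation_unitary[OF P] W]] by simp
  qed
  then show "\<exists>K. \<forall>W\<in>unitary_group n. \<forall>t\<in>{0..1}.
        cmod (h (rotation P t * W) - h W - \<i> * t * (\<Sum>k<n. \<Sum>a<n. P $$ (k, a) * h' k a W)) \<le> K * t\<^sup>2"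
    by blast
qed

lemma left_derivative_const: "left_derivative (\<lambda>_. c) (\<lambda>_ _ _. 0)"
  by (auto simp: left_derivative_def intro!: exI[of _ 0])

lemma left_derivative_add:
  assumes "left_derivative g g'" "left_derivative h h'"
  shows "left_derivative (\<lambda>W. g W + h W) (\<lambda>k a W. g' k a W + h' k a W)"
  unfolding left_derivative_def
proof (intro conjI allI impI ballI)
  show "good (\<lambda>W. g W + h W)" using assms by (auto simp: left_derivative_def)
  show "good (\<lambda>W. g' k a W + h' k a W)" if "k < n" "a < n" for k a
    using assms that by (auto simp: left_derivative_def)
  fix P assume P: "P \<in> projections"
  define X where "X W = (\<Sum>k<n. \<Sum>a<n. P $$ (k, a) * g' k a W)" for W
  define Y where "Y W = (\<Sum>k<n. \<Sum>a<n. P $$ (k, a) * h' k a W)" for W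
  have XY: "(\<Sum>k<n. \<Sum>a<n. P $$ (k, a) * (g' k a W + h' k a W)) = X W + Y W" for W
    by (simp add: X_def Y_def algebra_simps sum.distrib)
  obtain K where K: "\<And>W t. W \<in> unitary_group n \<Longrightarrow> t \<in> {0..1} \<Longrightarrow>
        cmod (g (rotation P t * W) - g W - \<i> * t * X W) \<le> K * t\<^sup>2"
    using left_derivative_bound[OF assms(1) P] unfolding X_def by blast
  obtain L where L: "\<And>W t. W \<in> unitary_group n \<Longrightarrow> t \<in> {0..1} \<Longrightarrow>
        cmod (h (rotation P t * W) - h W - \<i> * t * Y W) \<le> L * t\<^sup>2"
    using left_derivative_bound[OF assms(2) P] unfolding Y_def by blast
  have "cmod (g (rotation P t * W) + h (rotation P t * W) - (g W + h W) - \<i> * t * (X W + Y W)) \<le> (K + L) * t\<^sup>2"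
    if "W \<in> unitary_group n" "t \<in> {0..1}" for W t
  proof -
    have "g (rotation P t * W) + h (rotation P t * W) - (g W + h W) - \<i> * t * (X W + Y W) =
      (g (rotation P t * W) - g W - \<i> * t * X W) + (h (rotation P t * W) - h W - \<i> * t * Y W)"
      by (simp add: algebra_simps)
    then show ?thesis
      using norm_triangle_mono[OF K[OF that] L[OF that]] by (simp add: algebra_simps)
  qed
  then show "\<exists>K. \<forall>W\<in>unitary_group n. \<forall>t\<in>{0..1}.
     cmod (g (rotation P t * W) + h (rotation P t * W) - (g W + h W) - \<i> * t *
        (\<Sum>k<n. \<Sum>a<n. P $$ (k, a) * (g' k a W + h' k a W))) \<le> K * t\<^sup>2"
    unfolding XY by blast
qed

text \<open>Besides the two given remainders, multiplied by bounded functions, there is the product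
  of the increments of \<open>g\<close> and \<open>h\<close>. Each increment is O(t) because t^2 is
  at most t on [0, 1], so their product is O(t^2); this is where the restriction on \<open>t\<close>
  enters.\<close>

lemma left_derivative_mult:
  assumes "left_derivative g g'" "left_derivative h h'"
  shows "left_derivative (\<lambda>W. g W * h W) (\<lambda>k a W. g' k a W * h W + g W * h' k a W)"
  unfolding left_derivative_def
proof (intro conjI allI impI ballI)
  have good: "good g" "good h" and good': "\<And>k a. k < n \<Longrightarrow> a < n \<Longrightarrow> good (g' k a)"
    "\<And>k a. k < n \<Longrightarrow> a < n \<Longrightarrow> good (h' k a)"
    using assms by (auto simp: left_derivative_def)
  show "good (\<lambda>W. g W * h W)" using good by auto
  show "good (\<lambda>W. g' k a W * h W + g W * h' k a W)" if "k < n" "a < n" for k a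
    using good good' that by (intro good_add good_mult) auto
  fix P assume P: "P \<in> projections"
  define X where "X W = (\<Sum>k<n. \<Sum>a<n. P $$ (k, a) * g' k a W)" for W
  define Y where "Y W = (\<Sum>k<n. \<Sum>a<n. P $$ (k, a) * h' k a W)" for W
  have XY: "(\<Sum>k<n. \<Sum>a<n. P $$ (k, a) * (g' k a W * h W + g W * h' k a W)) = X W * h W + g W * Y W" for W
    by (simp add: X_def Y_def algebra_simps sum.distrib sum_distrib_left sum_distrib_right)
  have gX: "good X" "good Y"
    unfolding X_def Y_def using good' by (auto intro!: good_sum good_mult)
  obtain K where K: "\<And>W t. W \<in> unitary_group n \<Longrightarrow> t \<in> {0..1} \<Longrightarrow>
        cmod (g (rotation P t * W) - g W - \<i> * t * X W) \<le> K * t\<^sup>2"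
    using left_derivative_bound[OF assms(1) P] unfolding X_def by blast
  obtain L where L: "\<And>W t. W \<in> unitary_group n \<Longrightarrow> t \<in> {0..1} \<Longrightarrow>
        cmod (h (rotation P t * W) - h W - \<i> * t * Y W) \<le> L * t\<^sup>2"
    using left_derivative_bound[OF assms(2) P] unfolding Y_def by blast
  obtain B1 where B1: "B1 \<ge> 0" "\<And>W. W \<in> unitary_group n \<Longrightarrow> cmod (g W) \<le> B1" using good_bound[OF good(1)] by blast
  obtain B2 where B2: "B2 \<ge> 0" "\<And>W. W \<in> unitary_group n \<Longrightarrow> cmod (h W) \<le> B2" using good_bound[OF good(2)] by blast
  obtain B3 where B3: "B3 \<ge> 0" "\<And>W. W \<in> unitary_group n \<Longrightarrow> cmod (X W) \<le> B3" using good_bound[OF gX(1)] by blast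
  obtain B4 where B4: "B4 \<ge> 0" "\<And>W. W \<in> unitary_group n \<Longrightarrow> cmod (Y W) \<le> B4" using good_bound[OF gX(2)] by blast
  have "cmod (g (rotation P t * W) * h (rotation P t * W) - g W * h W - \<i> * t * (X W * h W + g W * Y W))
      \<le> (\<bar>K\<bar> * B2 + B1 * \<bar>L\<bar> + (B3 + \<bar>K\<bar>) * (B4 + \<bar>L\<bar>)) * t\<^sup>2"
    if W: "W \<in> unitary_group n" and t: "t \<in> {0..1}" for W t
  proof -
    define dg where "dg = g (rotation P t * W) - g W"
    define dh where "dh = h (rotation P t * W) - h W"
    have t2: "t\<^sup>2 \<le> t" "0 \<le> t" using t by (auto simp: power2_eq_square mult_left_le)
    have r: "cmod (dg - \<i> * t * X W) \<le> \<bar>K\<bar> * t\<^sup>2" "cmod (dh - \<i> * t * Y W) \<le> \<bar>L\<bar> * t\<^sup>2"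
      using K[OF W t] L[OF W t] mult_right_mono[OF abs_ge_self[of K], of "t\<^sup>2"]
        mult_right_mono[OF abs_ge_self[of L], of "t\<^sup>2"] by (auto simp: dg_def dh_def)
    have dg: "cmod dg \<le> (B3 + \<bar>K\<bar>) * t"
    proof -
      have "cmod dg \<le> cmod (\<i> * t * X W) + cmod (dg - \<i> * t * X W)" by norm
      also have "\<dots> \<le> t * B3 + \<bar>K\<bar> * t"
        using r(1) t2 B3(2)[OF W] mult_left_mono[OF t2(1), of "\<bar>K\<bar>"]
        by (intro add_mono) (auto simp: norm_mult intro: mult_left_mono)
      finally show ?thesis by (simp add: algebra_simps)
    qed
    have dh: "cmod dh \<le> (B4 + \<bar>L\<bar>) * t"
    proof -
      have "cmod dh \<le> cmod (\<i> * t * Y W) + cmod (dh - \<i> * t * Y W)" by norm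
      also have "\<dots> \<le> t * B4 + \<bar>L\<bar> * t"
        using r(2) t2 B4(2)[OF W] mult_left_mono[OF t2(1), of "\<bar>L\<bar>"]
        by (intro add_mono) (auto simp: norm_mult intro: mult_left_mono)
      finally show ?thesis by (simp add: algebra_simps)
    qed
    have "g (rotation P t * W) * h (rotation P t * W) - g W * h W - \<i> * t * (X W * h W + g W * Y W) =
        (dg - \<i> * t * X W) * h W + g W * (dh - \<i> * t * Y W) + dg * dh"
      by (simp add: dg_def dh_def algebra_simps)
    also have "cmod \<dots> \<le> \<bar>K\<bar> * t\<^sup>2 * B2 + B1 * (\<bar>L\<bar> * t\<^sup>2) + ((B3 + \<bar>K\<bar>) * t) * ((B4 + \<bar>L\<bar>) * t)"
      by (intro norm_triangle_mono; unfold norm_mult; intro mult_mono)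
        (use r dg dh B1 B2 B3 B4 W t2 in auto)
    also have "\<dots> = (\<bar>K\<bar> * B2 + B1 * \<bar>L\<bar> + (B3 + \<bar>K\<bar>) * (B4 + \<bar>L\<bar>)) * t\<^sup>2"
      by (simp add: algebra_simps power2_eq_square)
    finally show ?thesis .
  qed
  then show "\<exists>K. \<forall>W\<in>unitary_group n. \<forall>t\<in>{0..1}.
     cmod (g (rotation P t * W) * h (rotation P t * W) - g W * h W - \<i> * t *
        (\<Sum>k<n. \<Sum>a<n. P $$ (k, a) * (g' k a W * h W + g W * h' k a W))) \<le> K * t\<^sup>2"
    unfolding XY by blast
qed

lemma left_derivative_sum:
  "(\<And>i. i \<in> S \<Longrightarrow> left_derivative (g i) (g' i)) \<Longrightarrow>
    left_derivative (\<lambda>W. \<Sum>i\<in>S. g i W) (\<lambda>k a W. \<Sum>i\<in>S. g' i k a W)"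
  by (induction S rule: infinite_finite_induct) (simp_all add: left_derivative_const left_derivative_add)

text \<open>Left invariance makes the mean of the increment of \<open>g\<close> along a rotation
  vanish. As the remainder is O(t^2) uniformly in \<open>W\<close>, the mean of the derivative is at
  most K t for every t in (0, 1], hence zero. This covers the directions iP, and
  \<open>projections_span\<close> passes to matrix units.\<close>

theorem integral_left_derivative:
  assumes d: "left_derivative g g'" and ka: "k < n" "a < n"
  shows "(\<integral>W. g' k a W \<partial>\<mu>) = 0"
proof (rule projections_span[OF _ ka, of "\<lambda>k a. \<integral>W. g' k a W \<partial>\<mu>"])
  fix P assume P: "P \<in> projections"
  define X where "X W = (\<Sum>k<n. \<Sum>a<n. P $$ (k, a) * g' k a W)" for W
  have good: "good g" and good': "\<And>k a. k < n \<Longrightarrow> a < n \<Longrightarrow> good (g' k a)"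
    using d by (auto simp: left_derivative_def)
  have gX: "good X" unfolding X_def using good' by (auto intro!: good_sum good_mult)
  have IX: "(\<integral>W. X W \<partial>\<mu>) = (\<Sum>k<n. \<Sum>a<n. P $$ (k, a) * (\<integral>W. g' k a W \<partial>\<mu>))"
  proof -
    have "(\<integral>W. X W \<partial>\<mu>) = (\<Sum>k<n. \<integral>W. (\<Sum>a<n. P $$ (k, a) * g' k a W) \<partial>\<mu>)"
      unfolding X_def using good'
      by (intro Bochner_Integration.integral_sum good_integrable good_sum good_mult) auto
    also have "\<dots> = (\<Sum>k<n. \<Sum>a<n. \<integral>W. P $$ (k, a) * g' k a W \<partial>\<mu>)"
      using good'
      by (intro sum.cong refl Bochner_Integration.integral_sum good_integrable good_sum good_mult) auto
    finally show ?thesis by simp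
  qed
  obtain K where K: "\<And>W t. W \<in> unitary_group n \<Longrightarrow> t \<in> {0..1} \<Longrightarrow>
        cmod (g (rotation P t * W) - g W - \<i> * t * X W) \<le> K * t\<^sup>2"
    using left_derivative_bound[OF d P] unfolding X_def by blast
  have le: "cmod (\<integral>W. X W \<partial>\<mu>) \<le> K * t" if t: "t \<in> {0<..1}" for t
  proof -
    have V: "rotation P t \<in> unitary_group n" by (rule rotation_unitary[OF P])
    have gd: "good (\<lambda>W. g (rotation P t * W) - g W - \<i> * t * X W)"
      using good_left_mult[OF V good] good gX by (auto intro!: good_minus good_mult)
    have "(\<integral>W. g (rotation P t * W) - g W - \<i> * t * X W \<partial>\<mu>) = - (\<i> * t * (\<integral>W. X W \<partial>\<mu>))"
      using good_integrable[OF good_left_mult[OF V good]] good_integrable[OF good] good_integrable[OF gX]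
      by (simp add: integral_left_mult[OF V good])
    then have "t * cmod (\<integral>W. X W \<partial>\<mu>) = cmod (\<integral>W. g (rotation P t * W) - g W - \<i> * t * X W \<partial>\<mu>)"
      using t by (simp add: norm_mult)
    also have "\<dots> \<le> (\<integral>W. cmod (g (rotation P t * W) - g W - \<i> * t * X W) \<partial>\<mu>)"
      by (rule integral_norm_bound)
    also have "\<dots> \<le> (\<integral>W. K * t\<^sup>2 \<partial>\<mu>)"
      using K t good_integrable[OF gd] by (intro integral_mono) (auto simp: space_haar)
    also have "\<dots> = t * (K * t)" by (simp add: prob_space power2_eq_square)
    finally show ?thesis using t by simp
  qed
  have "((\<lambda>t. K * t) \<longlongrightarrow> K * 0) (at_right 0)" by (intro tendsto_intros)
  moreover have "\<forall>\<^sub>F t in at_right 0. cmod (\<integral>W. X W \<partial>\<mu>) \<le> K * t"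
    using eventually_at_right_real[of 0 1] by (rule eventually_mono) (auto intro: le)
  ultimately have "cmod (\<integral>W. X W \<partial>\<mu>) \<le> 0"
    by (intro tendsto_lowerbound[of "\<lambda>t. K * t" _ "at_right 0"]) auto
  then show "(\<Sum>k<n. \<Sum>a<n. P $$ (k, a) * (\<integral>W. g' k a W \<partial>\<mu>)) = 0"
    by (simp add: IX[symmetric])
qed

end

section \<open>The Schwinger-Dyson equation\<close>

declare index_mult_mat(1) [simp del]

context haar
begin

lemma good_mult_entry:
  assumes "\<And>W. W \<in> unitary_group n \<Longrightarrow> F W \<in> Mn" "\<And>W. W \<in> unitary_group n \<Longrightarrow> G W \<in> Mn"
    and "\<And>i j. i < n \<Longrightarrow> j < n \<Longrightarrow> good (\<lambda>W. F W $$ (i, j))"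
    and "\<And>i j. i < n \<Longrightarrow> j < n \<Longrightarrow> good (\<lambda>W. G W $$ (i, j))"
    and "i < n" "j < n"
  shows "good (\<lambda>W. (F W * G W) $$ (i, j))"
proof (rule good_cong)
  show "good (\<lambda>W. \<Sum>k<n. F W $$ (i, k) * G W $$ (k, j))"
    using assms by (intro good_sum good_mult) auto
qed (use assms in \<open>simp add: mult_idx\<close>)

lemma good_conj_by_entry:
  assumes b: "b \<in> Mn" and "i < n" "j < n"
  shows "good (\<lambda>W. conj_by W b $$ (i, j))"
proof -
  have adj: "good (\<lambda>W. mat_adjoint W $$ (i, j))" if "i < n" "j < n" for i j
  proof (rule good_cong)
    show "good (\<lambda>W. cnj (W $$ (j, i)))" using that by (intro good_cnj good_entry)
    fix W assume "W \<in> unitary_group n"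
    then have "W \<in> Mn" by simp
    then show "cnj (W $$ (j, i)) = mat_adjoint W $$ (i, j)" using that by auto
  qed
  show ?thesis
    unfolding conj_by_def using assms adj by (intro good_mult_entry good_entry) auto
qed

text \<open>Subtracting i t (P C - C P) from \<open>conj_by_rotation\<close> leaves P C with
  coefficient z - i t, C P with the conjugate coefficient, and P C P with coefficient |z|^2, where z
  = exp (i t) - 1. All three coefficients have modulus at most t^2.\<close>

lemma left_derivative_conj_by:
  assumes b: "b \<in> Mn" and ij: "i < n" "j < n"
  shows "left_derivative (\<lambda>W. conj_by W b $$ (i, j))
    (\<lambda>k a W. (eunit k a * conj_by W b - conj_by W b * eunit k a) $$ (i, j))"
  unfolding left_derivative_def
proof (intro conjI allI impI ballI)
  show "good (\<lambda>W. conj_by W b $$ (i, j))" using assms by (rule good_conj_by_entry)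
  have idx: "(eunit k a * C - C * eunit k a) $$ (i, j) =
      (if i = k then C $$ (a, j) else 0) - (if j = a then C $$ (i, k) else 0)"
    if "k < n" "a < n" "C \<in> Mn" for k a C
    using that ij eunit_mult_index[OF that(3,1,2) ij] mult_eunit_index[OF that(3,1,2) ij]
    by (simp add: entry_plus_minus del: index_minus_mat)
  show "good (\<lambda>W. (eunit k a * conj_by W b - conj_by W b * eunit k a) $$ (i, j))" if "k < n" "a < n" for k a
  proof (rule good_cong)
    show "good (\<lambda>W. (if i = k then conj_by W b $$ (a, j) else 0) - (if j = a then conj_by W b $$ (i, k) else 0))"
      using that assms
      by (intro good_minus; cases "i = k"; cases "j = a") (simp_all add: good_conj_by_entry)
  qed (use that b in \<open>auto simp: idx\<close>)
  fix P assume P: "P \<in> projections"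
  then have Pc: "P \<in> Mn" by (simp add: projections_def)
  have sum: "(\<Sum>k<n. \<Sum>a<n. P $$ (k, a) * (eunit k a * C - C * eunit k a) $$ (i, j)) =
      (P * C) $$ (i, j) - (C * P) $$ (i, j)" if "C \<in> Mn" for C
  proof -
    have "(\<Sum>k<n. \<Sum>a<n. P $$ (k, a) * (eunit k a * C - C * eunit k a) $$ (i, j)) =
      (\<Sum>k<n. \<Sum>a<n. if k = i then P $$ (k, a) * C $$ (a, j) else 0) -
      (\<Sum>k<n. \<Sum>a<n. if a = j then P $$ (k, a) * C $$ (i, k) else 0)"
      unfolding sum_subtractf[symmetric] by (intro sum.cong refl) (auto simp: idx[OF _ _ that] algebra_simps)
    also have "(\<Sum>k<n. \<Sum>a<n. if k = i then P $$ (k, a) * C $$ (a, j) else 0) =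
      (\<Sum>k<n. if k = i then \<Sum>a<n. P $$ (k, a) * C $$ (a, j) else 0)"
      by (intro sum.cong refl) auto
    also have "\<dots> - (\<Sum>k<n. \<Sum>a<n. if a = j then P $$ (k, a) * C $$ (i, k) else 0) = (P * C) $$ (i, j) - (C * P) $$ (i, j)"
      using ij Pc that by (simp add: mult_idx mult.commute)
    finally show ?thesis .
  qed
  have "good (\<lambda>W. (P * conj_by W b) $$ (i, j))" "good (\<lambda>W. (conj_by W b * P) $$ (i, j))"
    "good (\<lambda>W. (P * (conj_by W b * P)) $$ (i, j))"
    using Pc b ij by (auto intro!: good_mult_entry good_conj_by_entry)
  then obtain B1 B2 B3 where
    B: "\<And>W. W \<in> unitary_group n \<Longrightarrow> cmod ((P * conj_by W b) $$ (i, j)) \<le> B1"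
      "\<And>W. W \<in> unitary_group n \<Longrightarrow> cmod ((conj_by W b * P) $$ (i, j)) \<le> B2"
      "\<And>W. W \<in> unitary_group n \<Longrightarrow> cmod ((P * (conj_by W b * P)) $$ (i, j)) \<le> B3"
    unfolding good_def by blast
  have "cmod (conj_by (rotation P t * W) b $$ (i, j) - conj_by W b $$ (i, j) - \<i> * t *
      (\<Sum>k<n. \<Sum>a<n. P $$ (k, a) * (eunit k a * conj_by W b - conj_by W b * eunit k a) $$ (i, j)))
      \<le> (B1 + B2 + B3) * t\<^sup>2"
    if W: "W \<in> unitary_group n" and t: "t \<in> {0..1}" for W t
  proof -
    define C where "C = conj_by W b"
    define z where "z = cis t - 1"
    have C: "C \<in> Mn" using W b by (simp add: C_def)
    have "conj_by (rotation P t * W) b $$ (i, j) - C $$ (i, j) - \<i> * t * ((P * C) $$ (i, j) - (C * P) $$ (i, j)) =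
        (z - \<i> * t) * (P * C) $$ (i, j) + cnj (z - \<i> * t) * (C * P) $$ (i, j)
        + (z * cnj z) * (P * (C * P)) $$ (i, j)"
      using C Pc ij W b unfolding conj_by_rotation[OF P unitaryD(1)[OF W] b] C_def[symmetric] z_def[symmetric]
      by (simp add: algebra_simps)
    also have "cmod \<dots> \<le> t\<^sup>2 * B1 + t\<^sup>2 * B2 + t\<^sup>2 * B3"
    proof (intro norm_triangle_mono; unfold norm_mult complex_mod_cnj; intro mult_mono)
      show "cmod z * cmod z \<le> t\<^sup>2"
        using mult_mono[OF cis_minus_one_bound[of t] cis_minus_one_bound[of t]]
        by (simp add: z_def power2_eq_square)
    qed (use B[OF W] cis_minus_one_minus_bound[of t] in \<open>auto simp: z_def C_def\<close>)
    finally show ?thesis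
      unfolding C_def[symmetric] sum[OF C] by (simp add: algebra_simps)
  qed
  then show "\<exists>K. \<forall>W\<in>unitary_group n. \<forall>t\<in>{0..1}.
      cmod (conj_by (rotation P t * W) b $$ (i, j) - conj_by W b $$ (i, j) - \<i> * t *
      (\<Sum>k<n. \<Sum>a<n. P $$ (k, a) * (eunit k a * conj_by W b - conj_by W b * eunit k a) $$ (i, j))) \<le> K * t\<^sup>2"
    by blast
qed

text \<open>The derivatives are required to lie in \<open>Mn\<close> for all \<open>k\<close> and
  \<open>a\<close>, also beyond \<open>n\<close>, so that matrix identities can be applied without
  range conditions.\<close>

definition matrix_derivative :: "(complex mat \<Rightarrow> complex mat) \<Rightarrow> (nat \<Rightarrow> nat \<Rightarrow> complex mat \<Rightarrow> complex mat) \<Rightarrow> bool" where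
  "matrix_derivative F F' \<longleftrightarrow>
     (\<forall>W\<in>unitary_group n. F W \<in> Mn \<and> (\<forall>k a. F' k a W \<in> Mn)) \<and>
     (\<forall>i<n. \<forall>j<n. left_derivative (\<lambda>W. F W $$ (i, j)) (\<lambda>k a W. F' k a W $$ (i, j)))"

lemma matrix_derivative_const: "X \<in> Mn \<Longrightarrow> matrix_derivative (\<lambda>_. X) (\<lambda>_ _ _. 0\<^sub>m n n)"
  using left_derivative_cong[OF left_derivative_const] by (auto simp: matrix_derivative_def)

lemma matrix_derivative_conj_by:
  "b \<in> Mn \<Longrightarrow> matrix_derivative (\<lambda>W. conj_by W b)
     (\<lambda>k a W. eunit k a * conj_by W b - conj_by W b * eunit k a)"
  unfolding matrix_derivative_def using left_derivative_conj_by by auto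

lemma matrix_derivative_cong:
  assumes "matrix_derivative F F'" "\<And>W. W \<in> unitary_group n \<Longrightarrow> F W = G W"
    "\<And>k a W. W \<in> unitary_group n \<Longrightarrow> F' k a W = G' k a W"
  shows "matrix_derivative G G'"
proof -
  have "left_derivative (\<lambda>W. G W $$ (i, j)) (\<lambda>k a W. G' k a W $$ (i, j))" if "i < n" "j < n" for i j
  proof (rule left_derivative_cong)
    show "left_derivative (\<lambda>W. F W $$ (i, j)) (\<lambda>k a W. F' k a W $$ (i, j))"
      using assms(1) that by (auto simp: matrix_derivative_def)
  qed (simp_all add: assms(2,3))
  then show ?thesis using assms by (auto simp: matrix_derivative_def)
qed

lemma matrix_derivative_mult:
  assumes "matrix_derivative F F'" "matrix_derivative G G'"
  shows "matrix_derivative (\<lambda>W. F W * G W) (\<lambda>k a W. F' k a W * G W + F W * G' k a W)"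
proof -
  have c: "F W \<in> Mn" "F' k a W \<in> Mn" "G W \<in> Mn" "G' k a W \<in> Mn" if "W \<in> unitary_group n" for W k a
    using assms that by (auto simp: matrix_derivative_def)
  have "left_derivative (\<lambda>W. (F W * G W) $$ (i, j)) (\<lambda>k a W. (F' k a W * G W + F W * G' k a W) $$ (i, j))"
    if ij: "i < n" "j < n" for i j
  proof (rule left_derivative_cong)
    show "left_derivative (\<lambda>W. \<Sum>l<n. F W $$ (i, l) * G W $$ (l, j))
        (\<lambda>k a W. \<Sum>l<n. F' k a W $$ (i, l) * G W $$ (l, j) + F W $$ (i, l) * G' k a W $$ (l, j))"
      using assms ij by (intro left_derivative_sum left_derivative_mult) (auto simp: matrix_derivative_def)
    fix W assume W: "W \<in> unitary_group n"
    show "(\<Sum>l<n. F W $$ (i, l) * G W $$ (l, j)) = (F W * G W) $$ (i, j)"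
      using c[OF W] ij by (simp add: mult_idx)
    fix k a
    show "(\<Sum>l<n. F' k a W $$ (i, l) * G W $$ (l, j) + F W $$ (i, l) * G' k a W $$ (l, j)) =
      (F' k a W * G W + F W * G' k a W) $$ (i, j)"
      using c[OF W] ij by (simp add: entry_plus_minus mult_idx sum.distrib del: index_add_mat)
  qed
  then show ?thesis using c by (auto simp: matrix_derivative_def)
qed

lemma matrix_derivative_const_mult:
  assumes X: "X \<in> Mn" and F: "matrix_derivative F F'"
  shows "matrix_derivative (\<lambda>W. X * F W) (\<lambda>k a W. X * F' k a W)"
proof (rule matrix_derivative_cong[OF matrix_derivative_mult[OF matrix_derivative_const[OF X] F]])
  fix k a W assume "W \<in> unitary_group n"
  then have "F W \<in> Mn" "F' k a W \<in> Mn" using F by (auto simp: matrix_derivative_def)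
  then show "0\<^sub>m n n * F W + X * F' k a W = X * F' k a W" using X by simp
qed simp

lemma matrix_derivative_mult_const:
  assumes X: "X \<in> Mn" and F: "matrix_derivative F F'"
  shows "matrix_derivative (\<lambda>W. F W * X) (\<lambda>k a W. F' k a W * X)"
proof (rule matrix_derivative_cong[OF matrix_derivative_mult[OF F matrix_derivative_const[OF X]]])
  fix k a W assume "W \<in> unitary_group n"
  then have "F W \<in> Mn" "F' k a W \<in> Mn" using F by (auto simp: matrix_derivative_def)
  then show "F' k a W * X + F W * 0\<^sub>m n n = F' k a W * X" using X by simp
qed simp

lemma matrix_derivative_wmat:
  "w \<in> words \<Longrightarrow> matrix_derivative (\<lambda>W. wmat W w) (\<lambda>k a W. wgrad k a W w)"
proof (induction w)
  case Nil
  show ?case using matrix_derivative_const[of "1\<^sub>m n"] by simp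
next
  case (Cons p w)
  obtain x b where p: "p = (x, b)" by (cases p)
  then have c: "x \<in> Mn" "b \<in> Mn" "w \<in> words" using Cons.prems by auto
  show ?case
    unfolding p wmat_Cons wgrad.simps
    by (intro matrix_derivative_mult matrix_derivative_const_mult matrix_derivative_conj_by c Cons.IH)
qed

lemma left_derivative_Tr:
  assumes "matrix_derivative F F'"
  shows "left_derivative (\<lambda>W. Tr (F W)) (\<lambda>k a W. Tr (F' k a W))"
proof (rule left_derivative_cong)
  show "left_derivative (\<lambda>W. \<Sum>i<n. F W $$ (i, i)) (\<lambda>k a W. \<Sum>i<n. F' k a W $$ (i, i))"
    using assms by (intro left_derivative_sum) (auto simp: matrix_derivative_def)
qed (use assms in \<open>auto simp: matrix_derivative_def Tr_eq[of _ n]\<close>)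

end

context square_matrices
begin

definition wtr :: "complex mat \<Rightarrow> (complex mat \<times> complex mat) list \<Rightarrow> complex" where
  "wtr W w = Tr (wmat W w)"

definition wval :: "complex mat \<Rightarrow> (complex mat \<times> complex mat) list list \<Rightarrow> complex" where
  "wval W ws = (\<Prod>w\<leftarrow>ws. wtr W w)"

lemma wval_simps [simp]:
  "wval W [] = 1" "wval W (w # ws) = wtr W w * wval W ws" "wval W (us @ ws) = wval W us * wval W ws"
  by (simp_all add: wval_def)

lemma wtr_rotate: "W \<in> Mn \<Longrightarrow> u \<in> words \<Longrightarrow> v \<in> words \<Longrightarrow> wtr W (u @ v) = wtr W (v @ u)"
  unfolding wtr_def by (simp add: wmat_append Tr_swap)

end

context haar
begin

lemma left_derivative_wval:
  assumes "set ws \<subseteq> words"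
  shows "left_derivative (\<lambda>W. wval W ws)
    (\<lambda>k a W. \<Sum>t<length ws. Tr (wgrad k a W (ws ! t)) * wval W (take t ws @ drop (Suc t) ws))"
  using assms
proof (induction ws)
  case Nil
  then show ?case by (simp add: left_derivative_const)
next
  case (Cons w ws)
  have "left_derivative (\<lambda>W. wtr W w * wval W ws) (\<lambda>k a W. Tr (wgrad k a W w) * wval W ws +
      wtr W w * (\<Sum>t<length ws. Tr (wgrad k a W (ws ! t)) * wval W (take t ws @ drop (Suc t) ws)))"
    using Cons unfolding wtr_def
    by (intro left_derivative_mult left_derivative_Tr matrix_derivative_wmat) auto
  then show ?case
    by (rule left_derivative_cong)
      (simp_all add: sum.lessThan_Suc_shift sum_distrib_left mult_ac del: sum.lessThan_Suc)
qed

lemma good_wval: "set ws \<subseteq> words \<Longrightarrow> good (\<lambda>W. wval W ws)"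
  using left_derivative_wval by (auto simp: left_derivative_def)

lemma good_Tr_wmat: "x \<in> Mn \<Longrightarrow> w \<in> words \<Longrightarrow> good (\<lambda>W. Tr (x * wmat W w))"
  using left_derivative_Tr[OF matrix_derivative_const_mult[OF _ matrix_derivative_wmat]]
  by (auto simp: left_derivative_def)

text \<open>
  Integration by parts, applied to the entry \<open>(k, a)\<close> of \<open>W b W\<^sup>* w x\<close> times \<open>wval W ws\<close> in the
  direction of the matrix unit at \<open>(k, a)\<close> and summed over \<open>k\<close> and \<open>a\<close>.
\<close>

theorem loop_equation:
  assumes x: "x \<in> Mn" and b: "b \<in> Mn" and Trb: "Tr b = 0" and w: "w \<in> words" and ws: "set ws \<subseteq> words"
  shows "of_nat n * (\<integral>W. wval W (((x, b) # w) # ws) \<partial>\<mu>) =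
    (\<Sum>i<length w. let y = fst (w ! i); c = snd (w ! i); u = take i w; v = drop (Suc i) w in
        (\<integral>W. Tr (x * wmat W v) * wval W (((y, c * b) # u) # ws) \<partial>\<mu>)
      - (\<integral>W. wval W (((y, b) # u) # ((x, c) # v) # ws) \<partial>\<mu>)) +
    (\<Sum>t<length ws. \<Sum>i<length (ws ! t).
       let p = ws ! t; y = fst (p ! i); c = snd (p ! i); u = take i p; v = drop (Suc i) p;
         ws' = take t ws @ drop (Suc t) ws in
        (\<integral>W. Tr (x * wmat W (v @ u @ (y, c * b) # w)) * wval W ws' \<partial>\<mu>)
      - (\<integral>W. wval W (((x, c) # v @ u @ (y, b) # w) # ws') \<partial>\<mu>))"
proof -
  \<comment> \<open>By cyclicity the trace of \<open>F W\<close> is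
    \<open>wtr W ((x, b) # w)\<close>: the word is opened in front of its first conjugated
    letter.\<close>
  define F where "F W = conj_by W b * (wmat W w * x)" for W
  define F' where "F' k a W = (eunit k a * conj_by W b - conj_by W b * eunit k a) * (wmat W w * x)
    + conj_by W b * (wgrad k a W w * x)" for k a W
  define G' where "G' k a W = (\<Sum>t<length ws. Tr (wgrad k a W (ws ! t)) * wval W (take t ws @ drop (Suc t) ws))" for k a W
  have dF: "matrix_derivative F F'"
    unfolding F_def F'_def
    by (intro matrix_derivative_mult matrix_derivative_mult_const matrix_derivative_conj_by
        matrix_derivative_wmat x b w)
  have dh: "left_derivative (\<lambda>W. F W $$ (i, j) * wval W ws)
      (\<lambda>k a W. F' k a W $$ (i, j) * wval W ws + F W $$ (i, j) * G' k a W)" if "i < n" "j < n" for i j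
    unfolding G'_def
    by (intro left_derivative_mult left_derivative_wval ws) (use dF that in \<open>auto simp: matrix_derivative_def\<close>)
  then have int0: "(\<integral>W. F' k a W $$ (k, a) * wval W ws + F W $$ (k, a) * G' k a W \<partial>\<mu>) = 0"
    if "k < n" "a < n" for k a
    using integral_left_derivative[OF dh[OF that]] that by simp
  have gh: "good (\<lambda>W. F' k a W $$ (k, a) * wval W ws + F W $$ (k, a) * G' k a W)" if "k < n" "a < n" for k a
    using dh[OF that] that by (auto simp: left_derivative_def)
  \<comment> \<open>\<open>T1\<close> and \<open>T3\<close> come from the half of the commutator
    with the matrix unit after the differentiated letter, where this letter meets \<open>b\<close>
    and merges with it; \<open>T2\<close> and \<open>T4\<close> come from the other half and keep
    both letters. A split of the opened word gives \<open>T1\<close> and \<open>T2\<close>, a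
    joining of two words \<open>T3\<close> and \<open>T4\<close>.\<close>
  define T1 where "T1 i W = Tr (x * wmat W (drop (Suc i) w)) *
      wval W (((fst (w ! i), snd (w ! i) * b) # take i w) # ws)" for i W
  define T2 where "T2 i W = wval W (((fst (w ! i), b) # take i w) # ((x, snd (w ! i)) # drop (Suc i) w) # ws)" for i W
  define T3 where "T3 t i W = Tr (x * wmat W (drop (Suc i) (ws ! t) @ take i (ws ! t) @
      (fst (ws ! t ! i), snd (ws ! t ! i) * b) # w)) * wval W (take t ws @ drop (Suc t) ws)" for t i W
  define T4 where "T4 t i W = wval W (((x, snd (ws ! t ! i)) # drop (Suc i) (ws ! t) @ take i (ws ! t) @
      (fst (ws ! t ! i), b) # w) # (take t ws @ drop (Suc t) ws))" for t i W
  have ws_nth: "ws ! t \<in> words" if "t < length ws" for t using ws that by auto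
  have ws_rest: "set (take t ws @ drop (Suc t) ws) \<subseteq> words" for t
    using ws by (auto dest: in_set_takeD in_set_dropD)
  have good_T: "i < length w \<Longrightarrow> good (T1 i)" "i < length w \<Longrightarrow> good (T2 i)"
    "t < length ws \<Longrightarrow> i < length (ws ! t) \<Longrightarrow> good (T3 t i)"
    "t < length ws \<Longrightarrow> i < length (ws ! t) \<Longrightarrow> good (T4 t i)" for i t
    unfolding T1_def T2_def T3_def T4_def using x b w ws words_nth[OF w] words_nth[OF ws_nth] ws_nth ws_rest
    by (intro good_mult good_wval good_Tr_wmat; simp)+
  have pointwise: "(\<Sum>k<n. \<Sum>a<n. F' k a W $$ (k, a) * wval W ws + F W $$ (k, a) * G' k a W) =
      of_nat n * wval W (((x, b) # w) # ws) - (\<Sum>i<length w. T1 i W - T2 i W)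
      - (\<Sum>t<length ws. \<Sum>i<length (ws ! t). T3 t i W - T4 t i W)" if WU: "W \<in> unitary_group n" for W
  proof -
    define C where "C = conj_by W b"
    have W: "W \<in> Mn" using WU by simp
    have C: "C \<in> Mn" using W b by (simp add: C_def)
    have M: "wmat W w \<in> Mn" using W w by simp
    \<comment> \<open>The unit matrix is inserted so that \<open>sum_mult_eunit_mult\<close>
      produces its trace \<open>n\<close>, the factor on the left side of the loop equation.\<close>
    have F'_eq: "F' k a W = 1\<^sub>m n * (eunit k a * (C * (wmat W w * x)))
        - C * (eunit k a * (wmat W w * x)) + C * (wgrad k a W w * x)" for k a
      using C M x W w by (simp add: F'_def C_def[symmetric] distribs assoc)
    have s1: "(\<Sum>k<n. \<Sum>a<n. F' k a W $$ (k, a)) = of_nat n * Tr (C * (wmat W w * x))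
      + (\<Sum>k<n. \<Sum>a<n. (C * (wgrad k a W w * x)) $$ (k, a))"
    proof -
      \<comment> \<open>Centering enters here: this trace multiplies the term in which the matrix
        unit follows the first letter, a term that could otherwise be as large as the left
        side.\<close>
      have "Tr C = 0" using Tr_conj_by[OF WU b] Trb by (simp add: C_def)
      have "(\<Sum>k<n. \<Sum>a<n. F' k a W $$ (k, a)) =
        (\<Sum>k<n. \<Sum>a<n. (1\<^sub>m n * (eunit k a * (C * (wmat W w * x)))) $$ (k, a))
        - (\<Sum>k<n. \<Sum>a<n. (C * (eunit k a * (wmat W w * x))) $$ (k, a))
        + (\<Sum>k<n. \<Sum>a<n. (C * (wgrad k a W w * x)) $$ (k, a))"
        unfolding F'_eq
      proof -
        have "1\<^sub>m n * (eunit k a * (C * (wmat W w * x))) \<in> Mn" "C * (eunit k a * (wmat W w * x)) \<in> Mn"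
          "C * (wgrad k a W w * x) \<in> Mn" for k a using C M x W w by auto
        then show "(\<Sum>k<n. \<Sum>a<n. (1\<^sub>m n * (eunit k a * (C * (wmat W w * x)))
            - C * (eunit k a * (wmat W w * x)) + C * (wgrad k a W w * x)) $$ (k, a)) =
          (\<Sum>k<n. \<Sum>a<n. (1\<^sub>m n * (eunit k a * (C * (wmat W w * x)))) $$ (k, a))
          - (\<Sum>k<n. \<Sum>a<n. (C * (eunit k a * (wmat W w * x))) $$ (k, a))
          + (\<Sum>k<n. \<Sum>a<n. (C * (wgrad k a W w * x)) $$ (k, a))"
          by (simp add: entry_plus_minus sum.distrib sum_subtractf del: index_add_mat index_minus_mat)
      qed
      also have "(\<Sum>k<n. \<Sum>a<n. (1\<^sub>m n * (eunit k a * (C * (wmat W w * x)))) $$ (k, a)) =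
          of_nat n * Tr (C * (wmat W w * x))"
        using C M x by (subst sum_mult_eunit_mult) auto
      also have "(\<Sum>k<n. \<Sum>a<n. (C * (eunit k a * (wmat W w * x))) $$ (k, a)) = 0"
        using C M x by (subst sum_mult_eunit_mult) (auto simp: \<open>Tr C = 0\<close>)
      finally show ?thesis by simp
    qed
    have r1: "Tr (C * (wmat W w * x)) = wtr W ((x, b) # w)"
      using Tr_swap[of "C * wmat W w" x] C M x by (simp add: wtr_def wmat_Cons C_def[symmetric] assoc)
    have r2: "(\<Sum>k<n. \<Sum>a<n. (C * (wgrad k a W w * x)) $$ (k, a)) * wval W ws = (\<Sum>i<length w. T2 i W - T1 i W)"
      unfolding sum_wgrad_index[OF W w C x] sum_distrib_right
    proof (rule sum.cong[OF refl], goal_cases)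
      case (1 i)
      define y where "y = fst (w ! i)"
      define c where "c = snd (w ! i)"
      define u where "u = wmat W (take i w)"
      define v where "v = wmat W (drop (Suc i) w)"
      have yc: "y \<in> Mn" "c \<in> Mn" "u \<in> Mn" "v \<in> Mn" "conj_by W c \<in> Mn"
        using words_nth[OF w] 1 W w by (auto simp: y_def c_def u_def v_def)
      have "Tr (C * (u * y)) = Tr (y * (C * u))"
        using Tr_swap[of "C * u" y] yc C by (simp add: assoc)
      moreover have "Tr (conj_by W c * (v * x)) = Tr (x * (conj_by W c * v))"
        using Tr_swap[of "conj_by W c * v" x] yc x by (simp add: assoc)
      moreover have "Tr (C * (u * (y * conj_by W c))) = Tr (y * (conj_by W (c * b) * u))"
        using Tr_swap[of "C * u" "y * conj_by W c"] yc C b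
        by (simp add: assoc C_def conj_by_mult[OF WU, symmetric])
      moreover have "Tr (v * x) = Tr (x * v)" using yc x by (intro Tr_swap)
      ultimately show ?case
        using yc x C b W by (simp add: T1_def T2_def y_def[symmetric] c_def[symmetric] u_def[symmetric]
            v_def[symmetric] wtr_def wmat_Cons assoc C_def[symmetric] algebra_simps)
    qed
    have r3: "(\<Sum>k<n. \<Sum>a<n. F W $$ (k, a) * G' k a W) =
        (\<Sum>t<length ws. \<Sum>i<length (ws ! t). T4 t i W - T3 t i W)"
    proof -
      have FW: "F W \<in> Mn" using C M x by (simp add: F_def C_def[symmetric])
      have "(\<Sum>k<n. \<Sum>a<n. F W $$ (k, a) * G' k a W) =
        (\<Sum>t<length ws. (\<Sum>k<n. \<Sum>a<n. F W $$ (k, a) * Tr (wgrad k a W (ws ! t)))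
            * wval W (take t ws @ drop (Suc t) ws))"
        unfolding G'_def sum_distrib_left sum_distrib_right
        by (subst (3) sum.swap, subst (2) sum.swap) (simp add: mult_ac)
      also have "\<dots> = (\<Sum>t<length ws. \<Sum>i<length (ws ! t). T4 t i W - T3 t i W)"
      proof (rule sum.cong[OF refl], goal_cases)
        case (1 t)
        then have p: "ws ! t \<in> words" using ws_nth by auto
        have one: "Tr (wgrad k a W (ws ! t)) = Tr (1\<^sub>m n * wgrad k a W (ws ! t))" for k a
          using p W by simp
        show ?case
          unfolding one sum_Tr_wgrad[OF W p one_carrier_mat FW] sum_distrib_right
        proof (rule sum.cong[OF refl], goal_cases)
          case (1 i)
          define y where "y = fst (ws ! t ! i)"
          define c where "c = snd (ws ! t ! i)"
          define u where "u = wmat W (take i (ws ! t))"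
          define v where "v = wmat W (drop (Suc i) (ws ! t))"
          have uv: "take i (ws ! t) \<in> words" "drop (Suc i) (ws ! t) \<in> words" using p by auto
          have yc: "y \<in> Mn" "c \<in> Mn" "u \<in> Mn" "v \<in> Mn" "conj_by W c \<in> Mn"
            using words_nth[OF p] 1 W p by (auto simp: y_def c_def u_def v_def)
          have "Tr (F W * (conj_by W c * (v * (u * y)))) = Tr (x * (conj_by W c * (v * (u * (y * (C * wmat W w))))))"
            using Tr_swap[of "C * wmat W w" "x * (conj_by W c * (v * (u * y)))"] yc C M x
            by (simp add: F_def C_def[symmetric] assoc)
          moreover have "Tr (F W * (v * (u * (y * conj_by W c)))) =
              Tr (x * (v * (u * (y * (conj_by W (c * b) * wmat W w)))))"
            using Tr_swap[of "C * wmat W w" "x * (v * (u * (y * conj_by W c)))"] yc C M x b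
            by (simp add: F_def C_def assoc conj_by_mult[OF WU, symmetric])
          ultimately show ?case
            using yc x C b M W w uv by (simp add: T3_def T4_def y_def[symmetric] c_def[symmetric] u_def[symmetric]
                v_def[symmetric] wtr_def wmat_Cons wmat_append assoc C_def[symmetric] algebra_simps)
        qed
      qed
      finally show ?thesis .
    qed
    have "(\<Sum>k<n. \<Sum>a<n. F' k a W $$ (k, a) * wval W ws + F W $$ (k, a) * G' k a W) =
      (\<Sum>k<n. \<Sum>a<n. F' k a W $$ (k, a)) * wval W ws + (\<Sum>k<n. \<Sum>a<n. F W $$ (k, a) * G' k a W)"
      by (simp add: sum.distrib sum_distrib_right)
    also have "\<dots> = of_nat n * wval W (((x, b) # w) # ws) + (\<Sum>i<length w. T2 i W - T1 i W)
       + (\<Sum>t<length ws. \<Sum>i<length (ws ! t). T4 t i W - T3 t i W)"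
      unfolding s1 r3 distrib_right r2 by (simp add: r1)
    finally show ?thesis by (simp add: sum_subtractf)
  qed
  have "(\<integral>W. (\<Sum>k<n. \<Sum>a<n. F' k a W $$ (k, a) * wval W ws + F W $$ (k, a) * G' k a W) \<partial>\<mu>) =
      (\<Sum>k<n. \<Sum>a<n. \<integral>W. F' k a W $$ (k, a) * wval W ws + F W $$ (k, a) * G' k a W \<partial>\<mu>)"
    using gh by (subst Bochner_Integration.integral_sum, force intro!: good_integrable good_sum)
      (intro sum.cong refl Bochner_Integration.integral_sum good_integrable; simp)
  also have "\<dots> = 0" using int0 by simp
  also have "(\<integral>W. (\<Sum>k<n. \<Sum>a<n. F' k a W $$ (k, a) * wval W ws + F W $$ (k, a) * G' k a W) \<partial>\<mu>) =
      (\<integral>W. of_nat n * wval W (((x, b) # w) # ws) - (\<Sum>i<length w. T1 i W - T2 i W)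
      - (\<Sum>t<length ws. \<Sum>i<length (ws ! t). T3 t i W - T4 t i W) \<partial>\<mu>)"
    by (rule Bochner_Integration.integral_cong[OF refl], rule pointwise) (simp add: space_haar)
  also have "\<dots> = of_nat n * (\<integral>W. wval W (((x, b) # w) # ws) \<partial>\<mu>)
      - (\<integral>W. (\<Sum>i<length w. T1 i W - T2 i W) \<partial>\<mu>)
      - (\<integral>W. (\<Sum>t<length ws. \<Sum>i<length (ws ! t). T3 t i W - T4 t i W) \<partial>\<mu>)"
  proof -
    have i1: "integrable \<mu> (\<lambda>W. of_nat n * wval W (((x, b) # w) # ws))"
      using x b w ws by (intro good_integrable good_mult good_const good_wval) auto
    have i2: "integrable \<mu> (\<lambda>W. \<Sum>i<length w. T1 i W - T2 i W)"
      using good_T by (intro good_integrable good_sum good_minus) auto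
    have i3: "integrable \<mu> (\<lambda>W. \<Sum>t<length ws. \<Sum>i<length (ws ! t). T3 t i W - T4 t i W)"
      using good_T by (intro good_integrable good_sum good_minus) auto
    show ?thesis
      by (subst Bochner_Integration.integral_diff[OF Bochner_Integration.integrable_diff[OF i1 i2] i3],
          subst Bochner_Integration.integral_diff[OF i1 i2]) simp
  qed
  also have "(\<integral>W. (\<Sum>i<length w. T1 i W - T2 i W) \<partial>\<mu>) =
      (\<Sum>i<length w. (\<integral>W. T1 i W \<partial>\<mu>) - (\<integral>W. T2 i W \<partial>\<mu>))"
    using good_T
    by (subst Bochner_Integration.integral_sum, force intro!: good_integrable good_minus)
      (intro sum.cong refl Bochner_Integration.integral_diff good_integrable; simp)
  also have "(\<integral>W. (\<Sum>t<length ws. \<Sum>i<length (ws ! t). T3 t i W - T4 t i W) \<partial>\<mu>) =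
      (\<Sum>t<length ws. \<Sum>i<length (ws ! t). (\<integral>W. T3 t i W \<partial>\<mu>) - (\<integral>W. T4 t i W \<partial>\<mu>))"
  proof -
    have "(\<integral>W. (\<Sum>t<length ws. \<Sum>i<length (ws ! t). T3 t i W - T4 t i W) \<partial>\<mu>) =
      (\<Sum>t<length ws. \<integral>W. (\<Sum>i<length (ws ! t). T3 t i W - T4 t i W) \<partial>\<mu>)"
      using good_T by (intro Bochner_Integration.integral_sum good_integrable good_sum good_minus) auto
    also have "\<dots> = (\<Sum>t<length ws. \<Sum>i<length (ws ! t). \<integral>W. T3 t i W - T4 t i W \<partial>\<mu>)"
      using good_T
      by (intro sum.cong refl Bochner_Integration.integral_sum good_integrable good_minus) auto
    also have "\<dots> = (\<Sum>t<length ws. \<Sum>i<length (ws ! t). (\<integral>W. T3 t i W \<partial>\<mu>) - (\<integral>W. T4 t i W \<partial>\<mu>))"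
      using good_T
      by (intro sum.cong refl Bochner_Integration.integral_diff good_integrable) auto
    finally show ?thesis .
  qed
  finally show ?thesis
    unfolding Let_def T1_def[symmetric] T2_def[symmetric] T3_def[symmetric] T4_def[symmetric]
    by (simp add: algebra_simps)
qed

end

section \<open>Decay of the moments of centered words\<close>

lemma (in haar) good_Tr: "matrix_derivative F F' \<Longrightarrow> good (\<lambda>W. Tr (F W))"
  using left_derivative_Tr by (auto simp: left_derivative_def)

context square_matrices
begin

definition center :: "complex mat \<Rightarrow> complex mat" where
  "center b = b - tr b \<cdot>\<^sub>m 1\<^sub>m n"

lemma center_carrier [simp, intro]: "b \<in> Mn \<Longrightarrow> center b \<in> Mn"
  by (simp add: center_def)

lemma Tr_center: "b \<in> Mn \<Longrightarrow> n > 0 \<Longrightarrow> Tr (center b) = 0"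
  by (simp add: center_def Tr_plus_minus Tr_smult[of _ n] tr_def)

lemma conj_by_center:
  assumes W: "W \<in> unitary_group n" and b: "b \<in> Mn"
  shows "conj_by W b = conj_by W (center b) + tr b \<cdot>\<^sub>m 1\<^sub>m n"
proof -
  have "b = center b + tr b \<cdot>\<^sub>m 1\<^sub>m n"
    using b unfolding center_def by (intro eq_matI) auto
  then have "conj_by W b = conj_by W (center b + tr b \<cdot>\<^sub>m 1\<^sub>m n)" by simp
  then show ?thesis
    using W b by (simp add: conj_by_add conj_by_smult conj_by_one)
qed

text \<open>A matrix in front of a word joins its first letter. Stray factors left behind by deleted
  letters disappear in this way.\<close>

lemma Tr_absorb:
  "W \<in> Mn \<Longrightarrow> x \<in> Mn \<Longrightarrow> z \<in> Mn \<Longrightarrow> d \<in> Mn \<Longrightarrow> w \<in> words \<Longrightarrow>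
    Tr (x * wmat W ((z, d) # w)) = wtr W ((x * z, d) # w)"
  by (simp add: wtr_def wmat_Cons assoc)

text \<open>By \<open>conj_by_center\<close> the conjugated letter is a centered one plus a scalar.
  The scalar part deletes this letter but leaves its companion \<open>y\<close> stranded between
  \<open>p\<close> and \<open>w\<close>.\<close>

lemma wmat_center:
  assumes W: "W \<in> unitary_group n" and c: "y \<in> Mn" "b \<in> Mn" "p \<in> words" "w \<in> words"
  shows "wmat W (p @ (y, b) # w) = wmat W (p @ (y, center b) # w) + tr b \<cdot>\<^sub>m (wmat W p * (y * wmat W w))"
proof -
  have "wmat W p * (y * ((C + s \<cdot>\<^sub>m 1\<^sub>m n) * M)) = wmat W p * (y * (C * M)) + s \<cdot>\<^sub>m (wmat W p * (y * M))"
    if "C \<in> Mn" "M \<in> Mn" for C M s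
    using that c W by (simp add: distribs smult_mults)
  then show ?thesis
    using W c by (simp add: wmat_append wmat_Cons assoc conj_by_center[OF W c(2)])
qed

lemma Tr_wmat_center:
  assumes W: "W \<in> unitary_group n" and c: "y \<in> Mn" "b \<in> Mn" "p \<in> words" "w \<in> words" and x: "x \<in> Mn"
  shows "Tr (x * wmat W (p @ (y, b) # w)) = Tr (x * wmat W (p @ (y, center b) # w))
    + tr b * Tr (x * (wmat W p * (y * wmat W w)))"
  unfolding wmat_center[OF W c] using W c x
  by (simp add: distribs smult_mults Tr_plus_minus Tr_smult[of _ n])

lemma wtr_center:
  assumes W: "W \<in> unitary_group n" and c: "y \<in> Mn" "b \<in> Mn" "w \<in> words"
  shows "wtr W ((y, b) # w) = wtr W ((y, center b) # w) + tr b * Tr (y * wmat W w)"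
  using Tr_wmat_center[OF W c(1,2) words_Nil c(3) one_carrier_mat] W c by (simp add: wtr_def)

text \<open>The stranded \<open>y\<close> travels around the trace to the front if nothing follows
  it, and joins the next letter otherwise.\<close>

lemma Tr_wmat_infix:
  assumes W: "W \<in> Mn" and c: "x \<in> Mn" "y \<in> Mn" "p \<in> words" "w \<in> words"
  shows "w = [] \<Longrightarrow> Tr (x * (wmat W p * (y * wmat W w))) = Tr ((y * x) * wmat W p)"
    and "w = (z, d) # w' \<Longrightarrow> Tr (x * (wmat W p * (y * wmat W w))) = Tr (x * wmat W (p @ (y * z, d) # w'))"
proof -
  show "Tr (x * (wmat W p * (y * wmat W w))) = Tr ((y * x) * wmat W p)" if "w = []"
    using that W c Tr_swap[of "x * wmat W p" y] by (simp add: assoc)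
  show "Tr (x * (wmat W p * (y * wmat W w))) = Tr (x * wmat W (p @ (y * z, d) # w'))" if "w = (z, d) # w'"
    using that W c by (simp add: wmat_append wmat_Cons assoc)
qed

end

text \<open>This is f n = O(n^(-r/2)); powers of the square root keep the exponent a natural
  number.\<close>

definition decays :: "nat \<Rightarrow> (nat \<Rightarrow> complex) \<Rightarrow> bool" where
  "decays r f \<longleftrightarrow> (\<exists>K. \<forall>\<^sub>F n in sequentially. cmod (f n) * sqrt (real n) ^ r \<le> K)"

lemma decays_zero [simp]: "decays r (\<lambda>_. 0)"
  by (auto simp: decays_def intro!: exI[of _ 0])

lemma decays_cong:
  assumes "decays r f" "\<And>n. n \<ge> 1 \<Longrightarrow> f n = g n"
  shows "decays r g"
proof -
  obtain K where "\<forall>\<^sub>F n in sequentially. cmod (f n) * sqrt (real n) ^ r \<le> K"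
    using assms(1) by (auto simp: decays_def)
  then have "\<forall>\<^sub>F n in sequentially. cmod (g n) * sqrt (real n) ^ r \<le> K"
    using eventually_ge_at_top[of 1] by eventually_elim (simp add: assms(2))
  then show ?thesis by (auto simp: decays_def)
qed

lemma decays_add:
  assumes "decays r f" "decays r g"
  shows "decays r (\<lambda>n. f n + g n)"
proof -
  obtain K L where "\<forall>\<^sub>F n in sequentially. cmod (f n) * sqrt (real n) ^ r \<le> K"
    "\<forall>\<^sub>F n in sequentially. cmod (g n) * sqrt (real n) ^ r \<le> L"
    using assms by (auto simp: decays_def)
  then have "\<forall>\<^sub>F n in sequentially. cmod (f n + g n) * sqrt (real n) ^ r \<le> K + L"
  proof eventually_elim
    case (elim n)
    have "cmod (f n + g n) * sqrt (real n) ^ r \<le> (cmod (f n) + cmod (g n)) * sqrt (real n) ^ r"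
      by (intro mult_right_mono norm_triangle_ineq) auto
    then show ?case using elim by (simp add: algebra_simps)
  qed
  then show ?thesis by (auto simp: decays_def)
qed

lemma decays_sum: "(\<And>i. i \<in> S \<Longrightarrow> decays r (f i)) \<Longrightarrow> decays r (\<lambda>n. \<Sum>i\<in>S. f i n)"
  by (induction S rule: infinite_finite_induct) (auto intro: decays_add)

lemma decays_bounded_mult:
  assumes "decays r f" "\<And>n. cmod (c n) \<le> B"
  shows "decays r (\<lambda>n. c n * f n)"
proof -
  obtain K where K: "\<forall>\<^sub>F n in sequentially. cmod (f n) * sqrt (real n) ^ r \<le> K"
    using assms(1) by (auto simp: decays_def)
  have B: "B \<ge> 0" using assms(2)[of 0] norm_ge_zero order_trans by blast
  have "\<forall>\<^sub>F n in sequentially. cmod (c n * f n) * sqrt (real n) ^ r \<le> B * K"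
    using K
  proof eventually_elim
    case (elim n)
    have "cmod (c n * f n) * sqrt (real n) ^ r = cmod (c n) * (cmod (f n) * sqrt (real n) ^ r)"
      by (simp add: norm_mult)
    also have "\<dots> \<le> B * K" using assms(2)[of n] elim B by (intro mult_mono) auto
    finally show ?case .
  qed
  then show ?thesis by (auto simp: decays_def)
qed

lemma decays_mono:
  assumes "decays r f" "s \<le> r"
  shows "decays s f"
proof -
  obtain K where "\<forall>\<^sub>F n in sequentially. cmod (f n) * sqrt (real n) ^ r \<le> K"
    using assms(1) by (auto simp: decays_def)
  then have "\<forall>\<^sub>F n in sequentially. cmod (f n) * sqrt (real n) ^ s \<le> K"
    using eventually_ge_at_top[of 1]
  proof eventually_elim
    case (elim n)
    have "sqrt (real n) ^ s \<le> sqrt (real n) ^ r" using elim assms(2) by (intro power_increasing) auto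
    then have "cmod (f n) * sqrt (real n) ^ s \<le> cmod (f n) * sqrt (real n) ^ r"
      by (intro mult_left_mono) auto
    then show ?case using elim by simp
  qed
  then show ?thesis by (auto simp: decays_def)
qed

lemma decays_cmod:
  assumes "decays r f"
  shows "decays r (\<lambda>n. complex_of_real (cmod (f n)))"
  using assms by (simp add: decays_def)

text \<open>A letter is a whole sequence of matrices, one for each dimension, so that a word has a
  shape independent of \<open>n\<close> and its mean is a sequence whose decay can be
  stated.\<close>

type_synonym symbol = "nat \<Rightarrow> complex mat"

definition inst :: "nat \<Rightarrow> (symbol \<times> symbol) list \<Rightarrow> (complex mat \<times> complex mat) list" where
  "inst n w = map (\<lambda>(x, b). (x n, b n)) w"

lemma inst_simps [simp]:
  "inst n [] = []" "inst n (p # w) = (fst p n, snd p n) # inst n w"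
  "inst n (u @ v) = inst n u @ inst n v" "length (inst n w) = length w"
  by (auto simp: inst_def split_beta)

lemma inst_take: "take i (inst n w) = inst n (take i w)"
  and inst_drop: "drop i (inst n w) = inst n (drop i w)"
  by (simp_all add: inst_def take_map drop_map)

lemma inst_nth: "i < length w \<Longrightarrow> inst n w ! i = (fst (w ! i) n, snd (w ! i) n)"
  by (simp add: inst_def split_beta)

text \<open>Sequences of letters, closed under the operations that the loop equation produces.\<close>

locale haar_letters =
  fixes \<mu> :: "nat \<Rightarrow> complex mat measure" and SA SB :: "symbol set"
  assumes haar_seq: "n \<ge> 1 \<Longrightarrow> haar n (\<mu> n)"
    and SA_carrier: "x \<in> SA \<Longrightarrow> x n \<in> carrier_mat n n"
    and SA_mult: "x \<in> SA \<Longrightarrow> y \<in> SA \<Longrightarrow> (\<lambda>n. x n * y n) \<in> SA"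
    and SA_adjoint: "x \<in> SA \<Longrightarrow> (\<lambda>n. mat_adjoint (x n)) \<in> SA"
    and SA_bounded: "x \<in> SA \<Longrightarrow> \<exists>K. \<forall>n. cmod (Tr (x n)) \<le> K"
    and SB_carrier: "b \<in> SB \<Longrightarrow> b n \<in> carrier_mat n n"
    and SB_mult: "b \<in> SB \<Longrightarrow> c \<in> SB \<Longrightarrow> (\<lambda>n. b n * c n) \<in> SB"
    and SB_adjoint: "b \<in> SB \<Longrightarrow> (\<lambda>n. mat_adjoint (b n)) \<in> SB"
    and SB_center: "b \<in> SB \<Longrightarrow> (\<lambda>n. square_matrices.center n (b n)) \<in> SB"
    and SB_bounded: "b \<in> SB \<Longrightarrow> \<exists>K. \<forall>n. cmod (tr (b n)) \<le> K"
begin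

abbreviation wm :: "nat \<Rightarrow> complex mat \<Rightarrow> (symbol \<times> symbol) list \<Rightarrow> complex mat" where
  "wm n W w \<equiv> square_matrices.wmat n W (inst n w)"

abbreviation wv :: "nat \<Rightarrow> complex mat \<Rightarrow> (symbol \<times> symbol) list list \<Rightarrow> complex" where
  "wv n W ws \<equiv> square_matrices.wval n W (map (inst n) ws)"

definition SB0 :: "symbol set" where
  "SB0 = {b \<in> SB. \<forall>n\<ge>1. Tr (b n) = 0}"

definition centered_words :: "(symbol \<times> symbol) list set" where
  "centered_words = {w. set w \<subseteq> SA \<times> SB0}"

lemma centered_words_simps [simp]:
  "[] \<in> centered_words"
  "p # w \<in> centered_words \<longleftrightarrow> fst p \<in> SA \<and> snd p \<in> SB0 \<and> w \<in> centered_words"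
  "u @ v \<in> centered_words \<longleftrightarrow> u \<in> centered_words \<and> v \<in> centered_words"
  by (auto simp: centered_words_def mem_Times_iff)

lemma centered_words_take_drop [simp]:
  "w \<in> centered_words \<Longrightarrow> take i w \<in> centered_words"
  "w \<in> centered_words \<Longrightarrow> drop i w \<in> centered_words"
  by (auto simp: centered_words_def dest: in_set_takeD in_set_dropD)

lemma centered_words_nth:
  assumes "w \<in> centered_words" "i < length w"
  shows "fst (w ! i) \<in> SA" "snd (w ! i) \<in> SB0"
proof -
  have "w ! i \<in> SA \<times> SB0" using assms nth_mem[of i w] unfolding centered_words_def by blast
  then show "fst (w ! i) \<in> SA" "snd (w ! i) \<in> SB0" by (auto simp: mem_Times_iff)
qed

lemma SB0_SB: "b \<in> SB0 \<Longrightarrow> b \<in> SB"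
  by (simp add: SB0_def)

lemma SB0_Tr: "b \<in> SB0 \<Longrightarrow> n \<ge> 1 \<Longrightarrow> Tr (b n) = 0"
  by (simp add: SB0_def)

lemma center_SB0: "b \<in> SB \<Longrightarrow> (\<lambda>n. square_matrices.center n (b n)) \<in> SB0"
  using SB_carrier[of b] by (auto simp: SB0_def SB_center square_matrices.Tr_center)

lemma inst_words:
  assumes "w \<in> centered_words"
  shows "inst n w \<in> square_matrices.words n"
  using assms SA_carrier SB_carrier SB0_SB
  by (auto simp: inst_def square_matrices.words_def centered_words_def)

lemma inst_words_set: "set ws \<subseteq> centered_words \<Longrightarrow> set (map (inst n) ws) \<subseteq> square_matrices.words n"
  using inst_words by auto

definition mean :: "(symbol \<times> symbol) list list \<Rightarrow> nat \<Rightarrow> complex" where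
  "mean ws n = (\<integral>W. wv n W ws \<partial>\<mu> n)"

definition weight :: "(symbol \<times> symbol) list list \<Rightarrow> nat" where
  "weight ws = sum_list (map length ws)"

lemma weight_simps [simp]:
  "weight [] = 0" "weight (w # ws) = length w + weight ws" "weight (us @ ws) = weight us + weight ws"
  by (simp_all add: weight_def)

text \<open>The empty word is excluded because its trace is \<open>n\<close>. Every factor thus
  carries at least one centered letter, and a state of weight N has at most N factors.\<close>

definition states :: "(symbol \<times> symbol) list list set" where
  "states = {ws. set ws \<subseteq> centered_words - {[]}}"

lemma states_simps [simp]:
  "[] \<in> states" "w # ws \<in> states \<longleftrightarrow> w \<in> centered_words \<and> w \<noteq> [] \<and> ws \<in> states"
  "us @ ws \<in> states \<longleftrightarrow> us \<in> states \<and> ws \<in> states"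
  by (auto simp: states_def)

lemma states_take_drop [simp]:
  "ws \<in> states \<Longrightarrow> take i ws \<in> states" "ws \<in> states \<Longrightarrow> drop i ws \<in> states"
  by (auto simp: states_def dest: in_set_takeD in_set_dropD)

lemma states_inst: "ws \<in> states \<Longrightarrow> set (map (inst n) ws) \<subseteq> square_matrices.words n"
  by (rule inst_words_set) (auto simp: states_def)

section \<open>Bounds for the terms of the loop equation with a merged letter\<close>

context
  fixes N :: nat
  assumes IH: "\<And>ws. ws \<in> states \<Longrightarrow> weight ws < N \<Longrightarrow> decays (weight ws) (mean ws)"
begin

text \<open>If \<open>w\<close> is empty, the trace of \<open>x\<close> is a bounded deterministic
  factor; otherwise \<open>x\<close> joins the first letter of \<open>w\<close> and the integrand
  belongs to a state. The induction hypothesis covers both cases.\<close>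

lemma decays_prefix1:
  assumes x: "x \<in> SA" and w: "w \<in> centered_words" and ws: "ws \<in> states" and N: "length w + weight ws < N"
  shows "decays (length w + weight ws) (\<lambda>n. \<integral>W. Tr (x n * wm n W w) *
    wv n W ws \<partial>\<mu> n)"
proof (cases w)
  case Nil
  obtain B where B: "\<And>n. cmod (Tr (x n)) \<le> B" using SA_bounded[OF x] by blast
  have "decays (length w + weight ws) (\<lambda>n. Tr (x n) * mean ws n)"
    using decays_bounded_mult[OF IH[OF ws] B] N by (simp add: Nil)
  then show ?thesis
    by (rule decays_cong) (simp add: Nil mean_def square_matrices.wmat_Nil right_mult_one_mat[OF SA_carrier[OF x]])
next
  case (Cons p w')
  obtain z d where p: "p = (z, d)" by (cases p)
  have c: "z \<in> SA" "d \<in> SB0" "w' \<in> centered_words" using w Cons p by auto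
  have "decays (length w + weight ws) (mean ((((\<lambda>n. x n * z n), d) # w') # ws))"
    using IH[of "(((\<lambda>n. x n * z n), d) # w') # ws"] N c ws SA_mult[OF x c(1)] by (simp add: Cons)
  then show ?thesis
  proof (rule decays_cong)
    fix n :: nat assume "n \<ge> 1"
    interpret H: haar n "\<mu> n" by (rule haar_seq) fact
    show "mean ((((\<lambda>n. x n * z n), d) # w') # ws) n =
      (\<integral>W. Tr (x n * wm n W w) * wv n W ws \<partial>\<mu> n)"
      unfolding mean_def
    proof (rule Bochner_Integration.integral_cong[OF refl])
      fix W assume "W \<in> space (\<mu> n)"
      then have "W \<in> unitary_group n" by (simp add: H.space_haar)
      then show "wv n W ((((\<lambda>n. x n * z n), d) # w') # ws) =
          Tr (x n * wm n W w) * wv n W ws"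
        using H.Tr_absorb[of W "x n" "z n" "d n" "inst n w'"] SA_carrier[OF x] SA_carrier[OF c(1)]
          SB_carrier[OF SB0_SB[OF c(2)]] inst_words[OF c(3)]
        by (simp add: Cons p)
    qed
  qed
qed

text \<open>Two stray factors occur when a trace has split and the scalar part of the merged letter
  is taken. The second one is absorbed in the same way as the first.\<close>

lemma decays_prefix2:
  assumes x: "x \<in> SA" and y: "y \<in> SA" and w: "w \<in> centered_words" and u: "u \<in> centered_words"
    and ws: "ws \<in> states" and N: "length w + length u + weight ws < N"
  shows "decays (length w + length u + weight ws) (\<lambda>n. \<integral>W. Tr (x n * wm n W w) *
    (Tr (y n * wm n W u) * wv n W ws) \<partial>\<mu> n)"
proof (cases u)
  case Nil
  obtain B where B: "\<And>n. cmod (Tr (y n)) \<le> B" using SA_bounded[OF y] by blast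
  have "decays (length w + length u + weight ws) (\<lambda>n. Tr (y n) * (\<integral>W. Tr (x n * wm n W w) *
    wv n W ws \<partial>\<mu> n))"
    using decays_bounded_mult[OF decays_prefix1[OF x w ws] B] N by (simp add: Nil)
  then show ?thesis
    by (rule decays_cong)
      (simp add: Nil square_matrices.wmat_Nil right_mult_one_mat[OF SA_carrier[OF y]] mult_ac
        flip: Bochner_Integration.integral_mult_right_zero)
next
  case (Cons p u')
  obtain z d where p: "p = (z, d)" by (cases p)
  have c: "z \<in> SA" "d \<in> SB0" "u' \<in> centered_words" using u Cons p by auto
  have "decays (length w + length u + weight ws) (\<lambda>n. \<integral>W. Tr (x n * wm n W w) *
    wv n W ((((\<lambda>n. y n * z n), d) # u') # ws) \<partial>\<mu> n)"
    using decays_prefix1[of x w "(((\<lambda>n. y n * z n), d) # u') # ws"] N c ws x w SA_mult[OF y c(1)]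
    by (simp add: Cons add.assoc)
  then show ?thesis
  proof (rule decays_cong)
    fix n :: nat assume "n \<ge> 1"
    interpret H: haar n "\<mu> n" by (rule haar_seq) fact
    show "(\<integral>W. Tr (x n * wm n W w) * wv n W ((((\<lambda>n. y n * z n), d) # u') # ws) \<partial>\<mu> n) =
      (\<integral>W. Tr (x n * wm n W w) * (Tr (y n * wm n W u) * wv n W ws) \<partial>\<mu> n)"
    proof (rule Bochner_Integration.integral_cong[OF refl])
      fix W assume "W \<in> space (\<mu> n)"
      then have "W \<in> unitary_group n" by (simp add: H.space_haar)
      then show "Tr (x n * wm n W w) * wv n W ((((\<lambda>n. y n * z n), d) # u') # ws) =
          Tr (x n * wm n W w) * (Tr (y n * wm n W u) * wv n W ws)"
        using H.Tr_absorb[of W "y n" "z n" "d n" "inst n u'"] SA_carrier[OF y] SA_carrier[OF c(1)]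
          SB_carrier[OF SB0_SB[OF c(2)]] inst_words[OF c(3)]
        by (simp add: Cons p)
    qed
  qed
qed

text \<open>\<open>Tr_wmat_infix\<close> moves the stranded \<open>y\<close> away and reduces the
  claim to \<open>decays_prefix1\<close>; for empty \<open>w\<close> the outer factor becomes the
  product of \<open>y\<close> and \<open>x\<close>.\<close>

lemma decays_infix:
  assumes x: "x \<in> SA" and y: "y \<in> SA" and p: "p \<in> centered_words" and w: "w \<in> centered_words"
    and ws: "ws \<in> states" and N: "length p + length w + weight ws < N"
  shows "decays (length p + length w + weight ws) (\<lambda>n. \<integral>W. Tr (x n * (wm n W p *
    (y n * wm n W w))) * wv n W ws \<partial>\<mu> n)"
proof (cases w)
  case Nil
  have "decays (length p + length w + weight ws) (\<lambda>n. \<integral>W. Tr ((y n * x n) * wm n W p) *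
     wv n W ws \<partial>\<mu> n)"
    using decays_prefix1[of "\<lambda>n. y n * x n" p ws] SA_mult[OF y x] N p ws by (simp add: Nil)
  then show ?thesis
  proof (rule decays_cong)
    fix n :: nat assume "n \<ge> 1"
    interpret H: haar n "\<mu> n" by (rule haar_seq) fact
    show "(\<integral>W. Tr ((y n * x n) * wm n W p) * wv n W ws \<partial>\<mu> n) =
      (\<integral>W. Tr (x n * (wm n W p * (y n * wm n W w))) * wv n W ws \<partial>\<mu> n)"
      using H.Tr_wmat_infix(1)[of _ "x n" "y n" "inst n p" "inst n w"]
        SA_carrier[OF x] SA_carrier[OF y] inst_words[OF p] inst_words[OF w]
      by (intro Bochner_Integration.integral_cong[OF refl]) (simp add: H.space_haar Nil)
  qed
next
  case (Cons q w')
  obtain z d where q: "q = (z, d)" by (cases q)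
  have c: "z \<in> SA" "d \<in> SB0" "w' \<in> centered_words" using w Cons q by auto
  have "decays (length p + length w + weight ws) (\<lambda>n. \<integral>W. Tr (x n * wm n W (p @ ((\<lambda>n. y n * z n), d) # w')) * wv n W ws \<partial>\<mu> n)"
    using decays_prefix1[of x "p @ ((\<lambda>n. y n * z n), d) # w'" ws] SA_mult[OF y c(1)] N p c x ws
    by (simp add: Cons)
  then show ?thesis
  proof (rule decays_cong)
    fix n :: nat assume "n \<ge> 1"
    interpret H: haar n "\<mu> n" by (rule haar_seq) fact
    show "(\<integral>W. Tr (x n * wm n W (p @ ((\<lambda>n. y n * z n), d) # w')) * wv n W ws \<partial>\<mu> n) =
      (\<integral>W. Tr (x n * (wm n W p * (y n * wm n W w))) * wv n W ws \<partial>\<mu> n)"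
    proof (rule Bochner_Integration.integral_cong[OF refl])
      fix W assume "W \<in> space (\<mu> n)"
      then have W: "W \<in> carrier_mat n n" by (simp add: H.space_haar)
      have "Tr (x n * (wm n W p * (y n * wm n W w))) =
          Tr (x n * H.wmat W (inst n p @ (y n * z n, d n) # inst n w'))"
        using W SA_carrier[OF x] SA_carrier[OF y] inst_words[OF p] inst_words[OF w]
        by (rule H.Tr_wmat_infix(2)) (simp add: Cons q)
      then show "Tr (x n * wm n W (p @ ((\<lambda>n. y n * z n), d) # w')) * wv n W ws =
          Tr (x n * (wm n W p * (y n * wm n W w))) * wv n W ws"
        by simp
    qed
  qed
qed

text \<open>The merged letter \<open>c\<close> has to be centered again. Its centered part keeps the
  letter and decays with an extra n^(-1/2); its scalar part, a bounded number, deletes the letter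
  and determines the rate. The extra letter of the centered part accounts for the + 1 in the
  assumption on \<open>N\<close>.\<close>

lemma decays_merge_other:
  assumes x: "x \<in> SA" and y: "y \<in> SA" and c: "c \<in> SB" and p: "p \<in> centered_words" and w: "w \<in> centered_words"
    and ws: "ws \<in> states" and N: "length p + length w + weight ws + 1 < N"
  shows "decays (length p + length w + weight ws) (\<lambda>n. \<integral>W. Tr (x n * wm n W (p @ (y, c) # w)) * wv n W ws \<partial>\<mu> n)"
proof -
  obtain B where B: "\<And>n. cmod (tr (c n)) \<le> B" using SB_bounded[OF c] by blast
  define c0 where "c0 = (\<lambda>n. square_matrices.center n (c n))"
  have c0: "c0 \<in> SB0" unfolding c0_def by (rule center_SB0[OF c])
  define I1 where "I1 n = (\<integral>W. Tr (x n * wm n W (p @ (y, c0) # w)) * wv n W ws \<partial>\<mu> n)" for n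
  define I2 where "I2 n = (\<integral>W. Tr (x n * (wm n W p *
    (y n * wm n W w))) * wv n W ws \<partial>\<mu> n)" for n
  have "decays (length (p @ (y, c0) # w) + weight ws) I1"
    unfolding I1_def by (rule decays_prefix1) (use x y p w c0 ws N in auto)
  then have 1: "decays (length p + length w + weight ws) I1"
    by (rule decays_mono) simp
  have 2: "decays (length p + length w + weight ws) I2"
    unfolding I2_def using decays_infix[OF x y p w ws] N by auto
  have "decays (length p + length w + weight ws) (\<lambda>n. I1 n + tr (c n) * I2 n)"
    by (intro decays_add 1 decays_bounded_mult[OF 2 B])
  then show ?thesis
  proof (rule decays_cong)
    fix n :: nat assume n: "n \<ge> 1"
    interpret H: haar n "\<mu> n" by (rule haar_seq) fact
    note cs = SA_carrier[OF x, of n] SA_carrier[OF y, of n] SB_carrier[OF c, of n] inst_words[OF p, of n] inst_words[OF w, of n]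
    have eq: "Tr (x n * wm n W (p @ (y, c) # w)) * wv n W ws =
        Tr (x n * wm n W (p @ (y, c0) # w)) * wv n W ws +
        tr (c n) * (Tr (x n * (wm n W p * (y n * wm n W w))) * wv n W ws)"
      if W: "W \<in> unitary_group n" for W
      using H.Tr_wmat_center[OF W cs(2,3,4,5,1)] by (simp add: c0_def algebra_simps)
    have g1: "integrable (\<mu> n) (\<lambda>W. Tr (x n * wm n W (p @ (y, c0) # w)) * wv n W ws)"
      using cs ws c0 SB_carrier[OF SB0_SB[OF c0]]
      by (intro H.good_integrable H.good_mult H.good_Tr_wmat H.good_wval states_inst) auto
    have g2: "integrable (\<mu> n) (\<lambda>W. Tr (x n * (wm n W p * (y n * wm n W w))) * wv n W ws)"
      by (intro H.good_integrable H.good_mult H.good_wval states_inst ws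
          H.good_Tr[OF H.matrix_derivative_const_mult[OF cs(1) H.matrix_derivative_mult[OF
            H.matrix_derivative_wmat H.matrix_derivative_const_mult[OF cs(2) H.matrix_derivative_wmat]]]] cs)
    show "I1 n + tr (c n) * I2 n = (\<integral>W. Tr (x n * wm n W (p @ (y, c) # w)) * wv n W ws \<partial>\<mu> n)"
      unfolding I1_def I2_def using g1 g2
      by (subst Bochner_Integration.integral_cong[OF refl eq]) (simp_all add: H.space_haar)
  qed
qed

text \<open>As for \<open>decays_merge_other\<close>, but the derivative has hit the word that
  contains \<open>b\<close>: the trace has split, and the merged letter heads a word of its
  own.\<close>

lemma decays_merge_same:
  assumes x: "x \<in> SA" and y: "y \<in> SA" and c: "c \<in> SB" and v: "v \<in> centered_words" and u: "u \<in> centered_words"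
    and ws: "ws \<in> states" and N: "length v + length u + weight ws + 1 < N"
  shows "decays (length v + length u + weight ws) (\<lambda>n. \<integral>W. Tr (x n * wm n W v) *
    wv n W (((y, c) # u) # ws) \<partial>\<mu> n)"
proof -
  obtain B where B: "\<And>n. cmod (tr (c n)) \<le> B" using SB_bounded[OF c] by blast
  define c0 where "c0 = (\<lambda>n. square_matrices.center n (c n))"
  have c0: "c0 \<in> SB0" unfolding c0_def by (rule center_SB0[OF c])
  define I1 where "I1 n = (\<integral>W. Tr (x n * wm n W v) *
    wv n W (((y, c0) # u) # ws) \<partial>\<mu> n)" for n
  define I2 where "I2 n = (\<integral>W. Tr (x n * wm n W v) *
    (Tr (y n * wm n W u) * wv n W ws) \<partial>\<mu> n)" for n
  have "decays (length v + weight (((y, c0) # u) # ws)) I1"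
    unfolding I1_def by (rule decays_prefix1) (use x y u v c0 ws N in auto)
  then have 1: "decays (length v + length u + weight ws) I1"
    by (rule decays_mono) simp
  have 2: "decays (length v + length u + weight ws) I2"
    unfolding I2_def using decays_prefix2[OF x y v u ws] N by auto
  have "decays (length v + length u + weight ws) (\<lambda>n. I1 n + tr (c n) * I2 n)"
    by (intro decays_add 1 decays_bounded_mult[OF 2 B])
  then show ?thesis
  proof (rule decays_cong)
    fix n :: nat assume n: "n \<ge> 1"
    interpret H: haar n "\<mu> n" by (rule haar_seq) fact
    note cs = SA_carrier[OF x, of n] SA_carrier[OF y, of n] SB_carrier[OF c, of n] inst_words[OF v, of n] inst_words[OF u, of n]
    have eq: "Tr (x n * wm n W v) * wv n W (((y, c) # u) # ws) =
        Tr (x n * wm n W v) * wv n W (((y, c0) # u) # ws) +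
        tr (c n) * (Tr (x n * wm n W v) * (Tr (y n * wm n W u) * wv n W ws))"
      if W: "W \<in> unitary_group n" for W
      using H.wtr_center[OF W cs(2,3,5)] by (simp add: c0_def algebra_simps)
    have g1: "integrable (\<mu> n) (\<lambda>W. Tr (x n * wm n W v) * wv n W (((y, c0) # u) # ws))"
      using cs ws c0 y u
      by (intro H.good_integrable H.good_mult H.good_Tr_wmat H.good_wval states_inst) auto
    have g2: "integrable (\<mu> n) (\<lambda>W. Tr (x n * wm n W v) * (Tr (y n * wm n W u) * wv n W ws))"
      using cs ws
      by (intro H.good_integrable H.good_mult H.good_Tr_wmat H.good_wval states_inst)
    show "I1 n + tr (c n) * I2 n = (\<integral>W. Tr (x n * wm n W v) *
    wv n W (((y, c) # u) # ws) \<partial>\<mu> n)"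
      unfolding I1_def I2_def using g1 g2
      by (subst Bochner_Integration.integral_cong[OF refl eq]) (simp_all add: H.space_haar)
  qed
qed

end

end

context haar_letters
begin

lemma weight_split:
  assumes "t < length ws"
  shows "weight ws = length (ws ! t) + weight (take t ws @ drop (Suc t) ws)"
proof -
  have "weight ws = weight (take t ws @ ws ! t # drop (Suc t) ws)"
    using id_take_nth_drop[OF assms] by simp
  then show ?thesis by simp
qed

lemma weight_eq_sum: "weight ws = (\<Sum>t<length ws. length (ws ! t))"
  by (simp add: weight_def sum_list_sum_nth atLeast0LessThan)

lemma states_nth:
  assumes "ws \<in> states" "t < length ws"
  shows "ws ! t \<in> centered_words"
  using assms(1) nth_mem[OF assms(2)] unfolding states_def by blast

text \<open>The loop equation with its terms sorted. \<open>R\<close> collects the merged terms; the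
  two letters that merge may both be lost, hence the rate N - 2. The displayed means belong to
  states of the full weight N again.\<close>

lemma loop_states:
  assumes st: "((x, b) # w) # ws \<in> states"
    and IH: "\<And>vs. vs \<in> states \<Longrightarrow> weight vs < weight (((x, b) # w) # ws) \<Longrightarrow> decays (weight vs) (mean vs)"
  shows "\<exists>R. decays (weight (((x, b) # w) # ws) - 2) R \<and> (\<forall>n\<ge>1.
    of_nat n * mean (((x, b) # w) # ws) n = R n
     - (\<Sum>i<length w. mean (((fst (w ! i), b) # take i w) # ((x, snd (w ! i)) # drop (Suc i) w) # ws) n)
     - (\<Sum>t<length ws. \<Sum>i<length (ws ! t). mean (((x, snd (ws ! t ! i)) # drop (Suc i) (ws ! t) @
          take i (ws ! t) @ (fst (ws ! t ! i), b) # w) # (take t ws @ drop (Suc t) ws)) n))"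
proof -
  define N where "N = weight (((x, b) # w) # ws)"
  note IH' = IH[folded N_def]
  have x: "x \<in> SA" and b: "b \<in> SB0" and w: "w \<in> centered_words" and ws: "ws \<in> states" using st by auto
  have ws_nth: "ws ! t \<in> centered_words" if "t < length ws" for t
    by (rule states_nth[OF ws that])
  define cb where "cb c = (\<lambda>n. c n * b n)" for c :: symbol
  define R1 where "R1 i n = (\<integral>W. Tr (x n * wm n W (drop (Suc i) w)) *
    wv n W (((fst (w ! i), cb (snd (w ! i))) # take i w) # ws) \<partial>\<mu> n)" for i n
  define R2 where "R2 t i n = (\<integral>W. Tr (x n * square_matrices.wmat n W (inst n
      ((drop (Suc i) (ws ! t) @ take i (ws ! t)) @ (fst (ws ! t ! i), cb (snd (ws ! t ! i))) # w))) *
    wv n W (take t ws @ drop (Suc t) ws) \<partial>\<mu> n)" for t i n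
  have R1: "decays (N - 2) (R1 i)" if i: "i < length w" for i
  proof -
    have "decays (length (drop (Suc i) w) + length (take i w) + weight ws) (R1 i)"
      unfolding R1_def
    proof (rule decays_merge_same[OF IH'])
      show "cb (snd (w ! i)) \<in> SB"
        unfolding cb_def using centered_words_nth[OF w i] b by (intro SB_mult SB0_SB)
    qed (use x w ws i centered_words_nth[OF w i] in \<open>auto simp: N_def\<close>)
    then show ?thesis using i by (simp add: N_def)
  qed
  have R2: "decays (N - 2) (R2 t i)" if t: "t < length ws" and i: "i < length (ws ! t)" for t i
  proof -
    have "decays (length (drop (Suc i) (ws ! t) @ take i (ws ! t)) + length w +
        weight (take t ws @ drop (Suc t) ws)) (R2 t i)"
      unfolding R2_def
    proof (rule decays_merge_other[OF IH'])
      show "cb (snd (ws ! t ! i)) \<in> SB"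
        unfolding cb_def using centered_words_nth[OF ws_nth[OF t] i] b by (intro SB_mult SB0_SB)
    qed (use x w ws i ws_nth[OF t] centered_words_nth[OF ws_nth[OF t] i] weight_split[OF t]
        in \<open>auto simp: N_def simp del: weight_simps(3)\<close>)
    moreover have "length (drop (Suc i) (ws ! t) @ take i (ws ! t)) + length w +
        weight (take t ws @ drop (Suc t) ws) = N - 2"
      using i weight_split[OF t] by (simp add: N_def del: weight_simps(3))
    ultimately show ?thesis by simp
  qed
  define R where "R n = (\<Sum>i<length w. R1 i n) + (\<Sum>t<length ws. \<Sum>i<length (ws ! t). R2 t i n)" for n
  have "decays (N - 2) R"
    unfolding R_def using R1 R2 by (intro decays_add decays_sum) auto
  moreover have "of_nat n * mean (((x, b) # w) # ws) n = R n
     - (\<Sum>i<length w. mean (((fst (w ! i), b) # take i w) # ((x, snd (w ! i)) # drop (Suc i) w) # ws) n)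
     - (\<Sum>t<length ws. \<Sum>i<length (ws ! t). mean (((x, snd (ws ! t ! i)) # drop (Suc i) (ws ! t) @
          take i (ws ! t) @ (fst (ws ! t ! i), b) # w) # (take t ws @ drop (Suc t) ws)) n)" if n: "n \<ge> 1" for n
  proof -
    interpret H: haar n "\<mu> n" by (rule haar_seq) fact
    have L: "of_nat n * (\<integral>W. H.wval W (((x n, b n) # inst n w) # map (inst n) ws) \<partial>\<mu> n) =
      (\<Sum>i<length (inst n w). let y = fst (inst n w ! i); c = snd (inst n w ! i);
           u = take i (inst n w); v = drop (Suc i) (inst n w) in
        (\<integral>W. Tr (x n * H.wmat W v) * H.wval W (((y, c * b n) # u) # map (inst n) ws) \<partial>\<mu> n)
      - (\<integral>W. H.wval W (((y, b n) # u) # ((x n, c) # v) # map (inst n) ws) \<partial>\<mu> n)) +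
      (\<Sum>t<length (map (inst n) ws). \<Sum>i<length (map (inst n) ws ! t).
       let p = map (inst n) ws ! t; y = fst (p ! i); c = snd (p ! i); u = take i p; v = drop (Suc i) p;
         ws' = take t (map (inst n) ws) @ drop (Suc t) (map (inst n) ws) in
        (\<integral>W. Tr (x n * H.wmat W (v @ u @ (y, c * b n) # inst n w)) * H.wval W ws' \<partial>\<mu> n)
      - (\<integral>W. H.wval W (((x n, c) # v @ u @ (y, b n) # inst n w) # ws') \<partial>\<mu> n))"
      by (rule H.loop_equation)
        (use SA_carrier[OF x] SB_carrier[OF SB0_SB[OF b]] SB0_Tr[OF b n] inst_words[OF w] states_inst[OF ws] in auto)
    have S1: "(\<Sum>i<length (inst n w). let y = fst (inst n w ! i); c = snd (inst n w ! i);
           u = take i (inst n w); v = drop (Suc i) (inst n w) in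
        (\<integral>W. Tr (x n * H.wmat W v) * H.wval W (((y, c * b n) # u) # map (inst n) ws) \<partial>\<mu> n)
      - (\<integral>W. H.wval W (((y, b n) # u) # ((x n, c) # v) # map (inst n) ws) \<partial>\<mu> n)) =
      (\<Sum>i<length w. R1 i n - mean (((fst (w ! i), b) # take i w) # ((x, snd (w ! i)) # drop (Suc i) w) # ws) n)"
      by (rule sum.cong) (simp_all add: Let_def inst_nth inst_take inst_drop R1_def mean_def cb_def del: H.wval_simps)
    have S2: "(\<Sum>t<length (map (inst n) ws). \<Sum>i<length (map (inst n) ws ! t).
       let p = map (inst n) ws ! t; y = fst (p ! i); c = snd (p ! i); u = take i p; v = drop (Suc i) p;
         ws' = take t (map (inst n) ws) @ drop (Suc t) (map (inst n) ws) in
        (\<integral>W. Tr (x n * H.wmat W (v @ u @ (y, c * b n) # inst n w)) * H.wval W ws' \<partial>\<mu> n)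
      - (\<integral>W. H.wval W (((x n, c) # v @ u @ (y, b n) # inst n w) # ws') \<partial>\<mu> n)) =
      (\<Sum>t<length ws. \<Sum>i<length (ws ! t). R2 t i n - mean (((x, snd (ws ! t ! i)) # drop (Suc i) (ws ! t) @
          take i (ws ! t) @ (fst (ws ! t ! i), b) # w) # (take t ws @ drop (Suc t) ws)) n)"
      by (intro sum.cong) (simp_all add: Let_def inst_nth inst_take inst_drop R2_def mean_def cb_def
          take_map drop_map del: H.wval_simps)
    have "of_nat n * mean (((x, b) # w) # ws) n =
        of_nat n * (\<integral>W. H.wval W (((x n, b n) # inst n w) # map (inst n) ws) \<partial>\<mu> n)"
      by (simp add: mean_def del: H.wval_simps)
    then show ?thesis
      unfolding L S1 S2 by (simp add: R_def sum_subtractf)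
  qed
  ultimately show ?thesis unfolding N_def by blast
qed

text \<open>
  The terms of the loop equation that preserve the weight \<open>N\<close> are \<open>N - 1\<close> members of the finite
  family of states over the same letters; after division by \<open>n\<close> they are absorbed into the
  maximum over this family. All other terms lose at most two letters.
\<close>

theorem mean_decays: "ws \<in> states \<Longrightarrow> decays (weight ws) (mean ws)"
proof (induction "weight ws" arbitrary: ws rule: less_induct)
  case less
  define N where "N = weight ws"
  show ?case
  proof (cases "ws = []")
    case True
    have "mean [] n = 1" if "n \<ge> 1" for n
    proof -
      interpret H: haar n "\<mu> n" by (rule haar_seq) fact
      show ?thesis by (simp add: mean_def H.prob_space)
    qed
    then show ?thesis
      unfolding True decays_def
      by (intro exI[of _ 1] eventually_mono[OF eventually_ge_at_top[of 1]]) simp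
  next
    case False
    \<comment> \<open>The finite family: all states of the same weight whose letters occur in
      \<open>ws\<close>. The weight-preserving terms only redistribute letters, so they stay
      inside.\<close>
    define FA where "FA = fst ` set (concat ws)"
    define FB where "FB = snd ` set (concat ws)"
    define St where "St = {vs \<in> states. (\<forall>v\<in>set vs. set v \<subseteq> FA \<times> FB) \<and> weight vs = N}"
    have fin: "finite St"
    proof -
      have "length vs \<le> N \<and> set vs \<subseteq> {v. set v \<subseteq> FA \<times> FB \<and> length v \<le> N}" if vs: "vs \<in> St" for vs
      proof
        \<comment> \<open>No word of a state is empty, so there are at most as many words as
          letters.\<close>
        have "length vs = (\<Sum>v\<leftarrow>vs. 1)" by (simp add: sum_list_triv)
        also have "\<dots> \<le> (\<Sum>v\<leftarrow>vs. length v)"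
          using vs by (intro sum_list_mono) (auto simp: St_def states_def Suc_le_eq)
        also have "\<dots> = N" using vs by (simp add: St_def weight_def)
        finally show "length vs \<le> N" .
        have "length v \<le> N" if "v \<in> set vs" for v
          using vs member_le_sum_list[of "length v" "map length vs"] that by (auto simp: St_def weight_def)
        then show "set vs \<subseteq> {v. set v \<subseteq> FA \<times> FB \<and> length v \<le> N}"
          using vs by (auto simp: St_def)
      qed
      then have "St \<subseteq> {vs. set vs \<subseteq> {v. set v \<subseteq> FA \<times> FB \<and> length v \<le> N} \<and> length vs \<le> N}" by blast
      moreover have "finite {v. set v \<subseteq> FA \<times> FB \<and> length v \<le> N}"
        by (rule finite_lists_length_le) (simp add: FA_def FB_def)
      then have "finite {vs. set vs \<subseteq> {v. set v \<subseteq> FA \<times> FB \<and> length v \<le> N} \<and> length vs \<le> N}"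
        by (rule finite_lists_length_le)
      ultimately show ?thesis by (rule finite_subset)
    qed
    have wsSt: "ws \<in> St"
      using less.prems by (force simp: St_def N_def FA_def FB_def)
    define M where "M n = Max ((\<lambda>vs. cmod (mean vs n)) ` St)" for n
    have M: "cmod (mean vs n) \<le> M n" if "vs \<in> St" for vs n
      unfolding M_def using fin that by (intro Max_ge) auto
    have step: "\<exists>R. decays (N - 2) R \<and> (\<forall>n\<ge>1. real n * cmod (mean vs n) \<le> cmod (R n) + real (N - 1) * M n)"
      if vs: "vs \<in> St" for vs
    proof -
      have "vs \<noteq> []"
      proof
        assume "vs = []"
        then have "weight ws = 0" using vs by (simp add: St_def N_def)
        moreover from False obtain v vs' where "ws = v # vs'" by (cases ws) auto
        ultimately show False using less.prems by simp
      qed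
      then obtain v vs0 where v: "vs = v # vs0" by (cases vs) auto
      then obtain p w where "v = p # w" using vs by (cases v) (auto simp: St_def)
      then obtain x b where vs_eq: "vs = ((x, b) # w) # vs0" using v by (cases p) auto
      have st: "((x, b) # w) # vs0 \<in> states" and wN: "weight (((x, b) # w) # vs0) = N"
        and sub: "x \<in> FA" "b \<in> FB" "set w \<subseteq> FA \<times> FB" "\<forall>v\<in>set vs0. set v \<subseteq> FA \<times> FB"
        using vs by (auto simp: St_def vs_eq)
      have c: "x \<in> SA" "b \<in> SB0" "w \<in> centered_words" "vs0 \<in> states" using st by auto
      have c_nth: "vs0 ! t \<in> centered_words" "set (vs0 ! t) \<subseteq> FA \<times> FB" if "t < length vs0" for t
        using states_nth[OF c(4) that] nth_mem[OF that] sub(4) by blast+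
      have pair: "fst (v ! i) \<in> FA" "snd (v ! i) \<in> FB" if "set v \<subseteq> FA \<times> FB" "i < length v" for v i
      proof -
        have "v ! i \<in> FA \<times> FB" using that nth_mem[of i v] by blast
        then show "fst (v ! i) \<in> FA" "snd (v ! i) \<in> FB" by (auto simp: mem_Times_iff)
      qed
      have s1: "((fst (w ! i), b) # take i w) # ((x, snd (w ! i)) # drop (Suc i) w) # vs0 \<in> St"
        if "i < length w" for i
        using c centered_words_nth[OF c(3) that] pair[OF sub(3) that] wN that sub
          set_take_subset[of i w] set_drop_subset[of "Suc i" w]
        by (auto simp: St_def)
      have s2: "((x, snd (vs0 ! t ! i)) # drop (Suc i) (vs0 ! t) @ take i (vs0 ! t) @ (fst (vs0 ! t ! i), b) # w)
          # (take t vs0 @ drop (Suc t) vs0) \<in> St"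
        if t: "t < length vs0" and i: "i < length (vs0 ! t)" for t i
      proof -
        have "weight (((x, snd (vs0 ! t ! i)) # drop (Suc i) (vs0 ! t) @ take i (vs0 ! t) @ (fst (vs0 ! t ! i), b) # w)
          # (take t vs0 @ drop (Suc t) vs0)) = N"
          using wN weight_split[OF t] i by (simp del: weight_simps(3))
        moreover have "set (take t vs0 @ drop (Suc t) vs0) \<subseteq> set vs0"
          using set_take_subset[of t vs0] set_drop_subset[of "Suc t" vs0] by auto
        ultimately show ?thesis
          using c centered_words_nth[OF c_nth(1)[OF t] i] pair[OF c_nth(2)[OF t] i] sub c_nth[OF t]
            set_take_subset[of i "vs0 ! t"] set_drop_subset[of "Suc i" "vs0 ! t"]
          by (auto simp: St_def simp del: weight_simps)
      qed
      obtain R where R: "decays (N - 2) R" and eq: "\<And>n. n \<ge> 1 \<Longrightarrow> of_nat n * mean vs n = R n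
         - (\<Sum>i<length w. mean (((fst (w ! i), b) # take i w) # ((x, snd (w ! i)) # drop (Suc i) w) # vs0) n)
         - (\<Sum>t<length vs0. \<Sum>i<length (vs0 ! t). mean (((x, snd (vs0 ! t ! i)) # drop (Suc i) (vs0 ! t) @
              take i (vs0 ! t) @ (fst (vs0 ! t ! i), b) # w) # (take t vs0 @ drop (Suc t) vs0)) n)"
      proof -
        have "decays (weight us) (mean us)"
          if "us \<in> states" "weight us < weight (((x, b) # w) # vs0)" for us
          using less.hyps[of us] that unfolding wN N_def by blast
        from loop_states[OF st this, unfolded wN, folded vs_eq] that show thesis by blast
      qed
      have "real n * cmod (mean vs n) \<le> cmod (R n) + real (N - 1) * M n" if n: "n \<ge> 1" for n
      proof -
        have "real n * cmod (mean vs n) = cmod (of_nat n * mean vs n)" by (simp add: norm_mult)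
        also have "\<dots> \<le> cmod (R n) + (\<Sum>i<length w. M n) + (\<Sum>t<length vs0. \<Sum>i<length (vs0 ! t). M n)"
          unfolding eq[OF n]
          by (intro order_trans[OF norm_triangle_ineq4] add_mono order_refl sum_norm_le M s1 s2) auto
        also have "\<dots> = cmod (R n) + real (length w + weight vs0) * M n"
          by (simp add: weight_eq_sum sum_distrib_right distrib_right)
        \<comment> \<open>There is one weight-preserving term for each letter other than
          \<open>b\<close>.\<close>
        also have "length w + weight vs0 = N - 1" using wN by simp
        finally show ?thesis .
      qed
      then show ?thesis using R by blast
    qed
    then obtain R where R: "\<And>vs. vs \<in> St \<Longrightarrow> decays (N - 2) (R vs)"
      and R_le: "\<And>vs n. vs \<in> St \<Longrightarrow> n \<ge> 1 \<Longrightarrow>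
        real n * cmod (mean vs n) \<le> cmod (R vs n) + real (N - 1) * M n" by metis
    define S where "S n = (\<Sum>vs\<in>St. cmod (R vs n))" for n
    have nM: "real n * M n \<le> S n + real (N - 1) * M n" if n: "n \<ge> 1" for n
    proof -
      have "M n \<in> (\<lambda>vs. cmod (mean vs n)) ` St"
        unfolding M_def using fin wsSt by (intro Max_in) auto
      then obtain vs where vs: "vs \<in> St" "M n = cmod (mean vs n)" by auto
      have "cmod (R vs n) \<le> S n" unfolding S_def using fin vs(1) by (intro member_le_sum) auto
      then show ?thesis using R_le[OF vs(1) n] vs(2) by simp
    qed
    have "decays (N - 2) (\<lambda>n. \<Sum>vs\<in>St. complex_of_real (cmod (R vs n)))"
      using R by (intro decays_sum decays_cmod)
    then have "decays (N - 2) (\<lambda>n. complex_of_real (S n))" by (simp add: S_def)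
    then obtain K where K: "\<forall>\<^sub>F n in sequentially. \<bar>S n\<bar> * sqrt (real n) ^ (N - 2) \<le> K"
      by (auto simp: decays_def)
    have "\<forall>\<^sub>F n in sequentially. cmod (mean ws n) * sqrt (real n) ^ N \<le> 2 * K"
      \<comment> \<open>From n = 2N on, N - 1 is at most n/2, so the maximum on the right is
        absorbed into the left side at the price of a factor 2.\<close>
      using K eventually_ge_at_top[of "max 1 (2 * N)"]
    proof eventually_elim
      case (elim n)
      have n: "n \<ge> 1" "2 * real N \<le> real n" using elim(2) by auto
      have M0: "M n \<ge> 0" using M[OF wsSt, of n] norm_ge_zero order_trans by blast
      have "real (N - 1) * M n \<le> real n / 2 * M n" using n M0 by (intro mult_right_mono) auto
      then have "real n * M n \<le> 2 * S n" using nM[OF n(1)] by simp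
      moreover have "cmod (mean ws n) \<le> M n" by (rule M[OF wsSt])
      ultimately have m: "real n * cmod (mean ws n) \<le> 2 * S n"
        by (meson mult_left_mono of_nat_0_le_iff order_trans)
      \<comment> \<open>Only an inequality, because the subtraction truncates: for N = 1 the right
        side is n and not its square root.\<close>
      have pw: "sqrt (real n) ^ N \<le> real n * sqrt (real n) ^ (N - 2)"
      proof -
        have "sqrt (real n) ^ N \<le> sqrt (real n) ^ (2 + (N - 2))"
          using n by (intro power_increasing) auto
        also have "\<dots> = real n * sqrt (real n) ^ (N - 2)" by (simp only: power_add) simp
        finally show ?thesis .
      qed
      have "cmod (mean ws n) * sqrt (real n) ^ N \<le> cmod (mean ws n) * (real n * sqrt (real n) ^ (N - 2))"
        using pw by (intro mult_left_mono) auto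
      also have "\<dots> = (real n * cmod (mean ws n)) * sqrt (real n) ^ (N - 2)" by simp
      also have "\<dots> \<le> (2 * S n) * sqrt (real n) ^ (N - 2)"
        using m by (intro mult_right_mono) auto
      also have "\<dots> \<le> 2 * (\<bar>S n\<bar> * sqrt (real n) ^ (N - 2))"
        by (simp add: mult_right_mono)
      also have "\<dots> \<le> 2 * K" using elim(1) by simp
      finally show ?case .
    qed
    then show ?thesis by (auto simp: decays_def N_def)
  qed
qed

end

section \<open>Almost sure factorization\<close>

text \<open>The means are summable, so by monotone convergence the series of the \<open>f n\<close>
  has finite mean and converges almost everywhere; its terms then tend to zero.\<close>

lemma (in prob_space) AE_tendsto_zero_of_moments:
  fixes f :: "nat \<Rightarrow> 'a \<Rightarrow> real"
  assumes int: "\<And>n. n \<ge> 1 \<Longrightarrow> integrable M (f n)" and nonneg: "\<And>n x. 0 \<le> f n x"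
    and bound: "\<forall>\<^sub>F n in sequentially. (\<integral>x. f n x \<partial>M) * (real n)\<^sup>2 \<le> K"
  shows "AE x in M. (\<lambda>n. f n x) \<longlonglongrightarrow> 0"
proof -
  obtain n0 where n0: "\<And>n. n \<ge> n0 \<Longrightarrow> (\<integral>x. f n x \<partial>M) * (real n)\<^sup>2 \<le> K"
    using bound by (auto simp: eventually_sequentially)
  \<comment> \<open>The sums start at 1 at the earliest: integrability is given from there on, and
    the denominators do not vanish.\<close>
  define m where "m = max 1 n0"
  have int': "integrable M (f (n + m))" for n by (rule int) (simp add: m_def)
  have le: "(\<integral>x. f (n + m) x \<partial>M) \<le> K * inverse ((real (n + m))\<^sup>2)" for n
    using n0[of "n + m"] by (simp add: m_def field_simps)
  have summ: "summable (\<lambda>n. K * inverse ((real (n + m))\<^sup>2))"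
    using summable_ignore_initial_segment[OF inverse_power_summable[of 2, where 'a = real], of m]
    by (intro summable_mult) simp_all
  have K: "0 \<le> K * inverse ((real (n + m))\<^sup>2)" for n
    by (rule order_trans[OF Bochner_Integration.integral_nonneg[OF nonneg] le])
  have "(\<integral>\<^sup>+x. (suminf (\<lambda>n. ennreal (f (n + m) x))) \<partial>M) = (suminf (\<lambda>n. \<integral>\<^sup>+x. ennreal (f (n + m) x) \<partial>M))"
    using int' by (intro nn_integral_suminf) auto
  also have "\<dots> = (suminf (\<lambda>n. ennreal (\<integral>x. f (n + m) x \<partial>M)))"
    using int' nonneg by (simp add: nn_integral_eq_integral)
  also have "\<dots> \<le> (suminf (\<lambda>n. ennreal (K * inverse ((real (n + m))\<^sup>2))))"
    using le by (intro suminf_le ennreal_leI) auto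
  also have "\<dots> = ennreal (suminf (\<lambda>n. K * inverse ((real (n + m))\<^sup>2)))"
    using K summ by (rule suminf_ennreal2)
  also have "\<dots> < \<infinity>" by simp
  finally have fin: "(\<integral>\<^sup>+x. (suminf (\<lambda>n. ennreal (f (n + m) x))) \<partial>M) \<noteq> \<infinity>" by simp
  have "AE x in M. (suminf (\<lambda>n. ennreal (f (n + m) x))) \<noteq> \<infinity>"
    using int' by (intro nn_integral_PInf_AE[OF _ fin]) auto
  then show ?thesis
  proof eventually_elim
    case (elim x)
    then have "summable (\<lambda>n. f (n + m) x)"
      using nonneg by (intro summable_suminf_not_top) auto
    then have "(\<lambda>n. f (n + m) x) \<longlonglongrightarrow> 0" by (rule summable_LIMSEQ_zero)
    then show ?case by (simp add: LIMSEQ_offset[of _ m])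
  qed
qed

lemma tendsto_zero_bounded_mult:
  fixes f c :: "nat \<Rightarrow> complex"
  assumes "f \<longlonglongrightarrow> 0" "\<And>n. cmod (c n) \<le> B"
  shows "(\<lambda>n. c n * f n) \<longlonglongrightarrow> 0"
  using assms by (intro lim_null_mult_left_bounded[of _ B] always_eventually) auto

text \<open>Only the law of each single \<open>U n\<close> is prescribed; the joint law of the
  sequence is arbitrary, as almost sure convergence is drawn from summable moments.\<close>

locale haar_unitary_sequence = haar_letters + prob_space M for M :: "'w measure" +
  fixes U :: "nat \<Rightarrow> 'w \<Rightarrow> complex mat"
  assumes U_measurable: "n \<ge> 1 \<Longrightarrow> U n \<in> measurable M (borel_unitary n)"
    and U_distr: "n \<ge> 1 \<Longrightarrow> distr M (borel_unitary n) (U n) = \<mu> n"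
begin

lemma U_unitary: "n \<ge> 1 \<Longrightarrow> z \<in> space M \<Longrightarrow> U n z \<in> unitary_group n"
  using measurable_space[OF U_measurable] by (auto simp: borel_unitary_def)

definition wtrace :: "(symbol \<times> symbol) list \<Rightarrow> nat \<Rightarrow> 'w \<Rightarrow> complex" where
  "wtrace w n z = square_matrices.wtr n (U n z) (inst n w)"

definition gwords :: "(symbol \<times> symbol) list set" where
  "gwords = {w. set w \<subseteq> SA \<times> SB}"

lemma gwords_simps [simp]:
  "[] \<in> gwords"
  "p # w \<in> gwords \<longleftrightarrow> fst p \<in> SA \<and> snd p \<in> SB \<and> w \<in> gwords"
  "u @ v \<in> gwords \<longleftrightarrow> u \<in> gwords \<and> v \<in> gwords"
  by (auto simp: gwords_def mem_Times_iff)

lemma centered_words_gwords: "w \<in> centered_words \<Longrightarrow> w \<in> gwords"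
  using SB0_SB by (auto simp: gwords_def centered_words_def)

lemma inst_gwords: "w \<in> gwords \<Longrightarrow> inst n w \<in> square_matrices.words n"
  using SA_carrier SB_carrier by (auto simp: inst_def square_matrices.words_def gwords_def)

lemma SB0_adjoint: "b \<in> SB0 \<Longrightarrow> (\<lambda>n. mat_adjoint (b n)) \<in> SB0"
  using Tr_adjoint[OF SB_carrier[OF SB0_SB]] by (auto simp: SB0_def intro: SB_adjoint)

text \<open>With x' for adjoints, the adjoint of x1 C_b1 ... xm C_bm is C_bm' xm' ... C_b1' x1',
  where the letters are paired the wrong way round. Under the trace x1' moves to the front, and
  (x1', bm'), (xm', b(m-1)'), ..., (x2', b1') is a word of the right form. In \<open>step\<close>,
  the factor \<open>y\<close> in front and the factor \<open>y'\<close> left over at the end carry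
  out this shift by one place.\<close>

lemma adjoint_word:
  assumes "w \<in> centered_words" "w \<noteq> []"
  shows "\<exists>w'\<in>centered_words. length w' = length w \<and> (\<forall>n. \<forall>W\<in>unitary_group n.
    square_matrices.wtr n W (inst n w') = cnj (square_matrices.wtr n W (inst n w)))"
proof -
  have step: "\<exists>w'\<in>centered_words. \<exists>y'\<in>SA. length w' = length w \<and> (\<forall>n. \<forall>W\<in>unitary_group n.
      y n * mat_adjoint (wm n W w) = wm n W w' * y' n)"
    if "w \<in> centered_words" "y \<in> SA" for w y
    using that
  proof (induction w)
    case Nil
    have "\<forall>n. \<forall>W\<in>unitary_group n.
      y n * mat_adjoint (wm n W []) = wm n W [] * y n"
      using SA_carrier[OF \<open>y \<in> SA\<close>]
      by (simp add: square_matrices.wmat_Nil left_mult_one_mat[OF SA_carrier[OF \<open>y \<in> SA\<close>]]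
          right_mult_one_mat[OF SA_carrier[OF \<open>y \<in> SA\<close>]])
    then show ?case using Nil by force
  next
    case (Cons p w)
    obtain x b where p: "p = (x, b)" by (cases p)
    have c: "x \<in> SA" "b \<in> SB0" "w \<in> centered_words" using Cons.prems p by auto
    obtain w' y' where w': "w' \<in> centered_words" "y' \<in> SA" "length w' = length w"
      and eq: "\<And>n W. W \<in> unitary_group n \<Longrightarrow>
        y n * mat_adjoint (wm n W w) = wm n W w' * y' n"
      using Cons.IH[OF c(3) Cons.prems(2)] by blast
    define bs where "bs = (\<lambda>n. mat_adjoint (b n))"
    define xs where "xs = (\<lambda>n. mat_adjoint (x n))"
    have "y n * mat_adjoint (wm n W (p # w)) =
        wm n W (w' @ [(y', bs)]) * xs n" if W: "W \<in> unitary_group n" for n W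
    proof -
      interpret S: square_matrices n .
      have cs: "W \<in> S.Mn" "x n \<in> S.Mn" "b n \<in> S.Mn" "y n \<in> S.Mn" "y' n \<in> S.Mn" "inst n w \<in> S.words" "inst n w' \<in> S.words"
        using W SA_carrier[OF c(1)] SA_carrier[OF w'(2)] SA_carrier[OF Cons.prems(2)]
          SB_carrier[OF SB0_SB[OF c(2)]] inst_words[OF c(3)] inst_words[OF w'(1)] by auto
      have "y n * mat_adjoint (wm n W (p # w)) =
          (y n * mat_adjoint (wm n W w)) * (mat_adjoint (S.conj_by W (b n)) * mat_adjoint (x n))"
        using cs by (simp add: p S.wmat_Cons adjoint_mult[of _ n n _ n] S.assoc)
      also have "\<dots> = wm n W w' * y' n * (S.conj_by W (mat_adjoint (b n)) * mat_adjoint (x n))"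
        unfolding eq[OF W] using cs by (simp add: S.conj_by_adjoint)
      also have "\<dots> = wm n W (w' @ [(y', bs)]) * xs n"
        using cs by (simp add: S.wmat_append S.wmat_Cons S.assoc bs_def xs_def)
      finally show ?thesis .
    qed
    moreover have "w' @ [(y', bs)] \<in> centered_words" "xs \<in> SA"
      using w' c SB0_adjoint SA_adjoint by (auto simp: bs_def xs_def)
    ultimately show ?case using w'(3) by (intro bexI[of _ "w' @ [(y', bs)]"] bexI[of _ xs]) auto
  qed
  obtain x b w0 where w: "w = (x, b) # w0" using assms(2) by (cases w) auto
  have c: "x \<in> SA" "b \<in> SB0" "w0 \<in> centered_words" using assms(1) w by auto
  define bs where "bs = (\<lambda>n. mat_adjoint (b n))"
  obtain w' y' where w': "w' \<in> centered_words" "y' \<in> SA" "length w' = length w0"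
    and eq: "\<And>n W. W \<in> unitary_group n \<Longrightarrow>
      mat_adjoint (x n) * mat_adjoint (wm n W w0) = wm n W w' * y' n"
    using step[OF c(3) SA_adjoint[OF c(1)]] by blast
  have "square_matrices.wtr n W (inst n (w' @ [(y', bs)])) = cnj (square_matrices.wtr n W (inst n w))"
    if W: "W \<in> unitary_group n" for n W
  proof -
    interpret S: square_matrices n .
    have cs: "W \<in> S.Mn" "x n \<in> S.Mn" "b n \<in> S.Mn" "y' n \<in> S.Mn" "inst n w0 \<in> S.words" "inst n w' \<in> S.words"
      using W SA_carrier[OF c(1)] SA_carrier[OF w'(2)]
        SB_carrier[OF SB0_SB[OF c(2)]] inst_words[OF c(3)] inst_words[OF w'(1)] by auto
    have "cnj (S.wtr W (inst n w)) = Tr (mat_adjoint (wm n W w))"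
      unfolding S.wtr_def using cs by (subst Tr_adjoint[of _ n]) (auto simp: w)
    also have "\<dots> = Tr (mat_adjoint (wm n W w0) * (S.conj_by W (bs n) * mat_adjoint (x n)))"
      using cs by (simp add: w S.wmat_Cons adjoint_mult[of _ n n _ n] S.assoc S.conj_by_adjoint bs_def)
    also have "\<dots> = Tr ((mat_adjoint (x n) * mat_adjoint (wm n W w0)) * S.conj_by W (bs n))"
      using cs S.Tr_swap[of "mat_adjoint (wm n W w0) * S.conj_by W (bs n)" "mat_adjoint (x n)"]
      by (simp add: S.assoc bs_def)
    also have "\<dots> = S.wtr W (inst n (w' @ [(y', bs)]))"
      unfolding eq[OF W] using cs by (simp add: S.wtr_def S.wmat_append S.wmat_Cons S.assoc bs_def)
    finally show ?thesis by simp
  qed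
  moreover have "w' @ [(y', bs)] \<in> centered_words"
    using w' c SB0_adjoint by (auto simp: bs_def)
  moreover have "length (w' @ [(y', bs)]) = length w" using w'(3) by (simp add: w)
  ultimately show ?thesis by blast
qed

text \<open>
  Fourth moments are needed: for a word of length one the second moment is only \<open>O(1/n)\<close>,
  which is not summable.
\<close>

lemma centered_tendsto_zero:
  assumes w: "w \<in> centered_words" "w \<noteq> []"
  shows "AE z in M. (\<lambda>n. wtrace w n z) \<longlonglongrightarrow> 0"
proof -
  obtain w' where w': "w' \<in> centered_words" "length w' = length w"
    and cnj: "\<And>n W. W \<in> unitary_group n \<Longrightarrow>
      square_matrices.wtr n W (inst n w') = cnj (square_matrices.wtr n W (inst n w))"
    using adjoint_word[OF w] by blast
  \<comment> \<open>On unitary matrices the value of this state is the fourth power of the modulus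
    of the trace of \<open>w\<close>; its weight is 4 times the length of \<open>w\<close>, hence at
    least 4.\<close>
  define ws where "ws = [w, w', w, w']"
  have ws: "ws \<in> states" using w w' by (auto simp: ws_def)
  define f where "f n z = (cmod (wtrace w n z)) ^ 4" for n z
  have rep: "integrable M (f n)" "(\<integral>z. f n z \<partial>M) = cmod (mean ws n)" if n: "n \<ge> 1" for n
  proof -
    interpret H: haar n "\<mu> n" by (rule haar_seq) fact
    define g where "g W = (cmod (H.wtr W (inst n w))) ^ 4" for W
    have val: "wv n W ws = complex_of_real (g W)" if "W \<in> unitary_group n" for W
    proof -
      have "wv n W ws = (H.wtr W (inst n w) * cnj (H.wtr W (inst n w)))\<^sup>2"
        by (simp add: ws_def cnj[OF that] power2_eq_square)
      then show ?thesis by (simp add: g_def complex_norm_square[symmetric] del: of_real_power flip: of_real_power)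
    qed
    have good: "H.good (\<lambda>W. complex_of_real (g W))"
      using H.good_wval[OF states_inst[OF ws]] val by (rule H.good_cong)
    have meas: "g \<in> borel_measurable (\<mu> n)"
    proof -
      have "(\<lambda>W. Re (complex_of_real (g W))) \<in> borel_measurable (\<mu> n)"
        using good by (intro measurable_compose[OF _ borel_measurable_Re]) (simp add: H.good_def)
      then show ?thesis by simp
    qed
    then have meas': "g \<in> borel_measurable (borel_unitary n)"
      using measurable_cong_sets[OF H.sets_haar refl] by auto
    have gi: "integrable (\<mu> n) g"
      using H.good_integrable[OF good] by (simp add: complex_of_real_integrable_eq)
    have fg: "f n = (\<lambda>z. g (U n z))" by (simp add: f_def g_def wtrace_def fun_eq_iff)
    show "integrable M (f n)"
      unfolding fg using gi by (intro integrable_distr[OF U_measurable[OF n]]) (simp add: U_distr[OF n])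
    have "(\<integral>z. f n z \<partial>M) = (\<integral>W. g W \<partial>\<mu> n)"
      unfolding fg using integral_distr[OF U_measurable[OF n] meas'] by (simp add: U_distr[OF n])
    moreover have "mean ws n = complex_of_real (\<integral>W. g W \<partial>\<mu> n)"
      unfolding mean_def
      by (subst Bochner_Integration.integral_cong[OF refl val]) (simp_all add: H.space_haar integral_complex_of_real)
    moreover have "0 \<le> (\<integral>W. g W \<partial>\<mu> n)" by (rule Bochner_Integration.integral_nonneg) (simp add: g_def)
    ultimately show "(\<integral>z. f n z \<partial>M) = cmod (mean ws n)" by simp
  qed
  have "decays (weight ws) (mean ws)" by (rule mean_decays[OF ws])
  then have "decays 4 (mean ws)"
    by (rule decays_mono) (use w w' in \<open>cases w; simp add: ws_def\<close>)
  then obtain K where "\<forall>\<^sub>F n in sequentially. cmod (mean ws n) * sqrt (real n) ^ 4 \<le> K"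
    by (auto simp: decays_def)
  then have "\<forall>\<^sub>F n in sequentially. (\<integral>z. f n z \<partial>M) * (real n)\<^sup>2 \<le> K"
    using eventually_ge_at_top[of 1]
  proof eventually_elim
    case (elim n)
    have "sqrt (real n) ^ 4 = (sqrt (real n) ^ 2) ^ 2" by (simp only: power_mult[symmetric]) simp
    then show ?case using elim by (simp add: rep)
  qed
  then have "AE z in M. (\<lambda>n. f n z) \<longlonglongrightarrow> 0"
    by (intro AE_tendsto_zero_of_moments[of f K] rep) (auto simp: f_def)
  then show ?thesis
  proof eventually_elim
    case (elim z)
    have "(\<lambda>n. root 4 (f n z)) \<longlonglongrightarrow> root 4 0" using elim by (intro tendsto_real_root)
    moreover have "root 4 (f n z) = cmod (wtrace w n z)" for n
      by (simp add: f_def real_root_power_cancel)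
    ultimately show ?case by (simp add: tendsto_norm_zero_cancel)
  qed
qed

text \<open>The last letter is rotated to the front and split there, so that centered letters gather
  at the beginning.\<close>

lemma wtrace_snoc:
  assumes "q \<in> gwords" "x \<in> SA" "b \<in> SB" "n \<ge> 1" "z \<in> space M"
  shows "wtrace (q @ [(x, b)]) n z = wtrace ((x, \<lambda>n. square_matrices.center n (b n)) # q) n z
     + tr (b n) * Tr (x n * wm n (U n z) q)"
proof -
  interpret S: square_matrices n .
  have W: "U n z \<in> unitary_group n" using assms by (intro U_unitary)
  have cs: "x n \<in> S.Mn" "b n \<in> S.Mn" "inst n q \<in> S.words"
    using assms SA_carrier SB_carrier inst_gwords by auto
  have "wtrace (q @ [(x, b)]) n z = S.wtr (U n z) ((x n, b n) # inst n q)"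
    using S.wtr_rotate[of "U n z" "inst n q" "[(x n, b n)]"] W cs by (simp add: wtrace_def)
  then show ?thesis
    using S.wtr_center[OF W cs] by (simp add: wtrace_def)
qed

lemma Tr_wmat_Cons:
  assumes "w \<in> gwords" "x \<in> SA" "y \<in> SA" "b \<in> SB" "n \<ge> 1" "z \<in> space M"
  shows "Tr (x n * wm n (U n z) ((y, b) # w)) = wtrace (((\<lambda>n. x n * y n), b) # w) n z"
proof -
  interpret S: square_matrices n .
  have W: "U n z \<in> unitary_group n" using assms by (intro U_unitary)
  then show ?thesis
    using S.Tr_absorb[of "U n z" "x n" "y n" "b n" "inst n w"] assms SA_carrier SB_carrier inst_gwords
    by (simp add: wtrace_def)
qed

text \<open>The induction strips \<open>q\<close> from its end: the centered part of the last letter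
  extends \<open>p\<close>, while its scalar part makes \<open>x\<close> join the first letter of
  \<open>p\<close>. As \<open>p\<close> is nonempty, there is a letter for \<open>x\<close> to join,
  and every word that remains has a centered letter.\<close>

lemma partly_centered_tendsto_zero:
  assumes "q \<in> gwords" "p \<in> centered_words" "p \<noteq> []"
  shows "AE z in M. (\<lambda>n. wtrace (p @ q) n z) \<longlonglongrightarrow> 0"
  using assms
proof (induction q arbitrary: p rule: rev_induct)
  case Nil
  then show ?case using centered_tendsto_zero by simp
next
  case (snoc r q)
  obtain x b where r: "r = (x, b)" by (cases r)
  obtain y c p0 where p: "p = (y, c) # p0" using snoc.prems(3) by (cases p) auto
  have cs: "x \<in> SA" "b \<in> SB" "q \<in> gwords" "y \<in> SA" "c \<in> SB0" "p0 \<in> centered_words"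
    using snoc.prems r p by auto
  obtain B where B: "\<And>n. cmod (tr (b n)) \<le> B" using SB_bounded[OF cs(2)] by blast
  define p1 where "p1 = (x, \<lambda>n. square_matrices.center n (b n)) # p"
  define p2 where "p2 = ((\<lambda>n. x n * y n), c) # p0"
  have "AE z in M. (\<lambda>n. wtrace (p1 @ q) n z) \<longlonglongrightarrow> 0" "AE z in M. (\<lambda>n. wtrace (p2 @ q) n z) \<longlonglongrightarrow> 0"
    using cs snoc.prems center_SB0 SA_mult by (intro snoc.IH; simp add: p1_def p2_def)+
  then show ?case
    using AE_space
  proof eventually_elim
    case (elim z)
    have "(\<lambda>n. wtrace (p1 @ q) n z + tr (b n) * wtrace (p2 @ q) n z) \<longlonglongrightarrow> 0 + 0"
      by (intro tendsto_add elim tendsto_zero_bounded_mult[OF _ B])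
    moreover have "wtrace (p @ q @ [r]) n z = wtrace (p1 @ q) n z + tr (b n) * wtrace (p2 @ q) n z" if n: "n \<ge> 1" for n
    proof -
      have g: "p @ q \<in> gwords" "p0 @ q \<in> gwords"
        using snoc.prems cs centered_words_gwords by auto
      have "Tr (x n * wm n (U n z) (p @ q)) = wtrace (p2 @ q) n z"
        using Tr_wmat_Cons[OF g(2) cs(1,4) SB0_SB[OF cs(5)] n elim(3)] by (simp add: p p2_def)
      then show ?thesis
        using wtrace_snoc[OF g(1) cs(1,2) n elim(3)] by (simp add: r p1_def)
    qed
    then have "\<forall>\<^sub>F n in sequentially. wtrace (p1 @ q) n z + tr (b n) * wtrace (p2 @ q) n z = wtrace (p @ q @ [r]) n z"
      by (intro eventually_mono[OF eventually_ge_at_top[of 1]]) simp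
    ultimately show ?case
      by (simp add: tendsto_cong)
  qed
qed

definition letter_prod :: "(symbol \<times> symbol) list \<Rightarrow> nat \<Rightarrow> complex mat" where
  "letter_prod q n = foldr (\<lambda>(x, b) R. x n * R) q (1\<^sub>m n)"

lemma letter_prod_carrier: "q \<in> gwords \<Longrightarrow> letter_prod q n \<in> carrier_mat n n"
  using SA_carrier by (induction q) (auto simp: letter_prod_def split_beta intro!: mult_carrier_mat)

lemma letter_prod_append:
  assumes "q \<in> gwords" "r \<in> gwords"
  shows "letter_prod (q @ r) n = letter_prod q n * letter_prod r n"
  using assms(1)
proof (induction q)
  case Nil
  then show ?case using left_mult_one_mat[OF letter_prod_carrier[OF assms(2), of n]] by (simp add: letter_prod_def)
next
  case (Cons p q)
  then have "letter_prod (p # q @ r) n = fst p n * (letter_prod q n * letter_prod r n)"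
    by (simp add: letter_prod_def split_beta)
  also have "\<dots> = fst p n * letter_prod q n * letter_prod r n"
    using Cons.prems SA_carrier letter_prod_carrier assms(2)
    by (intro assoc_mult_mat[of _ n n _ n _ n, symmetric]) auto
  finally show ?case by (simp add: letter_prod_def split_beta)
qed

definition tr_prod :: "(symbol \<times> symbol) list \<Rightarrow> nat \<Rightarrow> complex" where
  "tr_prod q n = (\<Prod>(x, b)\<leftarrow>q. tr (b n))"

text \<open>Peeling off the last letter: the part with the centered \<open>b\<close> tends to zero
  by \<open>partly_centered_tendsto_zero\<close>, and the scalar part is tr b times the trace of a
  word shorter by one, in which \<open>x\<close> joins the first letter. Cyclicity keeps the trace
  of the product of the letters unchanged.\<close>

theorem wtrace_factorizes:
  assumes "q \<in> gwords" "q \<noteq> []"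
  shows "AE z in M. (\<lambda>n. wtrace q n z - Tr (letter_prod q n) * tr_prod q n) \<longlonglongrightarrow> 0"
  using assms
proof (induction "length q" arbitrary: q rule: less_induct)
  case less
  then obtain q0 r where "q = q0 @ [r]" by (cases q rule: rev_cases) auto
  then obtain x b where q: "q = q0 @ [(x, b)]" by (cases r) auto
  have cs: "x \<in> SA" "b \<in> SB" "q0 \<in> gwords" using less.prems q by auto
  obtain B where B: "\<And>n. cmod (tr (b n)) \<le> B" using SB_bounded[OF cs(2)] by blast
  define p1 where "p1 = (x, \<lambda>n. square_matrices.center n (b n)) # q0"
  have 1: "AE z in M. (\<lambda>n. wtrace p1 n z) \<longlonglongrightarrow> 0"
    using partly_centered_tendsto_zero[of q0 "[(x, \<lambda>n. square_matrices.center n (b n))]"] cs center_SB0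
    by (simp add: p1_def)
  have 2: "AE z in M. (\<lambda>n. Tr (x n * wm n (U n z) q0) -
      Tr (letter_prod q n) * tr_prod q0 n) \<longlonglongrightarrow> 0"
  proof (cases q0)
    case Nil
    have "x n * wm n (U n z) q0 = x n" for n z
      using right_mult_one_mat[OF SA_carrier[OF cs(1)]] by (simp add: Nil square_matrices.wmat_Nil)
    moreover have "letter_prod q n = x n" for n
      using right_mult_one_mat[OF SA_carrier[OF cs(1)]] by (simp add: q Nil letter_prod_def)
    ultimately show ?thesis by (simp add: Nil tr_prod_def)
  next
    case (Cons s q1)
    obtain y c where s: "s = (y, c)" by (cases s)
    have c: "y \<in> SA" "c \<in> SB" "q1 \<in> gwords" using cs Cons s by auto
    define q' where "q' = ((\<lambda>n. x n * y n), c) # q1"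
    have "AE z in M. (\<lambda>n. wtrace q' n z - Tr (letter_prod q' n) * tr_prod q' n) \<longlonglongrightarrow> 0"
      using c cs SA_mult by (intro less.hyps) (auto simp: q'_def q Cons)
    then show ?thesis
      using AE_space
    proof eventually_elim
      case (elim z)
      have "Tr (letter_prod q' n) = Tr (letter_prod q n)" for n
      proof -
        interpret S: square_matrices n .
        have m: "x n \<in> S.Mn" "y n \<in> S.Mn" "letter_prod q1 n \<in> S.Mn"
          using cs c SA_carrier letter_prod_carrier by auto
        have "letter_prod q n = letter_prod q0 n * letter_prod [(x, b)] n"
          unfolding q using cs by (intro letter_prod_append) auto
        also have "\<dots> = y n * letter_prod q1 n * x n"
          using m by (simp add: Cons s letter_prod_def)
        finally have "Tr (letter_prod q n) = Tr (y n * letter_prod q1 n * x n)" by simp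
        also have "\<dots> = Tr (x n * (y n * letter_prod q1 n))" using m by (intro S.Tr_swap) auto
        also have "\<dots> = Tr (letter_prod q' n)" using m by (simp add: q'_def letter_prod_def S.assoc)
        finally show ?thesis by simp
      qed
      moreover have "tr_prod q' = tr_prod q0" by (simp add: q'_def Cons s tr_prod_def fun_eq_iff)
      ultimately have lim: "(\<lambda>n. wtrace q' n z - Tr (letter_prod q n) * tr_prod q0 n) \<longlonglongrightarrow> 0"
        using elim(1) by simp
      have "wtrace q' n z = Tr (x n * wm n (U n z) q0)" if "n \<ge> 1" for n
        using Tr_wmat_Cons[OF c(3) cs(1) c(1,2) that elim(2)] by (simp add: q'_def Cons s)
      then have "\<forall>\<^sub>F n in sequentially. wtrace q' n z - Tr (letter_prod q n) * tr_prod q0 n =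
          Tr (x n * wm n (U n z) q0) - Tr (letter_prod q n) * tr_prod q0 n"
        by (intro eventually_mono[OF eventually_ge_at_top[of 1]]) simp
      then show ?case using lim by (rule Lim_transform_eventually[rotated])
    qed
  qed
  from 1 2 AE_space show ?case
  proof eventually_elim
    case (elim z)
    have "(\<lambda>n. wtrace p1 n z + tr (b n) * (Tr (x n * wm n (U n z) q0) -
      Tr (letter_prod q n) * tr_prod q0 n)) \<longlonglongrightarrow> 0 + 0"
      by (intro tendsto_add elim tendsto_zero_bounded_mult[OF _ B])
    moreover have "wtrace q n z = wtrace p1 n z + tr (b n) * Tr (x n * wm n (U n z) q0)"
      if n: "n \<ge> 1" for n
      using wtrace_snoc[OF cs(3,1,2) n elim(3)] by (simp add: q p1_def)
    then have "\<forall>\<^sub>F n in sequentially. wtrace p1 n z + tr (b n) * (Tr (x n * wm n (U n z) q0) -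
      Tr (letter_prod q n) * tr_prod q0 n) = wtrace q n z - Tr (letter_prod q n) * tr_prod q n"
      by (intro eventually_mono[OF eventually_ge_at_top[of 1]])
        (simp add: q tr_prod_def algebra_simps)
    ultimately show ?case
      by (simp add: tendsto_cong)
  qed
qed

end

section \<open>The matrix algebras\<close>

lemma matrix_alg_simps [simp]:
  "carrier (matrix_alg n) = carrier_mat n n" "mult (matrix_alg n) = (*)" "one (matrix_alg n) = 1\<^sub>m n"
  "zero (matrix_alg n) = 0\<^sub>m n n" "add (matrix_alg n) = (+)" "smult (matrix_alg n) = (\<cdot>\<^sub>m)"
  "star (matrix_alg n) = mat_adjoint"
  by (simp_all add: matrix_alg_def)

lemma abelian_group_matrix_alg: "abelian_group (matrix_alg n)"
proof (rule abelian_groupI)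
  fix x assume "x \<in> carrier (matrix_alg n)"
  then show "\<exists>y\<in>carrier (matrix_alg n). y \<oplus>\<^bsub>matrix_alg n\<^esub> x = \<zero>\<^bsub>matrix_alg n\<^esub>"
    by (intro bexI[of _ "- x"]) (auto intro!: uminus_l_inv_mat)
qed (auto intro: assoc_add_mat comm_add_mat)

lemma unital_star_algebra_matrix_alg: "unital_star_algebra (matrix_alg n)"
proof -
  have "Module.module class_ring (matrix_alg n)"
    by (rule moduleI[OF class_cring.is_cring abelian_group_matrix_alg])
      (auto simp: add_smult_distrib_right_mat add_smult_distrib_left_mat class_ring_simps intro!: eq_matI
        simp: algebra_simps)
  then have "star_algebra (matrix_alg n)"
    by (intro star_algebra.intro star_algebra_axioms.intro)
      (auto simp: adjoint_add[of _ n n] adjoint_smult[of _ n n] adjoint_mult[of _ n n _ n] class_ring_simps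
        intro: assoc_mult_mat add_mult_distrib_mat mult_add_distrib_mat mult_smult_assoc_mat mult_smult_distrib)
  then show ?thesis
    by (intro unital_star_algebra.intro unital_star_algebra_axioms.intro) auto
qed

lemma star_subalgebra_carrier: "star_algebra A \<Longrightarrow> star_subalgebra A (carrier A)"
  unfolding star_subalgebra_def linear_subspace_def
proof (intro conjI ballI allI subset_refl)
  assume A: "star_algebra A"
  interpret star_algebra A by (rule A)
  show "\<zero>\<^bsub>A\<^esub> \<in> carrier A" by simp
  show "x \<oplus>\<^bsub>A\<^esub> y \<in> carrier A" if "x \<in> carrier A" "y \<in> carrier A" for x y using that by simp
  show "c \<odot>\<^bsub>A\<^esub> x \<in> carrier A" if "x \<in> carrier A" for c x using that by (intro smult_closed) (auto simp: class_ring_simps)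
  show "x \<otimes>\<^bsub>A\<^esub> y \<in> carrier A" if "x \<in> carrier A" "y \<in> carrier A" for x y using that by (rule mult_closed)
  show "star A x \<in> carrier A" if "x \<in> carrier A" for x using that by (rule star_closed)
qed

text \<open>Dimension 0 is excluded because \<open>tr\<close> of its unit is 0.\<close>

lemma nc_prob_space_with_weight_matrix_alg:
  assumes n: "n \<ge> 1"
  shows "nc_prob_space_with_weight (matrix_alg n) (carrier_mat n n) Tr tr"
proof -
  interpret A: unital_star_algebra "matrix_alg n" by (rule unital_star_algebra_matrix_alg)
  have sub: "star_subalgebra (matrix_alg n) (carrier_mat n n)"
    using star_subalgebra_carrier[OF A.star_algebra_axioms] by simp
  have Tr: "tracial_weight (matrix_alg n) (carrier_mat n n) Tr"
  proof (intro tracial_weight.intro tracial_weight_axioms.intro A.star_algebra_axioms sub)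
    show "Tr (x \<otimes>\<^bsub>matrix_alg n\<^esub> y) = Tr (y \<otimes>\<^bsub>matrix_alg n\<^esub> x)"
      if "x \<in> carrier_mat n n" "y \<in> carrier_mat n n" for x y
      using Tr_comm[OF that] by simp
  qed (simp_all add: Tr_add[of _ n] Tr_smult[of _ n] Tr_adjoint[of _ n] Tr_adjoint_self_nonneg)
  have nonneg: "z / of_nat n \<in> \<real>\<^sub>\<ge>\<^sub>0" if "z \<in> \<real>\<^sub>\<ge>\<^sub>0" for z :: complex
    using that by (auto simp: complex_nonneg_Reals_iff)
  have prod: "mat_adjoint x * x \<in> carrier_mat n n" if "x \<in> carrier_mat n n" for x :: "complex mat"
    using that by auto
  have tr_eq: "tr X = Tr X / of_nat n" if "X \<in> carrier_mat n n" for X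
    using that by (auto simp: tr_def)
  have tr: "tracial_weight (matrix_alg n) (carrier (matrix_alg n)) tr"
    unfolding matrix_alg_simps(1)
  proof (intro tracial_weight.intro tracial_weight_axioms.intro A.star_algebra_axioms sub)
    show "tr (x \<otimes>\<^bsub>matrix_alg n\<^esub> y) = tr (y \<otimes>\<^bsub>matrix_alg n\<^esub> x)"
      if "x \<in> carrier_mat n n" "y \<in> carrier_mat n n" for x y
      using Tr_comm[OF that] that by (simp add: tr_eq)
  qed (simp_all add: tr_eq Tr_add[of _ n] Tr_smult[of _ n] Tr_adjoint[of _ n] Tr_adjoint_self_nonneg
      add_divide_distrib nonneg prod)
  have "nc_prob_space (matrix_alg n) tr"
    using tr n
    by (intro nc_prob_space.intro nc_prob_space_axioms.intro A.unital_star_algebra_axioms) (auto simp: tr_def)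
  then show ?thesis using Tr by (intro nc_prob_space_with_weight.intro)
qed

section \<open>The free unital *-algebra\<close>

text \<open>Words form a monoid under concatenation, so that *-polynomials become a ring.\<close>

instantiation list :: (type) monoid_add
begin

definition zero_list :: "'a list" where "zero_list = []"

definition plus_list :: "'a list \<Rightarrow> 'a list \<Rightarrow> 'a list" where "plus_list u v = u @ v"

instance by standard (auto simp: zero_list_def plus_list_def)

end

type_synonym 'v starpoly = "('v \<times> bool) list \<Rightarrow>\<^sub>0 complex"

definition monomial :: "('v \<times> bool) list \<Rightarrow> 'v starpoly" where
  "monomial w = Poly_Mapping.single w 1"

text \<open>The index \<open>0\<close> is the empty word, so the left factor is the constant
  polynomial with value \<open>c\<close>.\<close>

definition pscale :: "complex \<Rightarrow> 'v starpoly \<Rightarrow> 'v starpoly" where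
  "pscale c P = Poly_Mapping.single 0 c * P"

lemma lookup_pscale [simp]: "Poly_Mapping.lookup (pscale c P) w = c * Poly_Mapping.lookup P w"
  unfolding pscale_def mult_map_scale_conv_mult[symmetric]
  by (simp add: Poly_Mapping.map.rep_eq when_def)

lemma pscale_mult_left: "pscale c P * Q = pscale c (P * Q)"
  by (simp add: pscale_def mult.assoc)

lemma single_zero_commute: "P * Poly_Mapping.single (0 :: ('v \<times> bool) list) (c :: complex) = Poly_Mapping.single 0 c * P"
proof (induction P rule: update_induct)
  case const
  then show ?case by simp
next
  case (update f a b)
  have "Poly_Mapping.update a b f = Poly_Mapping.single a b + f"
    using update(1) by (intro poly_mapping_eqI)
      (auto simp: Poly_Mapping.lookup_update lookup_add lookup_single when_def not_in_keys_iff_lookup_eq_zero)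
  then show ?case using update(3) by (simp add: distrib_left distrib_right mult_single mult.commute)
qed

lemma pscale_mult_right: "P * pscale c Q = pscale c (P * Q)"
proof -
  have "P * pscale c Q = (P * Poly_Mapping.single 0 c) * Q" by (simp add: pscale_def mult.assoc)
  then show ?thesis by (simp add: single_zero_commute pscale_def mult.assoc)
qed

lemma pscale_simps [simp]:
  "pscale c (P + Q) = pscale c P + pscale c Q" "pscale (c + d) P = pscale c P + pscale d P"
  "pscale c (pscale d P) = pscale (c * d) P" "pscale 1 P = P" "pscale c 0 = 0"
  by (rule poly_mapping_eqI; simp add: lookup_add algebra_simps)+

lemma monomial_mult: "monomial u * monomial v = monomial (u @ v)"
  by (simp add: monomial_def mult_single plus_list_def)

lemma monomial_Nil: "monomial [] = 1"
  by (simp add: monomial_def zero_list_def[symmetric])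

lemma starpoly_eq_sum:
  fixes P :: "'v starpoly"
  shows "P = (\<Sum>w\<in>Poly_Mapping.keys P. pscale (Poly_Mapping.lookup P w) (monomial w))"
proof (rule poly_mapping_eqI)
  fix v
  have "Poly_Mapping.lookup (\<Sum>w\<in>Poly_Mapping.keys P. pscale (Poly_Mapping.lookup P w) (monomial w)) v =
    (\<Sum>w\<in>Poly_Mapping.keys P. if w = v then Poly_Mapping.lookup P v else 0)"
    unfolding lookup_sum by (intro sum.cong) (auto simp: monomial_def lookup_single when_def)
  also have "\<dots> = Poly_Mapping.lookup P v"
    by (simp add: in_keys_iff)
  finally show "Poly_Mapping.lookup P v =
    Poly_Mapping.lookup (\<Sum>w\<in>Poly_Mapping.keys P. pscale (Poly_Mapping.lookup P w) (monomial w)) v" by simp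
qed

text \<open>Induction over linear combinations that asks only for the monomials occurring in
  \<open>P\<close>, and so applies within subspaces given by conditions on words.\<close>

lemma starpoly_span:
  assumes zero: "X 0" and add: "\<And>P Q. X P \<Longrightarrow> X Q \<Longrightarrow> X (P + Q)" and scl: "\<And>c P. X P \<Longrightarrow> X (pscale c P)"
    and mon: "\<And>w. w \<in> Poly_Mapping.keys P \<Longrightarrow> X (monomial w)"
  shows "X P"
proof -
  have sums: "X (\<Sum>w\<in>S. pscale (Poly_Mapping.lookup P w) (monomial w))" if "S \<subseteq> Poly_Mapping.keys P" for S
    using finite_subset[OF that finite_keys] that
    by (induction S rule: finite_induct) (auto intro: zero add scl mon)
  show ?thesis by (subst starpoly_eq_sum) (rule sums[OF subset_refl])
qed

lemma starpoly_induct [case_names zero add scale monomial]: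
  assumes "X 0" "\<And>P Q. X P \<Longrightarrow> X Q \<Longrightarrow> X (P + Q)" "\<And>c P. X P \<Longrightarrow> X (pscale c P)" "\<And>w. X (monomial w)"
  shows "X P"
  using assms by (rule starpoly_span)

definition wstar :: "('v \<times> bool) list \<Rightarrow> ('v \<times> bool) list" where
  "wstar w = rev (map (\<lambda>(v, s). (v, \<not> s)) w)"

lemma wstar_wstar [simp]: "wstar (wstar w) = w"
  by (simp add: wstar_def rev_map[symmetric] o_def split_beta)

lemma wstar_append: "wstar (u @ v) = wstar v @ wstar u"
  by (simp add: wstar_def)

lemma wstar_simps [simp]: "wstar [] = []" "wstar w = [] \<longleftrightarrow> w = []"
  by (auto simp: wstar_def)

lemma set_wstar: "set (wstar w) = (\<lambda>(v, s). (v, \<not> s)) ` set w"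
  by (simp add: wstar_def)

lemma inj_wstar: "inj wstar"
  by (metis injI wstar_wstar)

text \<open>\<open>map_key\<close> composes with \<open>wstar\<close>; as \<open>wstar\<close> is
  its own inverse, this carries the conjugated coefficient of a word over to the adjoint
  word.\<close>

definition pstar :: "'v starpoly \<Rightarrow> 'v starpoly" where
  "pstar P = Poly_Mapping.map_key wstar (Poly_Mapping.map cnj P)"

lemma lookup_pstar [simp]: "Poly_Mapping.lookup (pstar P) w = cnj (Poly_Mapping.lookup P (wstar w))"
  by (simp add: pstar_def map_key.rep_eq[OF inj_wstar] Poly_Mapping.map.rep_eq when_def)

lemma pstar_simps [simp]:
  "pstar 0 = 0" "pstar (P + Q) = pstar P + pstar Q" "pstar (pscale c P) = pscale (cnj c) (pstar P)" "pstar (pstar P) = P"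
  by (rule poly_mapping_eqI; simp add: lookup_add)+

lemma pstar_monomial [simp]: "pstar (monomial w) = monomial (wstar w)"
proof (rule poly_mapping_eqI)
  fix v :: "('a \<times> bool) list"
  have "w = wstar v \<longleftrightarrow> wstar w = v" by (metis wstar_wstar)
  then show "Poly_Mapping.lookup (pstar (monomial w)) v = Poly_Mapping.lookup (monomial (wstar w)) v"
    by (simp add: monomial_def lookup_single when_def)
qed

lemma pstar_mult: "pstar (P * Q) = pstar Q * pstar P"
proof (induction P rule: starpoly_induct)
  case (monomial u)
  show ?case
    by (induction Q rule: starpoly_induct)
      (simp_all add: distrib_left distrib_right pscale_mult_left pscale_mult_right monomial_mult wstar_append)
qed (simp_all add: distrib_left distrib_right pscale_mult_left pscale_mult_right)

lemma in_keys_pstar: "w \<in> Poly_Mapping.keys (pstar P) \<longleftrightarrow> wstar w \<in> Poly_Mapping.keys P"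
  by (simp add: in_keys_iff)

lemma keys_pscale: "Poly_Mapping.keys (pscale c P) \<subseteq> Poly_Mapping.keys P"
  by (auto simp: in_keys_iff)

lemma keys_mult_append:
  "w \<in> Poly_Mapping.keys (P * Q) \<Longrightarrow> \<exists>u\<in>Poly_Mapping.keys P. \<exists>v\<in>Poly_Mapping.keys Q. w = u @ v"
  using keys_mult[of P Q] unfolding plus_list_def by blast

definition free_alg :: "'v starpoly star_alg" where
  "free_alg = \<lparr>carrier = UNIV, mult = (*), one = 1, zero = 0, add = (+), smult = pscale, star = pstar\<rparr>"

lemma free_alg_simps [simp]:
  "carrier free_alg = UNIV" "mult free_alg = (*)" "one free_alg = 1" "zero free_alg = 0"
  "add free_alg = (+)" "smult free_alg = pscale" "star free_alg = pstar"
  by (simp_all add: free_alg_def)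

lemma abelian_group_free_alg: "abelian_group free_alg"
proof (rule abelian_groupI)
  fix x :: "'a starpoly"
  show "\<exists>y\<in>carrier free_alg. y \<oplus>\<^bsub>free_alg\<^esub> x = \<zero>\<^bsub>free_alg\<^esub>" by (intro bexI[of _ "- x"]) auto
qed (auto simp: ac_simps)

lemma unital_star_algebra_free_alg: "unital_star_algebra free_alg"
proof -
  have "Module.module class_ring free_alg"
    by (rule moduleI[OF class_cring.is_cring abelian_group_free_alg]) (auto simp: class_ring_simps)
  then have "star_algebra free_alg"
    by (intro star_algebra.intro star_algebra_axioms.intro)
      (auto simp: mult.assoc distrib_left distrib_right pscale_mult_left pscale_mult_right pstar_mult class_ring_simps)
  then show ?thesis
    by (intro unital_star_algebra.intro unital_star_algebra_axioms.intro) auto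
qed

text \<open>The words of a product are concatenations of words of the factors. The domain of
  \<open>\<omega>\<close> and the algebras around the two generated ones are obtained from
  this.\<close>

lemma star_subalgebra_keys:
  assumes app: "\<And>u v. R u \<Longrightarrow> R v \<Longrightarrow> R (u @ v)" and st: "\<And>w. R w \<Longrightarrow> R (wstar w)"
  shows "star_subalgebra free_alg {P. \<forall>w\<in>Poly_Mapping.keys P. R w}" (is "star_subalgebra _ ?S")
  unfolding star_subalgebra_def linear_subspace_def
proof (intro conjI ballI allI)
  show "x \<oplus>\<^bsub>free_alg\<^esub> y \<in> ?S" if "x \<in> ?S" "y \<in> ?S" for x y
    using that keys_add[of x y] by (simp add: subset_iff) blast
  show "c \<odot>\<^bsub>free_alg\<^esub> x \<in> ?S" if "x \<in> ?S" for c x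
    using that keys_pscale[of c x] by (simp add: subset_iff)
  show "x \<otimes>\<^bsub>free_alg\<^esub> y \<in> ?S" if "x \<in> ?S" "y \<in> ?S" for x y
    using that by (auto dest!: keys_mult_append intro: app)
  show "star free_alg x \<in> ?S" if x: "x \<in> ?S" for x
  proof -
    have "R w" if "w \<in> Poly_Mapping.keys (pstar x)" for w
      using st[of "wstar w"] x that by (auto simp: in_keys_pstar)
    then show ?thesis by simp
  qed
qed simp_all

lemma alg_prod_free_alg: "alg_prod free_alg Ps = prod_list Ps"
  by (induction "free_alg :: 'a starpoly star_alg" Ps rule: alg_prod.induct) simp_all

lemma finsum_free_alg:
  assumes "finite S"
  shows "(\<Oplus>\<^bsub>free_alg\<^esub>w\<in>S. g w) = (\<Sum>w\<in>S. g w)"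
proof -
  interpret abelian_group free_alg by (rule abelian_group_free_alg)
  show ?thesis using assms by (induction S rule: finite_induct) simp_all
qed

lemma word_eval_free_alg:
  assumes "\<And>v s. (v, s) \<in> set w \<Longrightarrow> f v = monomial [(v, False)]"
  shows "word_eval free_alg f w = monomial w"
proof -
  have "prod_list (map (\<lambda>(v, s). if s then pstar (f v) else f v) w) = monomial w"
    using assms
  proof (induction w)
    case Nil
    then show ?case by (simp add: monomial_Nil)
  next
    case (Cons p w)
    obtain v s where p: "p = (v, s)" by (cases p)
    have "f v = monomial [(v, False)]" using Cons.prems p by auto
    moreover have "prod_list (map (\<lambda>(v, s). if s then pstar (f v) else f v) w) = monomial w"
      using Cons by auto
    ultimately show ?case by (simp add: p monomial_mult wstar_def)
  qed
  then show ?thesis by (simp add: word_eval_def alg_prod_free_alg cong: if_cong)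
qed

section \<open>Evaluation at matrices\<close>

text \<open>Unlike \<open>alg_prod\<close>, the fold ends in the unit matrix, so that concatenation
  becomes multiplication without a special case for the empty word.\<close>

definition wmon :: "nat \<Rightarrow> ('v \<Rightarrow> complex mat) \<Rightarrow> ('v \<times> bool) list \<Rightarrow> complex mat" where
  "wmon n f w = foldr (\<lambda>(v, s) R. (if s then mat_adjoint (f v) else f v) * R) w (1\<^sub>m n)"

lemma wmon_simps [simp]:
  "wmon n f [] = 1\<^sub>m n" "wmon n f ((v, s) # w) = (if s then mat_adjoint (f v) else f v) * wmon n f w"
  by (simp_all add: wmon_def)

lemma wmon_map: "wmon n f (map (\<lambda>(i, s). (h i, s)) w) = wmon n (\<lambda>i. f (h i)) w"
  by (induction w) (auto simp: wmon_def)

context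
  fixes n :: nat and f :: "'v \<Rightarrow> complex mat"
  assumes f: "\<And>v. f v \<in> carrier_mat n n"
begin

interpretation S: square_matrices n .

lemma wmon_carrier [simp]: "wmon n f w \<in> carrier_mat n n"
  using f by (induction w) auto

lemma wmon_append: "wmon n f (u @ v) = wmon n f u * wmon n f v"
  by (induction u) (auto simp: S.assoc f)

lemma wmon_wstar: "wmon n f (wstar w) = mat_adjoint (wmon n f w)"
proof (induction w)
  case (Cons p w)
  obtain v s where p: "p = (v, s)" by (cases p)
  have "wstar (p # w) = wstar w @ [(v, \<not> s)]" by (simp add: wstar_def p)
  then show ?case
    using Cons f by (simp add: wmon_append p adjoint_mult[of _ n n _ n])
qed simp

lemma word_eval_matrix_alg: "word_eval (matrix_alg n) f w = wmon n f w"
proof -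
  have "alg_prod (matrix_alg n) xs = foldr (*) xs (1\<^sub>m n)" if "set xs \<subseteq> carrier_mat n n" for xs
    using that by (induction "matrix_alg n" xs rule: alg_prod.induct) auto
  moreover have "foldr (*) (map (\<lambda>(v, s). if s then mat_adjoint (f v) else f v) w) (1\<^sub>m n) = wmon n f w"
    by (induction w) auto
  moreover have "set (map (\<lambda>(v, s). if s then mat_adjoint (f v) else f v) w) \<subseteq> carrier_mat n n"
    using f by (auto split: if_splits)
  ultimately show ?thesis by (simp add: word_eval_def cong: if_cong)
qed

text \<open>An entrywise sum takes the place of the finite sum in the matrix algebra, which reduces
  linearity to sums of complex numbers; \<open>ncpoly_eval_matrix_alg\<close> identifies the
  two.\<close>

definition peval :: "'v starpoly \<Rightarrow> complex mat" where
  "peval P = mat n n (\<lambda>ij. \<Sum>w\<in>Poly_Mapping.keys P. Poly_Mapping.lookup P w * wmon n f w $$ ij)"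

lemma peval_carrier [simp]: "peval P \<in> carrier_mat n n"
  by (simp add: peval_def)

lemma peval_superset:
  assumes "finite S" "Poly_Mapping.keys P \<subseteq> S" "i < n" "j < n"
  shows "peval P $$ (i, j) = (\<Sum>w\<in>S. Poly_Mapping.lookup P w * wmon n f w $$ (i, j))"
  using assms by (auto simp: peval_def in_keys_iff intro!: sum.mono_neutral_left)

lemma peval_add [simp]: "peval (P + Q) = peval P + peval Q"
proof (rule eq_matI)
  fix i j assume "i < dim_row (peval P + peval Q)" "j < dim_col (peval P + peval Q)"
  then have ij: "i < n" "j < n" by (auto simp: peval_def)
  define S where "S = Poly_Mapping.keys P \<union> Poly_Mapping.keys Q"
  have S: "finite S" "Poly_Mapping.keys P \<subseteq> S" "Poly_Mapping.keys Q \<subseteq> S" "Poly_Mapping.keys (P + Q) \<subseteq> S"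
    using keys_add[of P Q] by (auto simp: S_def)
  have "(peval P + peval Q) $$ (i, j) = peval P $$ (i, j) + peval Q $$ (i, j)"
    using ij by (intro S.entry_plus_minus) auto
  then show "peval (P + Q) $$ (i, j) = (peval P + peval Q) $$ (i, j)"
    using ij S by (simp add: peval_superset[of S] lookup_add distrib_right sum.distrib)
qed (simp_all add: peval_def)

lemma peval_pscale [simp]: "peval (pscale c P) = c \<cdot>\<^sub>m peval P"
proof (rule eq_matI)
  fix i j assume "i < dim_row (c \<cdot>\<^sub>m peval P)" "j < dim_col (c \<cdot>\<^sub>m peval P)"
  then have ij: "i < n" "j < n" by (auto simp: peval_def)
  have "(c \<cdot>\<^sub>m peval P) $$ (i, j) = c * peval P $$ (i, j)"
    using ij carrier_matD[OF peval_carrier[of P]] by (intro index_smult_mat) auto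
  then show "peval (pscale c P) $$ (i, j) = (c \<cdot>\<^sub>m peval P) $$ (i, j)"
    using ij keys_pscale[of c P] by (simp add: peval_superset[of "Poly_Mapping.keys P"] sum_distrib_left mult.assoc)
qed (simp_all add: peval_def)

lemma peval_monomial [simp]: "peval (monomial w) = wmon n f w"
proof (rule eq_matI)
  fix i j assume "i < dim_row (wmon n f w)" "j < dim_col (wmon n f w)"
  then have ij: "i < n" "j < n" using carrier_matD[OF wmon_carrier[of w]] by auto
  then show "peval (monomial w) $$ (i, j) = wmon n f w $$ (i, j)"
    by (simp add: peval_superset[of "{w}"] monomial_def)
qed (use carrier_matD[OF wmon_carrier[of w]] in \<open>simp_all add: peval_def\<close>)

lemma peval_zero [simp]: "peval 0 = 0\<^sub>m n n"
  by (rule eq_matI) (simp_all add: peval_def)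

lemma peval_one: "peval 1 = 1\<^sub>m n"
  using peval_monomial[of "[]"] by (simp add: monomial_Nil del: peval_monomial)

lemma peval_mult: "peval (P * Q) = peval P * peval Q"
proof (induction P rule: starpoly_induct)
  case (monomial u)
  show ?case
    by (induction Q rule: starpoly_induct)
      (simp_all add: distrib_left pscale_mult_right monomial_mult wmon_append S.distribs S.smult_mults
        del: index_mult_mat)
qed (simp_all add: distrib_right pscale_mult_left S.distribs S.smult_mults)

lemma peval_pstar: "peval (pstar P) = mat_adjoint (peval P)"
  by (induction P rule: starpoly_induct)
    (simp_all add: adjoint_add[of _ n n] adjoint_smult[of _ n n] wmon_wstar)

lemma finsum_matrix_alg_index:
  assumes "finite S" "\<And>w. w \<in> S \<Longrightarrow> g w \<in> carrier_mat n n" "i < n" "j < n"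
  shows "(\<Oplus>\<^bsub>matrix_alg n\<^esub>w\<in>S. g w) $$ (i, j) = (\<Sum>w\<in>S. g w $$ (i, j))"
proof -
  interpret A: abelian_group "matrix_alg n" by (rule abelian_group_matrix_alg)
  show ?thesis
    using assms(1,2)
  proof (induction S rule: finite_induct)
    case empty
    then show ?case using assms(3,4) by simp
  next
    case (insert w S)
    have "(\<Oplus>\<^bsub>matrix_alg n\<^esub>w\<in>S. g w) \<in> carrier_mat n n"
      using A.finsum_closed[of g S] insert.prems by auto
    then show ?case
      using insert assms(3,4) by (simp add: A.finsum_insert S.entry_plus_minus del: index_add_mat)
  qed
qed

end

text \<open>Agreement is asked only on the variables occurring in \<open>P\<close>. This permits
  replacing the given finite families by families defined for all indices.\<close>

lemma ncpoly_eval_matrix_alg: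
  assumes f: "\<And>v. f v \<in> carrier_mat n n"
    and eq: "\<And>w v s. w \<in> Poly_Mapping.keys P \<Longrightarrow> (v, s) \<in> set w \<Longrightarrow> case_sum x y v = f v"
  shows "ncpoly_eval (matrix_alg n) x y P = peval n f P"
proof -
  interpret A: abelian_group "matrix_alg n" by (rule abelian_group_matrix_alg)
  have wc: "wmon n f w \<in> carrier_mat n n" for w by (rule wmon_carrier) (rule f)
  have pc: "peval n f P \<in> carrier_mat n n" by (rule peval_carrier) (rule f)
  have ps: "peval n f P $$ (i, j) = (\<Sum>w\<in>Poly_Mapping.keys P. Poly_Mapping.lookup P w * wmon n f w $$ (i, j))"
    if "i < n" "j < n" for i j
    by (rule peval_superset) (use f that in auto)
  have we: "word_eval (matrix_alg n) (case_sum x y) w = wmon n f w" if "w \<in> Poly_Mapping.keys P" for w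
  proof -
    have "word_eval (matrix_alg n) (case_sum x y) w = word_eval (matrix_alg n) f w"
      unfolding word_eval_def using eq[OF that] by (intro arg_cong[of _ _ "alg_prod (matrix_alg n)"] map_cong) auto
    then show ?thesis using word_eval_matrix_alg[of f n w] f by simp
  qed
  have c: "(\<Oplus>\<^bsub>matrix_alg n\<^esub>w\<in>Poly_Mapping.keys P. Poly_Mapping.lookup P w \<cdot>\<^sub>m wmon n f w) \<in> carrier_mat n n"
    using A.finsum_closed[of "\<lambda>w. Poly_Mapping.lookup P w \<cdot>\<^sub>m wmon n f w" "Poly_Mapping.keys P"]
      wc by auto
  have "ncpoly_eval (matrix_alg n) x y P =
      (\<Oplus>\<^bsub>matrix_alg n\<^esub>w\<in>Poly_Mapping.keys P. Poly_Mapping.lookup P w \<cdot>\<^sub>m wmon n f w)"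
    unfolding ncpoly_eval_def using wc
    by (intro A.finsum_cong') (auto simp: we)
  also have "\<dots> = peval n f P"
  proof (rule eq_matI)
    fix i j assume "i < dim_row (peval n f P)" "j < dim_col (peval n f P)"
    then have ij: "i < n" "j < n" using carrier_matD[OF pc] by auto
    have "(Poly_Mapping.lookup P w \<cdot>\<^sub>m wmon n f w) $$ (i, j) = Poly_Mapping.lookup P w * wmon n f w $$ (i, j)" for w
      using ij carrier_matD[OF wc[of w]] by (intro index_smult_mat) auto
    then show "(\<Oplus>\<^bsub>matrix_alg n\<^esub>w\<in>Poly_Mapping.keys P. Poly_Mapping.lookup P w \<cdot>\<^sub>m wmon n f w) $$ (i, j) = peval n f P $$ (i, j)"
      using ij wc f
      by (subst finsum_matrix_alg_index[of f n]) (simp_all add: ps)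
  qed (use carrier_matD[OF c] carrier_matD[OF pc] in simp_all)
  finally show ?thesis .
qed

section \<open>The limit space\<close>

text \<open>All randomness is frozen: \<open>V\<close> stands for the values \<open>U n z\<close> at
  one sample point outside the null set. In the pairs, \<open>u\<close> is nonempty while
  \<open>v\<close> may be empty, in accordance with a non-unital and a unital algebra.\<close>

locale factorizing_sample =
  fixes gA gB :: "nat \<Rightarrow> nat \<Rightarrow> complex mat" and V :: "nat \<Rightarrow> complex mat"
  assumes gA: "gA n i \<in> carrier_mat n n" and gB: "gB n j \<in> carrier_mat n n"
    and V: "n \<ge> 1 \<Longrightarrow> V n \<in> unitary_group n"
    and conv_A: "w \<noteq> [] \<Longrightarrow> convergent (\<lambda>n. Tr (wmon n (gA n) w))"
    and conv_B: "w \<noteq> [] \<Longrightarrow> convergent (\<lambda>n. tr (wmon n (gB n) w))"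
    and factorizes: "q \<noteq> [] \<Longrightarrow> (\<And>u v. (u, v) \<in> set q \<Longrightarrow> u \<noteq> []) \<Longrightarrow>
      (\<lambda>n. square_matrices.wtr n (V n) (map (\<lambda>(u, v). (wmon n (gA n) u, wmon n (gB n) v)) q)
         - Tr (wmon n (gA n) (concat (map fst q))) * (\<Prod>(u, v)\<leftarrow>q. tr (wmon n (gB n) v))) \<longlonglongrightarrow> 0"
begin

text \<open>At \<open>n = 0\<close> nothing is known about \<open>V n\<close>; the default zero
  keeps all evaluations in the carrier.\<close>

definition ev :: "nat \<Rightarrow> nat + nat \<Rightarrow> complex mat" where
  "ev n = case_sum (gA n) (\<lambda>j. if n \<ge> 1 then V n * gB n j * mat_adjoint (V n) else 0\<^sub>m n n)"

lemma ev_carrier: "ev n v \<in> carrier_mat n n"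
proof (cases v)
  case (Inr j)
  interpret S: square_matrices n .
  show ?thesis using S.conj_by_carrier[OF S.unitaryD(1)[OF V] gB] by (simp add: ev_def Inr S.conj_by_def)
qed (simp add: ev_def gA)

definition E :: "nat \<Rightarrow> ncpoly \<Rightarrow> complex mat" where
  "E n P = peval n (ev n) P"

lemma E_carrier [simp]: "E n P \<in> carrier_mat n n"
  unfolding E_def by (rule peval_carrier) (rule ev_carrier)

lemma E_add: "E n (P + Q) = E n P + E n Q"
  unfolding E_def by (rule peval_add) (rule ev_carrier)

lemma E_pscale: "E n (pscale c P) = c \<cdot>\<^sub>m E n P"
  unfolding E_def by (rule peval_pscale) (rule ev_carrier)

lemma E_mult: "E n (P * Q) = E n P * E n Q"
  unfolding E_def by (rule peval_mult) (rule ev_carrier)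

lemma E_pstar: "E n (pstar P) = mat_adjoint (E n P)"
  unfolding E_def by (rule peval_pstar) (rule ev_carrier)

lemma E_monomial: "E n (monomial w) = wmon n (ev n) w"
  unfolding E_def by (rule peval_monomial) (rule ev_carrier)

lemma E_zero: "E n 0 = 0\<^sub>m n n"
  unfolding E_def by (rule peval_zero) (rule ev_carrier)

lemma E_one: "E n 1 = 1\<^sub>m n"
  unfolding E_def by (rule peval_one) (rule ev_carrier)

lemma Tr_E:
  "Tr (E n (P + Q)) = Tr (E n P) + Tr (E n Q)" "Tr (E n (pscale c P)) = c * Tr (E n P)" "Tr (E n 0) = 0"
  by (simp_all add: E_add E_pscale E_zero Tr_add[of _ n] Tr_smult[of _ n])

lemma tr_E_eq: "tr (E n P) = Tr (E n P) / of_nat n"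
  using carrier_matD[OF E_carrier[of n P]] by (simp add: tr_def)

lemma tr_E:
  "tr (E n (P + Q)) = tr (E n P) + tr (E n Q)" "tr (E n (pscale c P)) = c * tr (E n P)" "tr (E n 0) = 0"
  by (simp_all add: tr_E_eq Tr_E add_divide_distrib)

section \<open>Words as alternating blocks of x-letters and y-letters\<close>

definition embL :: "(nat \<times> bool) list \<Rightarrow> ((nat + nat) \<times> bool) list" where
  "embL u = map (\<lambda>(i, s). (Inl i, s)) u"

definition embR :: "(nat \<times> bool) list \<Rightarrow> ((nat + nat) \<times> bool) list" where
  "embR u = map (\<lambda>(i, s). (Inr i, s)) u"

definition block :: "((nat \<times> bool) list \<times> (nat \<times> bool) list) list \<Rightarrow> ((nat + nat) \<times> bool) list" where
  "block q = concat (map (\<lambda>(u, v). embL u @ embR v) q)"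

lemma block_simps [simp]: "block [] = []" "block ((u, v) # q) = embL u @ embR v @ block q"
  by (simp_all add: block_def)

lemma block_append: "block (p @ q) = block p @ block q"
  by (simp add: block_def)

lemma wmon_append_ev: "wmon n (ev n) (u @ v) = wmon n (ev n) u * wmon n (ev n) v"
  by (rule wmon_append) (rule ev_carrier)

lemma wmon_ev_carrier [simp]: "wmon n (ev n) w \<in> carrier_mat n n"
  by (rule wmon_carrier) (rule ev_carrier)

lemma wmon_gA_carrier [simp]: "wmon n (gA n) w \<in> carrier_mat n n"
  by (rule wmon_carrier) (rule gA)

lemma wmon_gB_carrier [simp]: "wmon n (gB n) w \<in> carrier_mat n n"
  by (rule wmon_carrier) (rule gB)

lemma wmon_embL: "wmon n (ev n) (embL u) = wmon n (gA n) u"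
  unfolding embL_def wmon_map by (simp add: ev_def)

lemma wmon_embR:
  assumes n: "n \<ge> 1"
  shows "wmon n (ev n) (embR v) = square_matrices.conj_by (V n) (wmon n (gB n) v)"
proof -
  interpret S: square_matrices n .
  show ?thesis
  proof (induction v)
    case Nil
    then show ?case using S.conj_by_one[OF V[OF n]] by (simp add: embR_def)
  next
    case (Cons p v)
    obtain j s where p: "p = (j, s)" by (cases p)
    have c: "V n \<in> S.Mn" "gB n j \<in> S.Mn" using V[OF n] gB by auto
    have "(if s then mat_adjoint (ev n (Inr j)) else ev n (Inr j)) =
        S.conj_by (V n) (if s then mat_adjoint (gB n j) else gB n j)"
      using n S.conj_by_adjoint[OF c] by (simp add: ev_def S.conj_by_def)
    then show ?case
      using Cons.IH c by (simp add: embR_def p S.conj_by_mult[OF V[OF n]])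
  qed
qed

lemma wmon_block:
  assumes n: "n \<ge> 1"
  shows "wmon n (ev n) (block q) =
    square_matrices.wmat n (V n) (map (\<lambda>(u, v). (wmon n (gA n) u, wmon n (gB n) v)) q)"
proof -
  interpret S: square_matrices n .
  show ?thesis
  proof (induction q)
    case (Cons p q)
    obtain u v where p: "p = (u, v)" by (cases p)
    have c: "V n \<in> S.Mn" using V[OF n] by auto
    have "map (\<lambda>(u, v). (wmon n (gA n) u, wmon n (gB n) v)) q \<in> S.words"
      by (auto simp: S.words_def)
    then show ?case
      using Cons.IH c by (simp add: p wmon_append_ev wmon_embL wmon_embR[OF n] S.wmat_Cons S.assoc)
  qed (simp add: S.wmat_Nil)
qed

definition has_x :: "((nat + nat) \<times> bool) list \<Rightarrow> bool" where
  "has_x w \<longleftrightarrow> (\<exists>i s. (Inl i, s) \<in> set w)"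

lemma has_x_append [simp]: "has_x (u @ v) \<longleftrightarrow> has_x u \<or> has_x v"
  by (auto simp: has_x_def)

lemma has_x_embR [simp]: "\<not> has_x (embR v)"
  by (auto simp: has_x_def embR_def)

lemma has_x_wstar [simp]: "has_x (wstar w) \<longleftrightarrow> has_x w"
  by (force simp: has_x_def set_wstar)

text \<open>Read from the right, every x-letter opens a new block with the y-letters collected so
  far; only the y-letters in front of the first x-letter are left over.\<close>

lemma parse_word: "\<exists>v q. w = embR v @ block q \<and> (\<forall>u v. (u, v) \<in> set q \<longrightarrow> u \<noteq> [])"
proof (induction w)
  case Nil
  show ?case by (intro exI[of _ "[]"]) (simp add: embR_def)
next
  case (Cons p w)
  then obtain v q where w: "w = embR v @ block q" "\<forall>u v. (u, v) \<in> set q \<longrightarrow> u \<noteq> []" by blast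
  show ?case
  proof (cases p)
    case (Pair a s)
    show ?thesis
    proof (cases a)
      case (Inl i)
      have "p # w = embR [] @ block (([(i, s)], v) # q)"
        by (simp add: w(1) Pair Inl embL_def embR_def)
      moreover have "\<forall>u' v'. (u', v') \<in> set (([(i, s)], v) # q) \<longrightarrow> u' \<noteq> []" using w(2) by auto
      ultimately show ?thesis by blast
    next
      case (Inr j)
      have "p # w = embR ((j, s) # v) @ block q"
        by (simp add: w(1) Pair Inr embR_def)
      then show ?thesis using w(2) by blast
    qed
  qed
qed

lemma conv_B_Nil: "convergent (\<lambda>n. tr (wmon n (gB n) v))"
proof (cases "v = []")
  case True
  have "(\<lambda>n. tr (wmon n (gB n) v)) \<longlonglongrightarrow> 1"
    by (rule tendsto_eventually, rule eventually_mono[OF eventually_ge_at_top[of 1]]) (simp add: True tr_def)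
  then show ?thesis by (auto simp: convergent_def)
qed (rule conv_B)

text \<open>The factorization error tends to zero, and the product it is measured against converges:
  the x-parts concatenate to a nonempty word, for which \<open>conv_A\<close> applies.\<close>

lemma convergent_Tr_block:
  assumes "q \<noteq> []" "\<And>u v. (u, v) \<in> set q \<Longrightarrow> u \<noteq> []"
  shows "convergent (\<lambda>n. Tr (wmon n (ev n) (block q)))"
proof -
  have "concat (map fst q) \<noteq> []"
  proof -
    obtain u v q' where q: "q = (u, v) # q'" using assms(1) by (metis neq_Nil_conv surj_pair)
    then have "u \<noteq> []" using assms(2) by auto
    then show ?thesis by (simp add: q)
  qed
  then have A: "convergent (\<lambda>n. Tr (wmon n (gA n) (concat (map fst q))))" by (rule conv_A)
  have B: "convergent (\<lambda>n. \<Prod>(u, v)\<leftarrow>q. tr (wmon n (gB n) v))"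
  proof (induction q)
    case (Cons p q)
    then show ?case using conv_B_Nil[of "snd p"] by (auto simp: split_beta intro!: convergent_mult)
  qed (simp add: convergent_const)
  have "convergent (\<lambda>n. (square_matrices.wtr n (V n) (map (\<lambda>(u, v). (wmon n (gA n) u, wmon n (gB n) v)) q)
         - Tr (wmon n (gA n) (concat (map fst q))) * (\<Prod>(u, v)\<leftarrow>q. tr (wmon n (gB n) v)))
      + Tr (wmon n (gA n) (concat (map fst q))) * (\<Prod>(u, v)\<leftarrow>q. tr (wmon n (gB n) v)))"
    by (intro convergent_add convergent_mult A B convergentI[OF factorizes] assms)
  then have "convergent (\<lambda>n. square_matrices.wtr n (V n) (map (\<lambda>(u, v). (wmon n (gA n) u, wmon n (gB n) v)) q))"
    by simp
  then obtain L where "(\<lambda>n. square_matrices.wtr n (V n) (map (\<lambda>(u, v). (wmon n (gA n) u, wmon n (gB n) v)) q)) \<longlonglongrightarrow> L"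
    by (auto simp: convergent_def)
  then have "(\<lambda>n. Tr (wmon n (ev n) (block q))) \<longlonglongrightarrow> L"
    by (rule Lim_transform_eventually, intro eventually_mono[OF eventually_ge_at_top[of 1]])
      (simp add: wmon_block square_matrices.wtr_def)
  then show ?thesis by (auto simp: convergent_def)
qed

text \<open>The initial y-letters move cyclically to the end of the last block, which exists because
  some x-letter occurs.\<close>

lemma convergent_Tr_word:
  assumes "has_x w"
  shows "convergent (\<lambda>n. Tr (wmon n (ev n) w))"
proof -
  obtain v q where w: "w = embR v @ block q" and q: "\<forall>u v. (u, v) \<in> set q \<longrightarrow> u \<noteq> []"
    using parse_word by blast
  have "q \<noteq> []" using assms w by (auto simp: has_x_def[of "[]"])
  then obtain q0 u v0 where q_eq: "q = q0 @ [(u, v0)]" by (metis rev_exhaust surj_pair)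
  define q' where "q' = q0 @ [(u, v0 @ v)]"
  have "convergent (\<lambda>n. Tr (wmon n (ev n) (block q')))"
    using q by (intro convergent_Tr_block) (auto simp: q'_def q_eq)
  moreover have "Tr (wmon n (ev n) (block q')) = Tr (wmon n (ev n) w)" for n
  proof -
    interpret S: square_matrices n .
    have "wmon n (ev n) (block q') = wmon n (ev n) (block q) * wmon n (ev n) (embR v)"
      unfolding wmon_append_ev[symmetric] by (simp add: q'_def q_eq block_append embR_def)
    then show ?thesis using S.Tr_swap[of "wmon n (ev n) (block q)" "wmon n (ev n) (embR v)"]
      by (simp add: w wmon_append_ev)
  qed
  ultimately show ?thesis by simp
qed

text \<open>The ideal of polynomials with P(0, y) = 0. It leaves out the unit, whose trace
  \<open>n\<close> diverges.\<close>

definition D :: "ncpoly set" where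
  "D = {P. \<forall>w\<in>Poly_Mapping.keys P. has_x w}"

lemma convergent_Tr_E: "P \<in> D \<Longrightarrow> convergent (\<lambda>n. Tr (E n P))"
  by (rule starpoly_span[of "\<lambda>P. convergent (\<lambda>n. Tr (E n P))"])
    (auto simp: Tr_E E_monomial D_def intro!: convergent_add convergent_mult convergent_const convergent_Tr_word)

lemma tr_conj_by:
  assumes n: "n \<ge> 1"
  shows "tr (wmon n (ev n) (embR v)) = tr (wmon n (gB n) v)"
proof -
  interpret S: square_matrices n .
  show ?thesis
    unfolding wmon_embR[OF n] tr_def
    using S.Tr_conj_by[OF V[OF n]] S.conj_by_carrier[OF S.unitaryD(1)[OF V[OF n]] wmon_gB_carrier[of n v]]
      carrier_matD[OF wmon_gB_carrier[of n v]] by auto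
qed

text \<open>For a word containing an x-letter, \<open>Tr\<close> converges and hence
  \<open>tr\<close> tends to 0; for a word in y-letters alone, \<open>tr\<close> is that of the same
  word in the matrices \<open>gB\<close>, by unitary invariance.\<close>

lemma convergent_tr_E: "convergent (\<lambda>n. tr (E n P))"
proof (induction P rule: starpoly_induct)
  case (monomial w)
  show ?case
  proof (cases "has_x w")
    case True
    then obtain L where "(\<lambda>n. Tr (E n (monomial w))) \<longlonglongrightarrow> L"
      using convergent_Tr_word by (auto simp: convergent_def E_monomial)
    then have "(\<lambda>n. Tr (E n (monomial w)) * inverse (of_nat n)) \<longlonglongrightarrow> L * 0"
      by (intro tendsto_mult lim_inverse_n)
    then show ?thesis by (auto simp: tr_E_eq convergent_def divide_inverse)
  next
    case False
    obtain v q where w: "w = embR v @ block q" and q: "\<forall>u v. (u, v) \<in> set q \<longrightarrow> u \<noteq> []"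
      using parse_word by blast
    have "q = []"
    proof (rule ccontr)
      assume "q \<noteq> []"
      then obtain u v' q' where "q = (u, v') # q'" by (metis neq_Nil_conv surj_pair)
      then show False using False q w by (cases u) (auto simp: has_x_def embL_def)
    qed
    obtain L where "(\<lambda>n. tr (wmon n (gB n) v)) \<longlonglongrightarrow> L" using conv_B_Nil by (auto simp: convergent_def)
    then have "(\<lambda>n. tr (E n (monomial w))) \<longlonglongrightarrow> L"
      by (rule Lim_transform_eventually, intro eventually_mono[OF eventually_ge_at_top[of 1]])
        (simp add: E_monomial w \<open>q = []\<close> tr_conj_by)
    then show ?thesis by (auto simp: convergent_def)
  qed
qed (auto simp: tr_E convergent_const intro!: convergent_add convergent_mult)

definition \<omega> :: "ncpoly \<Rightarrow> complex" where
  "\<omega> P = lim (\<lambda>n. Tr (E n P))"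

definition \<tau> :: "ncpoly \<Rightarrow> complex" where
  "\<tau> P = lim (\<lambda>n. tr (E n P))"

lemma lim_\<omega>: "P \<in> D \<Longrightarrow> (\<lambda>n. Tr (E n P)) \<longlonglongrightarrow> \<omega> P"
  unfolding \<omega>_def using convergent_Tr_E by (simp add: convergent_LIMSEQ_iff)

lemma lim_\<tau>: "(\<lambda>n. tr (E n P)) \<longlonglongrightarrow> \<tau> P"
  unfolding \<tau>_def using convergent_tr_E by (simp add: convergent_LIMSEQ_iff)

lemma D_ideal: "P \<in> D \<Longrightarrow> P * Q \<in> D" "P \<in> D \<Longrightarrow> Q * P \<in> D"
  unfolding D_def by (auto dest!: keys_mult_append)

lemma D_subalgebra: "star_subalgebra free_alg D"
  unfolding D_def by (rule star_subalgebra_keys) auto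

lemma nonneg_limit:
  assumes "f \<longlonglongrightarrow> L" "\<And>n. f n \<in> \<real>\<^sub>\<ge>\<^sub>0"
  shows "L \<in> (\<real>\<^sub>\<ge>\<^sub>0 :: complex set)"
  using assms by (intro Lim_in_closed_set[OF closed_nonneg_Reals_complex _ _ assms(1)]) auto

lemma weight_\<omega>: "tracial_weight free_alg D \<omega>"
proof -
  interpret F: unital_star_algebra "free_alg :: ncpoly star_alg" by (rule unital_star_algebra_free_alg)
  note cl = D_subalgebra[unfolded star_subalgebra_def linear_subspace_def, simplified]
  show ?thesis
  proof (intro tracial_weight.intro tracial_weight_axioms.intro F.star_algebra_axioms D_subalgebra)
    fix x y assume x: "x \<in> D" and y: "y \<in> D"
    have "(\<lambda>n. Tr (E n (x + y))) \<longlonglongrightarrow> \<omega> x + \<omega> y"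
      unfolding Tr_E by (intro tendsto_add lim_\<omega> x y)
    then show "\<omega> (x \<oplus>\<^bsub>free_alg\<^esub> y) = \<omega> x + \<omega> y"
      using lim_\<omega>[of "x + y"] x y cl by (auto intro: LIMSEQ_unique)
    have "Tr (E n (x * y)) = Tr (E n (y * x))" for n
      unfolding E_mult by (rule Tr_comm[OF E_carrier E_carrier])
    then show "\<omega> (x \<otimes>\<^bsub>free_alg\<^esub> y) = \<omega> (y \<otimes>\<^bsub>free_alg\<^esub> x)" by (simp add: \<omega>_def)
  next
    fix x c assume x: "x \<in> D"
    have "(\<lambda>n. Tr (E n (pscale c x))) \<longlonglongrightarrow> c * \<omega> x"
      unfolding Tr_E by (intro tendsto_mult tendsto_const lim_\<omega> x)
    then show "\<omega> (c \<odot>\<^bsub>free_alg\<^esub> x) = c * \<omega> x"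
      using lim_\<omega>[of "pscale c x"] x cl by (auto intro: LIMSEQ_unique)
  next
    fix x assume x: "x \<in> D"
    then have "(\<lambda>n. Tr (E n (pstar x * x))) \<longlonglongrightarrow> \<omega> (pstar x * x)"
      by (intro lim_\<omega> D_ideal)
    then show "\<omega> (star free_alg x \<otimes>\<^bsub>free_alg\<^esub> x) \<in> \<real>\<^sub>\<ge>\<^sub>0"
      unfolding free_alg_simps
      by (rule nonneg_limit) (simp add: E_mult E_pstar Tr_adjoint_self_nonneg[OF E_carrier])
    have "(\<lambda>n. Tr (E n (pstar x))) \<longlonglongrightarrow> cnj (\<omega> x)"
      unfolding E_pstar Tr_adjoint[OF E_carrier] by (intro tendsto_cnj lim_\<omega> x)
    then show "\<omega> (star free_alg x) = cnj (\<omega> x)"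
      using lim_\<omega>[of "pstar x"] x cl by (auto intro: LIMSEQ_unique)
  qed
qed

lemma state_\<tau>: "nc_prob_space free_alg \<tau>"
proof -
  interpret F: unital_star_algebra "free_alg :: ncpoly star_alg" by (rule unital_star_algebra_free_alg)
  have "tracial_weight free_alg (carrier free_alg) \<tau>"
  proof (intro tracial_weight.intro tracial_weight_axioms.intro F.star_algebra_axioms
      star_subalgebra_carrier[OF F.star_algebra_axioms])
    fix x y :: ncpoly and c
    have "(\<lambda>n. tr (E n (x + y))) \<longlonglongrightarrow> \<tau> x + \<tau> y"
      unfolding tr_E by (intro tendsto_add lim_\<tau>)
    then show "\<tau> (x \<oplus>\<^bsub>free_alg\<^esub> y) = \<tau> x + \<tau> y"
      using lim_\<tau>[of "x + y"] by (auto intro: LIMSEQ_unique)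
    have "Tr (E n (x * y)) = Tr (E n (y * x))" for n
      unfolding E_mult by (rule Tr_comm[OF E_carrier E_carrier])
    then show "\<tau> (x \<otimes>\<^bsub>free_alg\<^esub> y) = \<tau> (y \<otimes>\<^bsub>free_alg\<^esub> x)" by (simp add: \<tau>_def tr_E_eq)
    have "(\<lambda>n. tr (E n (pscale c x))) \<longlonglongrightarrow> c * \<tau> x"
      unfolding tr_E by (intro tendsto_mult tendsto_const lim_\<tau>)
    then show "\<tau> (c \<odot>\<^bsub>free_alg\<^esub> x) = c * \<tau> x"
      using lim_\<tau>[of "pscale c x"] by (auto intro: LIMSEQ_unique)
    have "tr (E n (pstar x * x)) \<in> \<real>\<^sub>\<ge>\<^sub>0" for n
      using Tr_adjoint_self_nonneg[OF E_carrier[of n x]] unfolding tr_E_eq unfolding E_mult E_pstar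
      by (auto simp: complex_nonneg_Reals_iff)
    then show "\<tau> (star free_alg x \<otimes>\<^bsub>free_alg\<^esub> x) \<in> \<real>\<^sub>\<ge>\<^sub>0"
      using nonneg_limit[OF lim_\<tau>] by simp
    have "(\<lambda>n. tr (E n (pstar x))) \<longlonglongrightarrow> cnj (\<tau> x)"
    proof -
      have "tr (E n (pstar x)) = cnj (tr (E n x))" for n
        unfolding tr_E_eq unfolding E_pstar Tr_adjoint[OF E_carrier] by simp
      then show ?thesis using tendsto_cnj[OF lim_\<tau>[of x]] by simp
    qed
    then show "\<tau> (star free_alg x) = cnj (\<tau> x)"
      using lim_\<tau>[of "pstar x"] by (auto intro: LIMSEQ_unique)
  qed
  moreover have "(\<lambda>n. tr (E n 1)) \<longlonglongrightarrow> 1"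
    by (rule tendsto_eventually, rule eventually_mono[OF eventually_ge_at_top[of 1]]) (simp add: E_one tr_def)
  then have "\<tau> 1 = 1" using lim_\<tau>[of 1] by (auto intro: LIMSEQ_unique)
  ultimately show ?thesis
    by (intro nc_prob_space.intro nc_prob_space_axioms.intro F.unital_star_algebra_axioms) auto
qed

lemma limit_space: "nc_prob_space_with_weight free_alg D \<omega> \<tau>"
  using state_\<tau> weight_\<omega> by (rule nc_prob_space_with_weight.intro)

text \<open>The factorization is proved for \<open>AA\<close> and \<open>BB\<close>, which are
  described by the words that occur, and restricts to the generated algebras inside them. The empty
  word is left out of \<open>AA\<close>, the non-unital one.\<close>

definition AA :: "ncpoly set" where
  "AA = {P. \<forall>w\<in>Poly_Mapping.keys P. w \<noteq> [] \<and> (\<forall>(v, s)\<in>set w. isl v)}"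

definition BB :: "ncpoly set" where
  "BB = {P. \<forall>w\<in>Poly_Mapping.keys P. \<forall>(v, s)\<in>set w. \<not> isl v}"

lemma AA_D: "AA \<subseteq> D"
proof
  fix P assume P: "P \<in> AA"
  have "has_x w" if "w \<in> Poly_Mapping.keys P" for w
  proof -
    have "w \<noteq> []" "\<forall>(v, s)\<in>set w. isl v" using P that by (auto simp: AA_def)
    then show ?thesis by (cases w) (auto simp: has_x_def isl_def)
  qed
  then show "P \<in> D" by (simp add: D_def)
qed

lemma AA_subalgebra: "star_subalgebra free_alg AA"
  unfolding AA_def by (rule star_subalgebra_keys) (fastforce simp: set_wstar)+

lemma BB_subalgebra: "star_subalgebra free_alg BB"
  unfolding BB_def by (rule star_subalgebra_keys) (fastforce simp: set_wstar)+

lemma all_isl_embL: "\<forall>(v, s)\<in>set w. isl v \<Longrightarrow> \<exists>u. w = embL u"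
proof (induction w)
  case (Cons p w)
  then obtain u i s where "w = embL u" "p = (Inl i, s)" by (cases p) (auto simp: isl_def)
  then show ?case by (intro exI[of _ "(i, s) # u"]) (simp add: embL_def)
qed (simp add: embL_def)

lemma no_isl_embR: "\<forall>(v, s)\<in>set w. \<not> isl v \<Longrightarrow> \<exists>u. w = embR u"
proof (induction w)
  case (Cons p w)
  obtain a s where p: "p = (a, s)" by (cases p)
  obtain j where "a = Inr j" using Cons.prems by (cases a) (auto simp: p)
  moreover obtain u where "w = embR u" using Cons by auto
  ultimately show ?case by (intro exI[of _ "(j, s) # u"]) (simp add: embR_def p)
qed (simp add: embR_def)

section \<open>Factorization of the limit functional on the two subalgebras\<close>

definition fac_err :: "(ncpoly \<times> ncpoly) list \<Rightarrow> nat \<Rightarrow> complex" where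
  "fac_err ps n = Tr (E n (prod_list (interleave ps)))
     - Tr (E n (prod_list (map fst ps))) * (\<Prod>(a, b)\<leftarrow>ps. tr (E n b))"

definition pairs :: "((nat \<times> bool) list \<times> (nat \<times> bool) list) list \<Rightarrow> (ncpoly \<times> ncpoly) list" where
  "pairs q = map (\<lambda>(u, v). (monomial (embL u), monomial (embR v))) q"

lemma interleave_simps [simp]:
  "interleave [] = []" "interleave ((P, Q) # ps) = P # Q # interleave ps"
  "interleave (ps @ qs) = interleave ps @ interleave qs"
  by (simp_all add: interleave_def)

lemma prod_pairs:
  "prod_list (interleave (pairs q)) = monomial (block q)"
  "prod_list (map fst (pairs q)) = monomial (embL (concat (map fst q)))"
  by (induction q) (auto simp: pairs_def monomial_Nil monomial_mult embL_def)

lemma fac_err_pairs: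
  assumes "\<And>u v. (u, v) \<in> set q \<Longrightarrow> u \<noteq> []"
  shows "fac_err (pairs q) \<longlonglongrightarrow> 0"
proof (cases "q = []")
  case True
  have "fac_err [] = (\<lambda>n. 0)" by (simp add: fac_err_def fun_eq_iff)
  then show ?thesis by (simp add: True pairs_def)
next
  case False
  have "\<forall>\<^sub>F n in sequentially. square_matrices.wtr n (V n) (map (\<lambda>(u, v). (wmon n (gA n) u, wmon n (gB n) v)) q)
         - Tr (wmon n (gA n) (concat (map fst q))) * (\<Prod>(u, v)\<leftarrow>q. tr (wmon n (gB n) v)) = fac_err (pairs q) n"
  proof (rule eventually_mono[OF eventually_ge_at_top[of 1]])
    fix n :: nat assume n: "n \<ge> 1"
    have "(\<Prod>(a, b)\<leftarrow>pairs q. tr (E n b)) = (\<Prod>(u, v)\<leftarrow>q. tr (wmon n (gB n) v))"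
      by (induction q) (auto simp: pairs_def E_monomial tr_conj_by[OF n])
    then show "square_matrices.wtr n (V n) (map (\<lambda>(u, v). (wmon n (gA n) u, wmon n (gB n) v)) q)
         - Tr (wmon n (gA n) (concat (map fst q))) * (\<Prod>(u, v)\<leftarrow>q. tr (wmon n (gB n) v)) = fac_err (pairs q) n"
      by (simp add: fac_err_def prod_pairs E_monomial wmon_block[OF n] wmon_embL square_matrices.wtr_def)
  qed
  moreover have "(\<lambda>n. square_matrices.wtr n (V n) (map (\<lambda>(u, v). (wmon n (gA n) u, wmon n (gB n) v)) q)
         - Tr (wmon n (gA n) (concat (map fst q))) * (\<Prod>(u, v)\<leftarrow>q. tr (wmon n (gB n) v))) \<longlonglongrightarrow> 0"
    using factorizes[OF False] assms by blast
  ultimately show ?thesis by (rule Lim_transform_eventually[rotated])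
qed

text \<open>Evaluation, \<open>Tr\<close> and \<open>tr\<close> are linear, so both terms of the
  error are linear in each slot, and the factorization has to be known for monomials only.\<close>

lemma fac_err_linear:
  "fac_err (ps @ (P + P', Q) # qs) n = fac_err (ps @ (P, Q) # qs) n + fac_err (ps @ (P', Q) # qs) n"
  "fac_err (ps @ (pscale c P, Q) # qs) n = c * fac_err (ps @ (P, Q) # qs) n"
  "fac_err (ps @ (0, Q) # qs) n = 0"
  "fac_err (ps @ (P, Q + Q') # qs) n = fac_err (ps @ (P, Q) # qs) n + fac_err (ps @ (P, Q') # qs) n"
  "fac_err (ps @ (P, pscale c Q) # qs) n = c * fac_err (ps @ (P, Q) # qs) n"
  "fac_err (ps @ (P, 0) # qs) n = 0"
  by (simp_all add: fac_err_def distrib_left distrib_right pscale_mult_left pscale_mult_right Tr_E tr_E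
      algebra_simps)

text \<open>A single pair is expanded into monomials, \<open>P\<close> before \<open>Q\<close>, with
  the other pairs held fixed; the monomials of \<open>P\<close> are nonempty by the definition of
  \<open>AA\<close>.\<close>

lemma fac_err_extend:
  assumes P: "P \<in> AA" and Q: "Q \<in> BB"
    and mon: "\<And>u v. u \<noteq> [] \<Longrightarrow> fac_err (ps @ (monomial (embL u), monomial (embR v)) # qs) \<longlonglongrightarrow> 0"
  shows "fac_err (ps @ (P, Q) # qs) \<longlonglongrightarrow> 0"
proof -
  have 1: "fac_err (ps @ (P, monomial (embR v)) # qs) \<longlonglongrightarrow> 0" for v
  proof (rule starpoly_span[of "\<lambda>P. fac_err (ps @ (P, monomial (embR v)) # qs) \<longlonglongrightarrow> 0"])
    fix w assume "w \<in> Poly_Mapping.keys P"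
    then have "w \<noteq> []" "\<forall>(v, s)\<in>set w. isl v" using P by (auto simp: AA_def)
    moreover from all_isl_embL[OF this(2)] obtain u where u: "w = embL u" by blast
    ultimately show "fac_err (ps @ (monomial w, monomial (embR v)) # qs) \<longlonglongrightarrow> 0"
      unfolding u by (intro mon) (auto simp: embL_def)
  next
    show "fac_err (ps @ (0, monomial (embR v)) # qs) \<longlonglongrightarrow> 0"
    proof -
      have "fac_err (ps @ (0, monomial (embR v)) # qs) = (\<lambda>n. 0)" by (simp add: fun_eq_iff fac_err_linear)
      then show ?thesis by simp
    qed
  next
    fix P1 P2
    assume "fac_err (ps @ (P1, monomial (embR v)) # qs) \<longlonglongrightarrow> 0" "fac_err (ps @ (P2, monomial (embR v)) # qs) \<longlonglongrightarrow> 0"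
    from tendsto_add[OF this] show "fac_err (ps @ (P1 + P2, monomial (embR v)) # qs) \<longlonglongrightarrow> 0"
      unfolding fac_err_linear(1)[symmetric] by simp
  next
    fix c P1
    assume "fac_err (ps @ (P1, monomial (embR v)) # qs) \<longlonglongrightarrow> 0"
    from tendsto_mult_left[OF this, of c] show "fac_err (ps @ (pscale c P1, monomial (embR v)) # qs) \<longlonglongrightarrow> 0"
      unfolding fac_err_linear(2)[symmetric] by simp
  qed
  show ?thesis
  proof (rule starpoly_span[of "\<lambda>Q. fac_err (ps @ (P, Q) # qs) \<longlonglongrightarrow> 0"])
    fix w assume "w \<in> Poly_Mapping.keys Q"
    then have "\<forall>(v, s)\<in>set w. \<not> isl v" using Q by (auto simp: BB_def)
    from no_isl_embR[OF this] show "fac_err (ps @ (P, monomial w) # qs) \<longlonglongrightarrow> 0" using 1 by auto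
  next
    show "fac_err (ps @ (P, 0) # qs) \<longlonglongrightarrow> 0"
    proof -
      have "fac_err (ps @ (P, 0) # qs) = (\<lambda>n. 0)" by (simp add: fun_eq_iff fac_err_linear)
      then show ?thesis by simp
    qed
  next
    fix P1 P2
    assume "fac_err (ps @ (P, P1) # qs) \<longlonglongrightarrow> 0" "fac_err (ps @ (P, P2) # qs) \<longlonglongrightarrow> 0"
    from tendsto_add[OF this] show "fac_err (ps @ (P, P1 + P2) # qs) \<longlonglongrightarrow> 0"
      unfolding fac_err_linear(4)[symmetric] by simp
  next
    fix c P1
    assume "fac_err (ps @ (P, P1) # qs) \<longlonglongrightarrow> 0"
    from tendsto_mult_left[OF this, of c] show "fac_err (ps @ (P, pscale c P1) # qs) \<longlonglongrightarrow> 0"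
      unfolding fac_err_linear(5)[symmetric] by simp
  qed
qed

text \<open>General pairs stand on the left and pairs of monomials on the right. Each step expands
  the last general pair and hands its monomials over to \<open>q\<close>, until
  \<open>fac_err_pairs\<close> applies.\<close>

lemma fac_err_tendsto:
  assumes "set ps \<subseteq> AA \<times> BB" "\<And>u v. (u, v) \<in> set q \<Longrightarrow> u \<noteq> []"
  shows "fac_err (ps @ pairs q) \<longlonglongrightarrow> 0"
  using assms
proof (induction ps arbitrary: q rule: rev_induct)
  case Nil
  then show ?case using fac_err_pairs by simp
next
  case (snoc p ps)
  obtain P Q where p: "p = (P, Q)" by (cases p)
  have "fac_err (ps @ (P, Q) # pairs q) \<longlonglongrightarrow> 0"
  proof (rule fac_err_extend)
    fix u v :: "(nat \<times> bool) list" assume "u \<noteq> []"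
    then have "fac_err (ps @ pairs ((u, v) # q)) \<longlonglongrightarrow> 0"
      using snoc.prems by (intro snoc.IH) auto
    then show "fac_err (ps @ (monomial (embL u), monomial (embR v)) # pairs q) \<longlonglongrightarrow> 0"
      by (simp add: pairs_def)
  qed (use snoc.prems p in auto)
  then show ?case by (simp add: p)
qed

lemma prod_list_AA: "set Ps \<subseteq> AA \<Longrightarrow> Ps \<noteq> [] \<Longrightarrow> prod_list Ps \<in> D"
  using AA_D by (cases Ps) (auto intro: D_ideal)

lemma interleave_D: "set ps \<subseteq> AA \<times> BB \<Longrightarrow> ps \<noteq> [] \<Longrightarrow> prod_list (interleave ps) \<in> D"
  using AA_D by (cases ps) (auto intro!: D_ideal(1))

lemma \<omega>_factorizes:
  assumes ps: "set ps \<subseteq> AA \<times> BB" "ps \<noteq> []"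
  shows "\<omega> (prod_list (interleave ps)) = \<omega> (prod_list (map fst ps)) * (\<Prod>(a, b)\<leftarrow>ps. \<tau> b)"
proof -
  have "prod_list (map fst ps) \<in> D"
    using ps by (intro prod_list_AA) auto
  note 1 = lim_\<omega>[OF this]
  have 2: "(\<lambda>n. \<Prod>(a, b)\<leftarrow>ps. tr (E n b)) \<longlonglongrightarrow> (\<Prod>(a, b)\<leftarrow>ps. \<tau> b)"
    by (induction ps) (auto simp: split_beta intro!: tendsto_mult lim_\<tau>)
  have "fac_err (ps @ pairs []) \<longlonglongrightarrow> 0" by (rule fac_err_tendsto) (use ps in auto)
  then have "fac_err ps \<longlonglongrightarrow> 0" by (simp add: pairs_def)
  from tendsto_add[OF this tendsto_mult[OF 1 2]]
  have "(\<lambda>n. Tr (E n (prod_list (interleave ps)))) \<longlonglongrightarrow> \<omega> (prod_list (map fst ps)) * (\<Prod>(a, b)\<leftarrow>ps. \<tau> b)"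
    by (simp add: fac_err_def)
  then show ?thesis using lim_\<omega>[OF interleave_D[OF ps]] by (rule LIMSEQ_unique[symmetric])
qed

lemma gen_star_subalgebra_subset: "star_subalgebra C T \<Longrightarrow> S \<subseteq> T \<Longrightarrow> gen_star_subalgebra C S \<subseteq> T"
  by (auto simp: gen_star_subalgebra_def)

text \<open>The subalgebra \<open>T\<close> ensures that the intersection runs over a nonempty
  family; an empty one would yield the whole type, which may exceed the carrier.\<close>

lemma star_subalgebra_gen:
  assumes "star_subalgebra C T" "S \<subseteq> T"
  shows "star_subalgebra C (gen_star_subalgebra C S)"
  unfolding star_subalgebra_def linear_subspace_def
proof (intro conjI ballI allI)
  show "gen_star_subalgebra C S \<subseteq> carrier C"
    using gen_star_subalgebra_subset[OF assms] assms(1)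
    by (auto simp: star_subalgebra_def linear_subspace_def)
qed (auto simp: gen_star_subalgebra_def star_subalgebra_def linear_subspace_def)

definition xvar :: "nat \<Rightarrow> ncpoly" where "xvar i = monomial [(Inl i, False)]"

definition yvar :: "nat \<Rightarrow> ncpoly" where "yvar j = monomial [(Inr j, False)]"

lemma cyclically_monotone_limit:
  "cyclically_monotone_families free_alg D \<omega> \<tau> k xvar l yvar"
proof -
  define GA where "GA = gen_star_subalgebra free_alg (xvar ` {..<k})"
  define GB where "GB = gen_star_subalgebra free_alg (insert \<one>\<^bsub>free_alg\<^esub> (yvar ` {..<l}))"
  have xs: "xvar ` {..<k} \<subseteq> AA" by (auto simp: xvar_def AA_def monomial_def)
  have ys: "insert \<one>\<^bsub>free_alg\<^esub> (yvar ` {..<l}) \<subseteq> BB"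
    by (auto simp: yvar_def BB_def monomial_def zero_list_def)
  have GA: "GA \<subseteq> AA" "star_subalgebra free_alg GA"
    unfolding GA_def using gen_star_subalgebra_subset[OF AA_subalgebra xs] star_subalgebra_gen[OF AA_subalgebra xs] by auto
  have GB: "GB \<subseteq> BB" "star_subalgebra free_alg GB" "1 \<in> GB"
    unfolding GB_def using gen_star_subalgebra_subset[OF BB_subalgebra ys] star_subalgebra_gen[OF BB_subalgebra ys]
    by (auto simp: gen_star_subalgebra_def)
  have "ideal_over free_alg GB GA \<subseteq> D"
  proof -
    have "alg_prod free_alg (b\<^sub>0 # interleave ps) \<in> D" if "ps \<noteq> []" "set ps \<subseteq> GA \<times> GB" for b\<^sub>0 ps
      using interleave_D[of ps] that GA(1) GB(1) by (force simp: alg_prod_free_alg intro: D_ideal)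
    moreover have "linear_subspace free_alg D" using D_subalgebra by (simp add: star_subalgebra_def)
    ultimately show ?thesis unfolding ideal_over_def lin_span_def by blast
  qed
  moreover have "\<omega> (alg_prod free_alg (interleave ps)) = \<omega> (alg_prod free_alg (map fst ps)) * (\<Prod>(a, b)\<leftarrow>ps. \<tau> b)"
    if "ps \<noteq> []" "set ps \<subseteq> GA \<times> GB" for ps
    unfolding alg_prod_free_alg using that GA(1) GB(1) by (intro \<omega>_factorizes) auto
  ultimately show ?thesis
    unfolding cyclically_monotone_families_def cyclically_monotone_def GA_def[symmetric] GB_def[symmetric]
    using GA GB by auto
qed

lemma ncpoly_eval_free_alg: "ncpoly_eval free_alg xvar yvar P = P"
proof -
  have "word_eval free_alg (case_sum xvar yvar) w = monomial w" for w
    by (rule word_eval_free_alg) (auto simp: xvar_def yvar_def split: sum.split)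
  then have "ncpoly_eval free_alg xvar yvar P = (\<Sum>w\<in>Poly_Mapping.keys P. pscale (Poly_Mapping.lookup P w) (monomial w))"
    by (simp add: ncpoly_eval_def finsum_free_alg)
  then show ?thesis by (simp add: starpoly_eq_sum[symmetric])
qed

text \<open>A word without x-letters keeps its coefficient in \<open>subst_x_zero P\<close>, so none
  can occur in \<open>P\<close>.\<close>

lemma subst_x_zero_D:
  assumes "subst_x_zero P = 0"
  shows "P \<in> D"
proof -
  have "has_x v" if v: "v \<in> Poly_Mapping.keys P" for v
  proof (rule ccontr)
    assume nx: "\<not> has_x v"
    have "Poly_Mapping.lookup (subst_x_zero P) v = (\<Sum>w\<in>Poly_Mapping.keys P. if w = v then Poly_Mapping.lookup P v else 0)"
      unfolding subst_x_zero_def lookup_sum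
      using nx by (intro sum.cong) (auto simp: lookup_single when_def has_x_def)
    also have "\<dots> = Poly_Mapping.lookup P v" using v by simp
    finally show False using assms v by (simp add: in_keys_iff)
  qed
  then show ?thesis by (simp add: D_def)
qed

end

section \<open>The almost sure limit\<close>

lemma wmon_eq_zero:
  assumes f: "\<And>v. f v \<in> carrier_mat n n" and v: "(v, s) \<in> set w" "f v = 0\<^sub>m n n"
  shows "wmon n f w = 0\<^sub>m n n"
  using v(1)
proof (induction w)
  case (Cons p w)
  interpret S: square_matrices n .
  have c: "wmon n f w \<in> carrier_mat n n" by (rule wmon_carrier) (rule f)
  obtain u t where p: "p = (u, t)" by (cases p)
  show ?case
  proof (cases "u = v")
    case True
    then show ?thesis using c v(2) by (simp add: p)
  next
    case False
    then have "wmon n f w = 0\<^sub>m n n" using Cons p by auto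
    then show ?thesis using f[of u] by (simp add: p)
  qed
qed simp

text \<open>
  The hypotheses say nothing about variables beyond the given ones or about dimension \<open>0\<close>, so
  the families are extended by zero.
\<close>

definition pad :: "nat \<Rightarrow> (nat \<Rightarrow> nat \<Rightarrow> complex mat) \<Rightarrow> nat \<Rightarrow> nat \<Rightarrow> complex mat" where
  "pad k A n i = (if n \<ge> 1 \<and> i < k then A n i else 0\<^sub>m n n)"

lemma pad_carrier:
  "(\<And>n i. n \<ge> 1 \<Longrightarrow> i < k \<Longrightarrow> A n i \<in> carrier_mat n n) \<Longrightarrow> pad k A n i \<in> carrier_mat n n"
  by (auto simp: pad_def)

text \<open>A word with a variable out of range evaluates to zero at every \<open>n\<close>. On all
  other words the padding changes nothing for n at least 1, and the limit is the one given by
  convergence in distribution.\<close>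

lemma convergent_pad:
  assumes conv: "converges_in_distribution k matrix_alg (\<lambda>n. \<phi>) A C \<omega> a"
    and A: "\<And>n i. n \<ge> 1 \<Longrightarrow> i < k \<Longrightarrow> A n i \<in> carrier_mat n n"
    and w: "w \<noteq> []" and zero: "\<And>n. \<phi> (0\<^sub>m n n) = 0"
  shows "convergent (\<lambda>n. \<phi> (wmon n (pad k A n) w))"
proof (cases "\<forall>(i, s)\<in>set w. i < k")
  case True
  then have "(\<lambda>n. \<phi> (word_eval (matrix_alg n) (A n) w)) \<longlonglongrightarrow> \<omega> (word_eval C a w)"
    using conv w by (simp add: converges_in_distribution_def)
  moreover have "word_eval (matrix_alg n) (A n) w = wmon n (pad k A n) w" if "n \<ge> 1" for n
  proof -
    have "word_eval (matrix_alg n) (A n) w = word_eval (matrix_alg n) (pad k A n) w"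
      unfolding word_eval_def using True that
      by (intro arg_cong[of _ _ "alg_prod (matrix_alg n)"] map_cong) (auto simp: pad_def)
    also have "\<dots> = wmon n (pad k A n) w"
      by (rule word_eval_matrix_alg) (rule pad_carrier[OF A])
    finally show ?thesis .
  qed
  then have "\<forall>\<^sub>F n in sequentially. \<phi> (word_eval (matrix_alg n) (A n) w) = \<phi> (wmon n (pad k A n) w)"
    by (intro eventually_mono[OF eventually_ge_at_top[of 1]]) simp
  ultimately have "(\<lambda>n. \<phi> (wmon n (pad k A n) w)) \<longlonglongrightarrow> \<omega> (word_eval C a w)"
    by (rule Lim_transform_eventually)
  then show ?thesis by (rule convergentI)
next
  case False
  then obtain i s where i: "(i, s) \<in> set w" "\<not> i < k" by auto
  have "wmon n (pad k A n) w = 0\<^sub>m n n" for n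
    by (rule wmon_eq_zero[OF pad_carrier[OF A] i(1)]) (use i(2) in \<open>auto simp: pad_def\<close>)
  then show ?thesis by (simp add: zero convergent_const)
qed

text \<open>
  Centering a polynomial in the \<open>B\<^sub>j(n)\<close> subtracts its own trace at each \<open>n\<close>, so the coefficients
  have to depend on \<open>n\<close>.
\<close>

inductive_set bounded_span :: "(nat \<Rightarrow> nat \<Rightarrow> complex mat) \<Rightarrow> symbol set"
  for g :: "nat \<Rightarrow> nat \<Rightarrow> complex mat" where
  zero: "(\<lambda>n. 0\<^sub>m n n) \<in> bounded_span g"
| step: "b \<in> bounded_span g \<Longrightarrow> (\<And>n. cmod (c n) \<le> K) \<Longrightarrow>
    (\<lambda>n. c n \<cdot>\<^sub>m wmon n (g n) w + b n) \<in> bounded_span g"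

context
  fixes g :: "nat \<Rightarrow> nat \<Rightarrow> complex mat"
  assumes g: "\<And>n i. g n i \<in> carrier_mat n n"
begin

lemma wmon_g_carrier [simp]: "wmon n (g n) w \<in> carrier_mat n n"
  by (rule wmon_carrier) (rule g)

lemma bounded_span_carrier: "b \<in> bounded_span g \<Longrightarrow> b n \<in> carrier_mat n n"
  by (induction rule: bounded_span.induct) auto

lemma bounded_span_add:
  assumes "b \<in> bounded_span g" "d \<in> bounded_span g"
  shows "(\<lambda>n. b n + d n) \<in> bounded_span g"
  using assms(1)
proof (induction rule: bounded_span.induct)
  case zero
  then show ?case using assms(2) bounded_span_carrier[OF assms(2)] by (simp add: left_add_zero_mat)
next
  case (step b c K w)
  have "(\<lambda>n. c n \<cdot>\<^sub>m wmon n (g n) w + b n + d n) = (\<lambda>n. c n \<cdot>\<^sub>m wmon n (g n) w + (b n + d n))"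
    using bounded_span_carrier[OF step.hyps(1)] bounded_span_carrier[OF assms(2)]
    by (intro ext assoc_add_mat[of _ n n for n]) auto
  then show ?case using bounded_span.step[OF step.IH step.hyps(2)] by simp
qed

lemma bounded_span_smult:
  assumes "b \<in> bounded_span g" and t: "\<And>n. cmod (t n) \<le> B"
  shows "(\<lambda>n. t n \<cdot>\<^sub>m b n) \<in> bounded_span g"
  using assms(1)
proof (induction rule: bounded_span.induct)
  case zero
  have "(\<lambda>n. t n \<cdot>\<^sub>m 0\<^sub>m n n) = (\<lambda>n. 0\<^sub>m n n)" by auto
  then show ?case using bounded_span.zero by simp
next
  case (step b c K w)
  have "B \<ge> 0" using t[of 0] norm_ge_zero order_trans by blast
  have "cmod (t n * c n) \<le> B * K" for n
    unfolding norm_mult using t step.hyps(2) \<open>B \<ge> 0\<close> by (intro mult_mono) auto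
  from bounded_span.step[OF step.IH this]
  have "(\<lambda>n. (t n * c n) \<cdot>\<^sub>m wmon n (g n) w + t n \<cdot>\<^sub>m b n) \<in> bounded_span g" .
  moreover have "(t n * c n) \<cdot>\<^sub>m wmon n (g n) w + t n \<cdot>\<^sub>m b n = t n \<cdot>\<^sub>m (c n \<cdot>\<^sub>m wmon n (g n) w + b n)" for n
    using carrier_matD[OF wmon_g_carrier[of n w]] carrier_matD[OF bounded_span_carrier[OF step.hyps(1), of n]]
    by (intro eq_matI) (auto simp: algebra_simps)
  ultimately show ?case by simp
qed

lemma bounded_span_wmon: "(\<lambda>n. wmon n (g n) w) \<in> bounded_span g"
proof -
  have "(\<lambda>n. 1 \<cdot>\<^sub>m wmon n (g n) w + 0\<^sub>m n n) \<in> bounded_span g"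
    by (rule bounded_span.step[where K = 1, OF bounded_span.zero]) simp
  moreover have "1 \<cdot>\<^sub>m wmon n (g n) w + 0\<^sub>m n n = wmon n (g n) w" for n
    using carrier_matD[OF wmon_g_carrier[of n w]] by (intro eq_matI) auto
  ultimately show ?thesis by simp
qed

lemma bounded_span_wmon_mult:
  assumes "b \<in> bounded_span g"
  shows "(\<lambda>n. wmon n (g n) u * b n) \<in> bounded_span g"
  using assms
proof (induction rule: bounded_span.induct)
  case zero
  have "(\<lambda>n. wmon n (g n) u * 0\<^sub>m n n) = (\<lambda>n. 0\<^sub>m n n)"
    using right_mult_zero_mat[OF wmon_g_carrier] by auto
  then show ?case using bounded_span.zero by simp
next
  case (step b c K w)
  have "wmon n (g n) u * (c n \<cdot>\<^sub>m wmon n (g n) w + b n) = c n \<cdot>\<^sub>m wmon n (g n) (u @ w) + wmon n (g n) u * b n" for n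
  proof -
    interpret S: square_matrices n .
    have "wmon n (g n) (u @ w) = wmon n (g n) u * wmon n (g n) w" by (rule wmon_append) (rule g)
    then show ?thesis using bounded_span_carrier[OF step.hyps(1), of n] by (simp add: S.distribs S.smult_mults)
  qed
  then show ?case using bounded_span.step[where w = "u @ w", OF step.IH step.hyps(2)] by simp
qed

lemma bounded_span_mult:
  assumes "b \<in> bounded_span g" "d \<in> bounded_span g"
  shows "(\<lambda>n. b n * d n) \<in> bounded_span g"
  using assms(1)
proof (induction rule: bounded_span.induct)
  case zero
  have "(\<lambda>n. 0\<^sub>m n n * d n) = (\<lambda>n. 0\<^sub>m n n)"
    using left_mult_zero_mat[OF bounded_span_carrier[OF assms(2)]] by auto
  then show ?case using bounded_span.zero by simp
next
  case (step b c K w)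
  have "(c n \<cdot>\<^sub>m wmon n (g n) w + b n) * d n = c n \<cdot>\<^sub>m (wmon n (g n) w * d n) + b n * d n" for n
  proof -
    interpret S: square_matrices n .
    show ?thesis using bounded_span_carrier[OF step.hyps(1), of n] bounded_span_carrier[OF assms(2), of n]
      by (simp add: S.distribs S.smult_mults)
  qed
  then show ?case
    using bounded_span_add[OF bounded_span_smult[OF bounded_span_wmon_mult[OF assms(2)] step.hyps(2)] step.IH] by simp
qed

lemma bounded_span_adjoint:
  assumes "b \<in> bounded_span g"
  shows "(\<lambda>n. mat_adjoint (b n)) \<in> bounded_span g"
  using assms
proof (induction rule: bounded_span.induct)
  case zero
  then show ?case using bounded_span.zero by simp
next
  case (step b c K w)
  have "mat_adjoint (c n \<cdot>\<^sub>m wmon n (g n) w + b n) = cnj (c n) \<cdot>\<^sub>m wmon n (g n) (wstar w) + mat_adjoint (b n)" for n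
  proof -
    have "wmon n (g n) (wstar w) = mat_adjoint (wmon n (g n) w)" by (rule wmon_wstar) (rule g)
    then show ?thesis using bounded_span_carrier[OF step.hyps(1), of n]
      by (simp add: adjoint_add[of _ n n] adjoint_smult[of _ n n])
  qed
  then show ?case using bounded_span.step[where c = "\<lambda>n. cnj (c n)" and K = K and w = "wstar w", OF step.IH] step.hyps(2) by simp
qed

text \<open>The coefficients are bounded and the traces of nonempty words converge; the empty word
  has normalized trace at most 1.\<close>

lemma bounded_span_tr:
  assumes "b \<in> bounded_span g" and conv: "\<And>w. w \<noteq> [] \<Longrightarrow> convergent (\<lambda>n. tr (wmon n (g n) w))"
  shows "\<exists>K. \<forall>n. cmod (tr (b n)) \<le> K"
  using assms(1)
proof (induction rule: bounded_span.induct)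
  case zero
  show ?case by (auto simp: tr_def intro!: exI[of _ 0])
next
  case (step b c K w)
  obtain L where L: "\<And>n. cmod (tr (b n)) \<le> L" using step.IH by blast
  have "\<exists>J. \<forall>n. cmod (tr (wmon n (g n) w)) \<le> J"
  proof (cases "w = []")
    case True
    have "cmod (tr (1\<^sub>m n)) \<le> 1" for n by (simp add: tr_def)
    then show ?thesis using True by auto
  next
    case False
    from convergent_imp_Bseq[OF conv[OF False]] show ?thesis by (auto simp: Bseq_def)
  qed
  then obtain J where J: "\<And>n. cmod (tr (wmon n (g n) w)) \<le> J" by blast
  have K: "K \<ge> 0" using step.hyps(2)[of 0] norm_ge_zero order_trans by blast
  have "cmod (tr (c n \<cdot>\<^sub>m wmon n (g n) w + b n)) \<le> K * J + L" for n
  proof -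
    have cs: "wmon n (g n) w \<in> carrier_mat n n" "b n \<in> carrier_mat n n"
      using bounded_span_carrier[OF step.hyps(1)] by auto
    then have "tr (c n \<cdot>\<^sub>m wmon n (g n) w + b n) = c n * tr (wmon n (g n) w) + tr (b n)"
      using carrier_matD[OF cs(1)] carrier_matD[OF cs(2)]
      by (simp add: tr_def Tr_add[of _ n] Tr_smult[of _ n] add_divide_distrib)
    also have "cmod \<dots> \<le> K * J + L"
      using step.hyps(2) J L K by (intro norm_triangle_mono) (auto simp: norm_mult intro!: mult_mono)
    finally show ?thesis .
  qed
  then show ?case by blast
qed

text \<open>The unit is the empty word, and its coefficient - tr (b n) is bounded by
  \<open>bounded_span_tr\<close>.\<close>

lemma bounded_span_center:
  assumes b: "b \<in> bounded_span g" and conv: "\<And>w. w \<noteq> [] \<Longrightarrow> convergent (\<lambda>n. tr (wmon n (g n) w))"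
  shows "(\<lambda>n. square_matrices.center n (b n)) \<in> bounded_span g"
proof -
  obtain K where K: "\<And>n. cmod (tr (b n)) \<le> K" using bounded_span_tr[OF assms] by blast
  have "(\<lambda>n. (- tr (b n)) \<cdot>\<^sub>m wmon n (g n) [] + b n) \<in> bounded_span g"
    by (rule bounded_span.step[where K = K, OF b]) (simp add: K)
  moreover have "(- tr (b n)) \<cdot>\<^sub>m wmon n (g n) [] + b n = square_matrices.center n (b n)" for n
    using carrier_matD[OF bounded_span_carrier[OF b, of n]]
    by (intro eq_matI) (auto simp: square_matrices.center_def)
  ultimately show ?thesis by simp
qed

end

locale haar_pair = prob_space M for M :: "'w measure" +
  fixes U :: "nat \<Rightarrow> 'w \<Rightarrow> complex mat" and gA gB :: "nat \<Rightarrow> nat \<Rightarrow> complex mat"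
  assumes U: "n \<ge> 1 \<Longrightarrow> haar_unitary M n (U n)"
    and gA: "gA n i \<in> carrier_mat n n" and gB: "gB n j \<in> carrier_mat n n"
    and conv_A: "w \<noteq> [] \<Longrightarrow> convergent (\<lambda>n. Tr (wmon n (gA n) w))"
    and conv_B: "w \<noteq> [] \<Longrightarrow> convergent (\<lambda>n. tr (wmon n (gB n) w))"
begin

text \<open>Only nonempty words: the unit has the unbounded trace \<open>n\<close>, against
  \<open>SA_bounded\<close>.\<close>

definition words_A :: "symbol set" where
  "words_A = {\<lambda>n. wmon n (gA n) w | w. w \<noteq> []}"

lemma words_A_mult:
  assumes "x \<in> words_A" "y \<in> words_A"
  shows "(\<lambda>n. x n * y n) \<in> words_A"
proof -
  obtain u v where uv: "x = (\<lambda>n. wmon n (gA n) u)" "y = (\<lambda>n. wmon n (gA n) v)" "u \<noteq> []"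
    using assms by (auto simp: words_A_def)
  have "wmon n (gA n) u * wmon n (gA n) v = wmon n (gA n) (u @ v)" for n
    by (rule wmon_append[symmetric]) (rule gA)
  then show ?thesis using uv by (auto simp: words_A_def intro!: exI[of _ "u @ v"])
qed

lemma words_A_adjoint:
  assumes "x \<in> words_A"
  shows "(\<lambda>n. mat_adjoint (x n)) \<in> words_A"
proof -
  obtain u where u: "x = (\<lambda>n. wmon n (gA n) u)" "u \<noteq> []" using assms by (auto simp: words_A_def)
  have "mat_adjoint (wmon n (gA n) u) = wmon n (gA n) (wstar u)" for n
    by (rule wmon_wstar[symmetric]) (rule gA)
  then show ?thesis using u by (auto simp: words_A_def intro!: exI[of _ "wstar u"])
qed

sublocale haar_unitary_sequence "\<lambda>n. distr M (borel_unitary n) (U n)" words_A "bounded_span gB" M U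
proof unfold_locales
  fix n :: nat assume n: "n \<ge> 1"
  show "normalized_haar_measure n (distr M (borel_unitary n) (U n))"
    using U[OF n] by (simp add: haar_unitary_def)
  show "U n \<in> measurable M (borel_unitary n)" using U[OF n] by (simp add: haar_unitary_def)
next
  show "x n \<in> carrier_mat n n" if "x \<in> words_A" for x n
    using that wmon_carrier[of "gA n" n] gA by (auto simp: words_A_def)
  show "\<exists>K. \<forall>n. cmod (Tr (x n)) \<le> K" if x: "x \<in> words_A" for x
  proof -
    obtain u where u: "x = (\<lambda>n. wmon n (gA n) u)" "u \<noteq> []" using x by (auto simp: words_A_def)
    from convergent_imp_Bseq[OF conv_A[OF u(2)]] show ?thesis by (auto simp: u(1) Bseq_def)
  qed
qed (use words_A_mult words_A_adjoint bounded_span_carrier[of gB, OF gB] bounded_span_mult[of gB, OF gB]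
    bounded_span_adjoint[of gB, OF gB] bounded_span_center[of gB, OF gB _ conv_B] bounded_span_tr[of gB, OF gB _ conv_B] in auto)

definition symbols :: "((nat \<times> bool) list \<times> (nat \<times> bool) list) list \<Rightarrow> (symbol \<times> symbol) list" where
  "symbols q = map (\<lambda>(u, v). (\<lambda>n. wmon n (gA n) u, \<lambda>n. wmon n (gB n) v)) q"

lemma symbols_gwords: "(\<And>u v. (u, v) \<in> set q \<Longrightarrow> u \<noteq> []) \<Longrightarrow> symbols q \<in> gwords"
  unfolding gwords_def using bounded_span_wmon[of gB, OF gB] by (auto simp: symbols_def words_A_def)

text \<open>The quantifier runs over the index words \<open>q\<close>, of which there are countably
  many, and not over the symbols: the sequences of coefficients in \<open>bounded_span\<close> would
  make these uncountable.\<close>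

lemma AE_factorizing_sample: "AE z in M. factorizing_sample gA gB (\<lambda>n. U n z)"
proof -
  have "AE z in M. \<forall>q. q \<noteq> [] \<longrightarrow> (\<forall>u v. (u, v) \<in> set q \<longrightarrow> u \<noteq> []) \<longrightarrow>
      (\<lambda>n. wtrace (symbols q) n z - Tr (letter_prod (symbols q) n) * tr_prod (symbols q) n) \<longlonglongrightarrow> 0"
    unfolding AE_all_countable
  proof
    fix q :: "((nat \<times> bool) list \<times> (nat \<times> bool) list) list"
    show "AE z in M. q \<noteq> [] \<longrightarrow> (\<forall>u v. (u, v) \<in> set q \<longrightarrow> u \<noteq> []) \<longrightarrow>
      (\<lambda>n. wtrace (symbols q) n z - Tr (letter_prod (symbols q) n) * tr_prod (symbols q) n) \<longlonglongrightarrow> 0"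
    proof (cases "q \<noteq> [] \<and> (\<forall>u v. (u, v) \<in> set q \<longrightarrow> u \<noteq> [])")
      case True
      then have "AE z in M. (\<lambda>n. wtrace (symbols q) n z - Tr (letter_prod (symbols q) n) * tr_prod (symbols q) n) \<longlonglongrightarrow> 0"
        by (intro wtrace_factorizes symbols_gwords) (auto simp: symbols_def)
      then show ?thesis by eventually_elim simp
    qed auto
  qed
  then show ?thesis
    using AE_space
  proof eventually_elim
    case (elim z)
    show ?case
    proof (unfold_locales, rule gA, rule gB, rule U_unitary, assumption, rule elim(2), rule conv_A, assumption, rule conv_B, assumption)
      fix q :: "((nat \<times> bool) list \<times> (nat \<times> bool) list) list"
      assume q: "q \<noteq> []" "\<And>u v. (u, v) \<in> set q \<Longrightarrow> u \<noteq> []"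
      have "inst n (symbols q) = map (\<lambda>(u, v). (wmon n (gA n) u, wmon n (gB n) v)) q" for n
        by (auto simp: inst_def symbols_def)
      moreover have "letter_prod (symbols q) n = wmon n (gA n) (concat (map fst q))" for n
      proof (induction q)
        case (Cons p q)
        have "wmon n (gA n) (fst p @ concat (map fst q)) = wmon n (gA n) (fst p) * wmon n (gA n) (concat (map fst q))"
          by (rule wmon_append) (rule gA)
        then show ?case using Cons by (auto simp: symbols_def letter_prod_def split_beta)
      qed (simp add: symbols_def letter_prod_def)
      moreover have "tr_prod (symbols q) n = (\<Prod>(u, v)\<leftarrow>q. tr (wmon n (gB n) v))" for n
        by (induction q) (auto simp: tr_prod_def symbols_def)
      moreover have "(\<lambda>n. wtrace (symbols q) n z - Tr (letter_prod (symbols q) n) * tr_prod (symbols q) n) \<longlonglongrightarrow> 0"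
        using elim(1) q by blast
      ultimately show "(\<lambda>n. square_matrices.wtr n (U n z) (map (\<lambda>(u, v). (wmon n (gA n) u, wmon n (gB n) v)) q)
         - Tr (wmon n (gA n) (concat (map fst q))) * (\<Prod>(u, v)\<leftarrow>q. tr (wmon n (gB n) v))) \<longlonglongrightarrow> 0"
        by (simp add: wtrace_def)
    qed
  qed
qed

end

theorem theorem4p3:
  fixes M :: "'w measure"
    and U :: "nat \<Rightarrow> 'w \<Rightarrow> complex mat"
    and k l :: nat
    and A B :: "nat \<Rightarrow> nat \<Rightarrow> complex mat"
    and a :: "nat \<Rightarrow> 'h :: complex_hilbert_space \<Rightarrow> 'h"
    and Q :: "'q star_alg" and \<tau> :: "'q \<Rightarrow> complex" and b :: "nat \<Rightarrow> 'q"
  assumes "prob_space M"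
    and "\<And>n i. n \<ge> 1 \<Longrightarrow> i < k \<Longrightarrow> A n i \<in> carrier_mat n n"
    and "\<And>n j. n \<ge> 1 \<Longrightarrow> j < l \<Longrightarrow> B n j \<in> carrier_mat n n"
    and "\<And>n. n \<ge> 1 \<Longrightarrow> haar_unitary M n (U n)"
    and "separable_space (euclidean :: 'h topology)"
    and "\<And>i. i < k \<Longrightarrow> a i \<in> trace_class"
    and "converges_in_distribution k matrix_alg (\<lambda>n. Tr) A trace_class_alg trace_op a"
    and "nc_prob_space Q \<tau>"
    and "\<And>j. j < l \<Longrightarrow> b j \<in> carrier Q"
    and "converges_in_distribution l matrix_alg (\<lambda>n. tr) B Q \<tau> b"
  shows "AE z in M. asymptotically_cyclically_monotone
           matrix_alg (\<lambda>n. carrier_mat n n) (\<lambda>n. Tr) (\<lambda>n. tr)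
           k A l (\<lambda>n j. U n z * B n j * mat_adjoint (U n z))"
proof -
  note A = assms(2) and B = assms(3)
  interpret haar_pair M U "pad k A" "pad l B"
  proof (intro haar_pair.intro haar_pair_axioms.intro)
    show "convergent (\<lambda>n. Tr (wmon n (pad k A n) w))" if "w \<noteq> []" for w
      using assms(7) A that by (rule convergent_pad) simp_all
    show "convergent (\<lambda>n. tr (wmon n (pad l B n) w))" if "w \<noteq> []" for w
      using assms(10) B that by (rule convergent_pad) (simp_all add: tr_def)
  qed (use assms pad_carrier[OF A] pad_carrier[OF B] in auto)
  from AE_factorizing_sample show ?thesis
    using AE_space
  proof eventually_elim
    case (elim z)
    interpret F: factorizing_sample "pad k A" "pad l B" "\<lambda>n. U n z" by (rule elim(1))
    define Bn where "Bn n j = U n z * B n j * mat_adjoint (U n z)" for n j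
    have Uc: "U n z \<in> carrier_mat n n" if "n \<ge> 1" for n
      using U_unitary[OF that elim(2)] by (simp add: unitary_group_def)
    have Bn: "Bn n j \<in> carrier_mat n n" if "n \<ge> 1" "j < l" for n j
      unfolding Bn_def using Uc[OF that(1)] B[OF that] by (intro mult_carrier_mat[of _ n n]) auto
    \<comment> \<open>A polynomial in \<open>ncpolys k l\<close> involves only variables in range,
      where the padded families agree with the given ones.\<close>
    have ev: "ncpoly_eval (matrix_alg n) (A n) (Bn n) P = F.E n P" if n: "n \<ge> 1" and P: "P \<in> ncpolys k l" for n P
      unfolding F.E_def
    proof (rule ncpoly_eval_matrix_alg[OF F.ev_carrier])
      fix w v s assume "w \<in> Poly_Mapping.keys P" "(v, s) \<in> set w"
      then have "v \<in> Inl ` {..<k} \<union> Inr ` {..<l}" using P by (auto simp: ncpolys_def)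
      then show "case_sum (A n) (Bn n) v = F.ev n v"
        using n by (auto simp: F.ev_def pad_def Bn_def)
    qed
    have "asymptotically_cyclically_monotone matrix_alg (\<lambda>n. carrier_mat n n) (\<lambda>n. Tr) (\<lambda>n. tr) k A l Bn"
      unfolding asymptotically_cyclically_monotone_def
    proof (intro conjI allI impI exI ballI)
      show "nc_prob_space_with_weight (matrix_alg n) (carrier_mat n n) Tr tr" if "1 \<le> n" for n
        using that by (rule nc_prob_space_with_weight_matrix_alg)
      show "A n i \<in> carrier_mat n n" if "1 \<le> n" "i < k" for n i using that by (rule A)
      show "Bn n j \<in> carrier (matrix_alg n)" if "1 \<le> n" "j < l" for n j using Bn[OF that] by simp
      \<comment> \<open>The witness is the free algebra with the functionals formed at the sample
        point \<open>z\<close>; its generators take the place of the limits of the two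
        families.\<close>
      show "nc_prob_space_with_weight free_alg F.D F.\<omega> F.\<tau>" by (rule F.limit_space)
      show "F.xvar i \<in> F.D" for i by (auto simp: F.xvar_def F.D_def monomial_def F.has_x_def)
      show "F.yvar j \<in> carrier free_alg" for j by simp
      show "cyclically_monotone_families free_alg F.D F.\<omega> F.\<tau> k F.xvar l F.yvar"
        by (rule F.cyclically_monotone_limit)
      fix P assume P: "P \<in> ncpolys k l" and P0: "subst_x_zero P = 0"
      show "ncpoly_eval (matrix_alg n) (A n) (Bn n) P \<in> carrier_mat n n" if "1 \<le> n" for n
        using ev[OF that P] by simp
      have "\<forall>\<^sub>F n in sequentially. Tr (F.E n P) = Tr (ncpoly_eval (matrix_alg n) (A n) (Bn n) P)"
        by (rule eventually_mono[OF eventually_ge_at_top[of 1]]) (simp add: ev[OF _ P])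
      then show "(\<lambda>n. Tr (ncpoly_eval (matrix_alg n) (A n) (Bn n) P)) \<longlonglongrightarrow> F.\<omega> (ncpoly_eval free_alg F.xvar F.yvar P)"
        unfolding F.ncpoly_eval_free_alg
        by (rule Lim_transform_eventually[OF F.lim_\<omega>[OF F.subst_x_zero_D[OF P0]]])
    qed
    then show ?case unfolding Bn_def .
  qed
qed

end
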